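(* For $A\in2^\omega$: $A$ is low for Martin-Löf randomness if and only if $A$ is low for density randomness.
   Context: Identify (irrational) reals in $[0,1]$ with their binary expansions in $2^\omega$. For an oracle $A$, a class $\mathcal C\subseteq[0,1]$ is $A$-effectively closed if its complement in $[0,1]$ is a union of an $A$-computably enumerable sequence of rational open intervals. The lower Lebesgue density of $\mathcal C$ at $z$ is $\underline\varrho(\mathcal C\mid z)=\liminf_{\gamma,\delta\to0^+}\frac{\lambda([z-\gamma,z+\delta]\cap\mathcal C)}{\gamma+\delta}$. A real $z$ is density random relative to $A$ if $z$ is Martin-Löf random relative to $A$ and $\underline\varrho(\mathcal C\mid z)=1$ for every $A$-effectively closed $\mathcal C$ containing $z$ (density random = density random relative to the empty oracle). $A$ is low for Martin-Löf randomness if every Martin-Löf random set is Martin-Löf random relative to $A$; $A$ is low for density randomness if every density random $Z$ is density random relative to $A$. *)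

theory Defs
  imports "HOL-Probability.Probability" "HOL-Library.Nat_Bijection"
begin

section \<open>Oracle computability\<close>

text \<open>
  Programs for the partial recursive functions relative to an oracle (Kleene's schemata together
  with a query instruction). Arities are not tracked in the syntax: a program applied to an
  argument list of unsuitable length simply has no value.
\<close>

datatype prog =
    Zero
  | Succ
  | Proj nat
  | Query
  | Comp prog "prog list"
  | PrimRec prog prog
  | Mu prog

text \<open>\<open>computes A p xs y\<close>: with oracle \<open>A\<close>, program \<open>p\<close> halts on input \<open>xs\<close> with output \<open>y\<close>.\<close>

inductive computes :: "(nat \<Rightarrow> bool) \<Rightarrow> prog \<Rightarrow> nat list \<Rightarrow> nat \<Rightarrow> bool" for A :: "nat \<Rightarrow> bool" where
  computes_Zero: "computes A Zero xs 0"
| computes_Succ: "computes A Succ [x] (Suc x)"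
| computes_Proj: "i < length xs \<Longrightarrow> computes A (Proj i) xs (xs ! i)"
| computes_Query: "computes A Query [x] (of_bool (A x))"
| computes_Comp:
    "list_all2 (\<lambda>g y. computes A g xs y) gs ys \<Longrightarrow> computes A f ys z \<Longrightarrow>
     computes A (Comp f gs) xs z"
| computes_PrimRec_0: "computes A f xs y \<Longrightarrow> computes A (PrimRec f g) (0 # xs) y"
| computes_PrimRec_Suc:
    "computes A (PrimRec f g) (n # xs) y \<Longrightarrow> computes A g (n # y # xs) z \<Longrightarrow>
     computes A (PrimRec f g) (Suc n # xs) z"
| computes_Mu:
    "computes A f (n # xs) 0 \<Longrightarrow> (\<forall>m<n. \<exists>y>0. computes A f (m # xs) y) \<Longrightarrow>
     computes A (Mu f) xs n"

definition ce_in :: "(nat \<Rightarrow> bool) \<Rightarrow> nat set \<Rightarrow> bool" where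
  "ce_in A W \<longleftrightarrow> (\<exists>p. W = {n. \<exists>y. computes A p [n] y})"

definition empty_oracle :: "nat \<Rightarrow> bool" where
  "empty_oracle = (\<lambda>_. False)"


section \<open>Martin-Loef randomness\<close>

definition cantor_measure :: "(nat \<Rightarrow> bool) measure" where
  "cantor_measure = Pi\<^sub>M UNIV (\<lambda>_. measure_pmf (bernoulli_pmf (1 / 2)))"

definition cylinder :: "bool list \<Rightarrow> (nat \<Rightarrow> bool) set" where
  "cylinder \<sigma> = {X. \<forall>i<length \<sigma>. X i = \<sigma> ! i}"

definition string_code :: "bool list \<Rightarrow> nat" where
  "string_code \<sigma> = list_encode (map of_bool \<sigma>)"

text \<open>
  A Martin-Loef test relative to \<open>A\<close>: the sets \<open>U n\<close> are \<open>\<Sigma>\<^sup>0\<^sub>1(A)\<close> uniformly in \<open>n\<close>, the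
  uniformity being that a single \<open>A\<close>-c.e. set of pairs (index, string) generates them all.
\<close>

definition ml_test :: "(nat \<Rightarrow> bool) \<Rightarrow> (nat \<Rightarrow> (nat \<Rightarrow> bool) set) \<Rightarrow> bool" where
  "ml_test A U \<longleftrightarrow>
     (\<exists>W. ce_in A W \<and>
       (\<forall>n. U n = (\<Union>\<sigma>\<in>{\<sigma>. prod_encode (n, string_code \<sigma>) \<in> W}. cylinder \<sigma>))) \<and>
     (\<forall>n. measure cantor_measure (U n) \<le> (1 / 2) ^ n)"

definition ml_random :: "(nat \<Rightarrow> bool) \<Rightarrow> (nat \<Rightarrow> bool) \<Rightarrow> bool" where
  "ml_random A Z \<longleftrightarrow> (\<forall>U. ml_test A U \<longrightarrow> Z \<notin> (\<Inter>n. U n))"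


section \<open>Density randomness\<close>

definition binary_real :: "(nat \<Rightarrow> bool) \<Rightarrow> real" where
  "binary_real Z = (\<Sum>n. of_bool (Z n) / 2 ^ Suc n)"

definition rat_of_code :: "nat \<Rightarrow> real" where
  "rat_of_code c = (case prod_decode c of (i, j) \<Rightarrow> of_int (int_decode i) / of_nat (Suc j))"

definition interval_of_code :: "nat \<Rightarrow> real set" where
  "interval_of_code c = (case prod_decode c of (a, b) \<Rightarrow> {rat_of_code a<..<rat_of_code b})"

text \<open>
  Complements are taken in \<open>[0,1]\<close>, so a rational open interval contributes its trace on \<open>[0,1]\<close>.
\<close>

definition effectively_closed :: "(nat \<Rightarrow> bool) \<Rightarrow> real set \<Rightarrow> bool" where
  "effectively_closed A C \<longleftrightarrow> C \<subseteq> {0..1} \<and>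
     (\<exists>W. ce_in A W \<and> {0..1} - C = {0..1} \<inter> (\<Union>c\<in>W. interval_of_code c))"

definition lower_density :: "real set \<Rightarrow> real \<Rightarrow> ereal" where
  "lower_density C z =
     Liminf (at_right 0 \<times>\<^sub>F at_right 0)
       (\<lambda>(\<gamma>, \<delta>). ereal (measure lborel ({z - \<gamma>..z + \<delta>} \<inter> C) / (\<gamma> + \<delta>)))"

text \<open>
  A sequence \<open>Z\<close> is identified with the real \<open>binary_real Z\<close>. The ambiguity at dyadic rationals is
  harmless because both expansions of a dyadic rational are computable, hence not random.
\<close>

definition density_random :: "(nat \<Rightarrow> bool) \<Rightarrow> (nat \<Rightarrow> bool) \<Rightarrow> bool" where
  "density_random A Z \<longleftrightarrow> ml_random A Z \<and>
     (\<forall>C. effectively_closed A C \<and> binary_real Z \<in> C \<longrightarrow> lower_density C (binary_real Z) = 1)"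


section \<open>Lowness\<close>

definition low_for_ml_randomness :: "(nat \<Rightarrow> bool) \<Rightarrow> bool" where
  "low_for_ml_randomness A \<longleftrightarrow> (\<forall>Z. ml_random empty_oracle Z \<longrightarrow> ml_random A Z)"

definition low_for_density_randomness :: "(nat \<Rightarrow> bool) \<Rightarrow> bool" where
  "low_for_density_randomness A \<longleftrightarrow> (\<forall>Z. density_random empty_oracle Z \<longrightarrow> density_random A Z)"

end

(*
  Both notions of lowness imply that every density random sequence is Martin-Loef random relative
  to A. The non-density-random sequences are covered by countably many null sets, each of which has
  unrelativised effectively open covers of arbitrarily small measure: for Martin-Loef tests this is
  clear, and for density it follows from the weak-type maximal inequality. Forcing with pairs of a
  cylinder and an effectively open set to be avoided then shows that every A-c.e. set of strings of
  finite total weight is contained in a c.e. set of strings of finite total weight.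

  Lowness for Martin-Loef randomness results by covering the minimal strings of all levels of an
  A-test and applying Solovay's criterion. For density, cover the minimal dyadic intervals of the
  complement of an A-effectively closed C containing Z. Since Z is random, only finitely many strings
  of the cover are prefixes of Z, and they can be removed without uncovering the complement. The
  remaining open dyadic intervals have an effectively closed complement, which contains Z and is,
  up to dyadic rationals, a subset of C.
*)

theory Submission
  imports Defs
begin

section \<open>Recursive functions relative to an oracle\<close>

text \<open>The obstacle is that the common consequence of both lowness notions concerns density
  random sequences only. A sequence that refutes it must fail an \<open>A\<close>-test and yet
  escape every null set on which density randomness fails. Each of these null sets has open covers
  of small measure, but no single test is assembled from them; hence a condition carries an open set
  to be avoided, which absorbs one more cover at each step while the condition keeps positive
  measure. The \<open>A\<close>-test to be failed comes from turning each code into an event whose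
  measure is its weight, with different codes read from disjoint bits. If the construction gets
  stuck, the stuck condition is given by finitely many data and describes the desired unrelativised
  cover, because measures of differences from an effectively open set are approximable from above.
  For density, the new closed set must contain \<open>Z\<close>, or the density hypothesis says
  nothing about it. Deleting prefixes of \<open>Z\<close> from the cover is harmless, since a
  minimal string of the complement of \<open>C\<close> that is a prefix of \<open>Z\<close> would
  put \<open>Z\<close> outside \<open>C\<close>.\<close>

class ctx =
  fixes vals :: "'a \<Rightarrow> nat list"
  assumes vals_length: "\<exists>k. \<forall>a. length (vals a) = k"
begin

text \<open>Any element serves as the sample, since all tuples of a type have the same length. A
  fixed length lets one program \<open>Proj i\<close> fetch a component from every tuple.\<close>

definition arity :: "'a itself \<Rightarrow> nat" where
  "arity _ = length (vals undefined)"

lemma length_vals [simp]: "length (vals a) = arity TYPE('a)"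
  using vals_length by (auto simp: arity_def)

end

instantiation nat :: ctx
begin
definition vals_nat :: "nat \<Rightarrow> nat list" where [simp]: "vals_nat n = [n]"
instance by standard simp
end

instantiation prod :: (ctx, ctx) ctx
begin
definition vals_prod :: "'a \<times> 'b \<Rightarrow> nat list" where [simp]: "vals_prod p = vals (fst p) @ vals (snd p)"
instance by standard simp
end

text \<open>
  A function between tuples of numbers is given by one program for each component of the value,
  run on the tuple of arguments. Tuples serve as typed contexts, in which a bound variable is
  one more component.
\<close>

definition rc :: "(nat \<Rightarrow> bool) \<Rightarrow> ('a::ctx \<Rightarrow> 'b::ctx) \<Rightarrow> bool" where
  "rc A f \<longleftrightarrow> (\<exists>ps. \<forall>x. list_all2 (\<lambda>p. computes A p (vals x)) ps (vals (f x)))"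

definition dec :: "(nat \<Rightarrow> bool) \<Rightarrow> ('a::ctx \<Rightarrow> bool) \<Rightarrow> bool" where
  "dec A P \<longleftrightarrow> rc A (\<lambda>x. of_bool (P x) :: nat)"

lemma rc_nat_iff:
  fixes f :: "'a::ctx \<Rightarrow> nat"
  shows "rc A f \<longleftrightarrow> (\<exists>p. \<forall>x. computes A p (vals x) (f x))"
proof
  assume "rc A f"
  then obtain ps where ps: "\<And>x. list_all2 (\<lambda>p. computes A p (vals x)) ps [f x]"
    by (auto simp: rc_def)
  from list_all2_lengthD[OF ps] obtain p where "ps = [p]"
    by (auto simp: length_Suc_conv)
  with ps show "\<exists>p. \<forall>x. computes A p (vals x) (f x)" by auto
next
  assume "\<exists>p. \<forall>x. computes A p (vals x) (f x)"
  then obtain p where "\<And>x. computes A p (vals x) (f x)" by auto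
  then show "rc A f" unfolding rc_def by (intro exI[of _ "[p]"]) auto
qed

named_theorems rc_intros

lemma rc_comp:
  assumes "rc A f" "rc A g"
  shows "rc A (\<lambda>x. f (g x))"
proof -
  obtain ps qs where ps: "\<And>x. list_all2 (\<lambda>p. computes A p (vals x)) ps (vals (f x))"
    and qs: "\<And>x. list_all2 (\<lambda>p. computes A p (vals x)) qs (vals (g x))"
    using assms by (auto simp: rc_def)
  show ?thesis unfolding rc_def
  proof (intro exI[of _ "map (\<lambda>p. Comp p qs) ps"] allI)
    fix x
    show "list_all2 (\<lambda>p. computes A p (vals x)) (map (\<lambda>p. Comp p qs) ps) (vals (f (g x)))"
      unfolding list_all2_map1
      by (rule list_all2_mono[OF ps[of "g x"]]) (rule computes_Comp[OF qs])
  qed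
qed

lemma rc_Proj:
  assumes "\<And>x. \<exists>us ws. vals x = us @ vals (f x) @ ws \<and> length us = k"
  shows "rc A f"
proof -
  \<comment> \<open>An arbitrary sample point that supplies the length of the selected
    segment.\<close>
  fix x0
  let ?l = "length (vals (f x0))"
  show ?thesis unfolding rc_def
  proof (intro exI[of _ "map Proj [k..<k + ?l]"] allI)
    fix x
    obtain us ws where u: "vals x = us @ vals (f x) @ ws" "length us = k" using assms by blast
    show "list_all2 (\<lambda>p. computes A p (vals x)) (map Proj [k..<k + ?l]) (vals (f x))"
    proof (rule list_all2_all_nthI)
      fix i assume "i < length (map Proj [k..<k + ?l])"
      then have i: "i < ?l" by simp
      have "vals x ! (k + i) = vals (f x) ! i"
        unfolding u(1) using i u(2) by (simp add: nth_append)
      moreover have "k + i < length (vals x)"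
        unfolding u(1) using i u(2) by simp
      ultimately show "computes A (map Proj [k..<k + ?l] ! i) (vals x) (vals (f x) ! i)"
        using i computes_Proj[of "k + i" "vals x" A] by simp
    qed simp
  qed
qed

lemma rc_id [rc_intros]: "rc A (\<lambda>x. x)"
  by (rule rc_Proj[of _ 0]) auto

lemma rc_fst_aux: "rc A (fst :: 'a::ctx \<times> 'b::ctx \<Rightarrow> 'a)"
  by (rule rc_Proj[of _ 0]) auto

lemma rc_snd_aux: "rc A (snd :: 'a::ctx \<times> 'b::ctx \<Rightarrow> 'b)"
  by (rule rc_Proj[of _ "arity TYPE('a)"]) (metis append_Nil2 length_vals vals_prod_def)

lemmas rc_fst [rc_intros] = rc_comp[OF rc_fst_aux]
lemmas rc_snd [rc_intros] = rc_comp[OF rc_snd_aux]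

lemma rc_Pair [rc_intros]:
  assumes "rc A f" "rc A g"
  shows "rc A (\<lambda>x. (f x, g x))"
proof -
  obtain ps qs where "\<And>x. list_all2 (\<lambda>p. computes A p (vals x)) ps (vals (f x))"
    "\<And>x. list_all2 (\<lambda>p. computes A p (vals x)) qs (vals (g x))"
    using assms by (auto simp: rc_def)
  then show ?thesis unfolding rc_def
    by (intro exI[of _ "ps @ qs"]) (auto intro: list_all2_appendI)
qed

lemma rc_Suc [rc_intros]:
  assumes "rc A f" shows "rc A (\<lambda>x. Suc (f x))"
proof -
  have "rc A Suc" unfolding rc_nat_iff by (auto intro: computes_Succ)
  from rc_comp[OF this assms] show ?thesis .
qed

lemma rc_const_nat: "rc A (\<lambda>x. c :: nat)"
proof (induction c)
  case 0
  show ?case unfolding rc_nat_iff by (auto intro: computes_Zero)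
qed (rule rc_Suc)

lemma rc_const [rc_intros]: "rc A (\<lambda>x::'a::ctx. c :: 'b::ctx)"
proof -
  have "\<exists>ps. \<forall>x::'a. list_all2 (\<lambda>p. computes A p (vals x)) ps ys" for ys
  proof (induction ys)
    case (Cons y ys)
    then obtain ps where ps: "\<And>x::'a. list_all2 (\<lambda>p. computes A p (vals x)) ps ys" by auto
    obtain p where p: "\<And>x::'a. computes A p (vals x) y"
      using rc_const_nat[of A y, where 'a='a] unfolding rc_nat_iff by auto
    show ?case by (rule exI[of _ "p # ps"]) (use p ps in auto)
  qed auto
  then show ?thesis by (auto simp: rc_def)
qed

lemma rc_oracle: "rc A (\<lambda>n. of_bool (A n) :: nat)"
  unfolding rc_nat_iff by (intro exI[of _ Query] allI) (simp add: computes_Query del: of_bool_eq_iff split del: split_of_bool)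

text \<open>The assumption on \<open>g\<close> lists its arguments in the order in which
  \<open>PrimRec\<close> hands them over: counter, previous value, parameters.\<close>

lemma rc_rec_nat [rc_intros]:
  fixes f :: "'a::ctx \<Rightarrow> nat"
  assumes h: "rc A h" and f: "rc A f" and g: "rc A (\<lambda>p. g (snd (snd p)) (fst p) (fst (snd p)))"
  shows "rc A (\<lambda>x. rec_nat (f x) (g x) (h x))"
proof -
  obtain pf where pf: "\<And>x. computes A pf (vals x) (f x)" using f unfolding rc_nat_iff by auto
  obtain pg where pg: "\<And>x. computes A pg (vals x) (g (snd (snd x)) (fst x) (fst (snd x)))"
    using g unfolding rc_nat_iff by auto
  have *: "computes A (PrimRec pf pg) (n # vals x) (rec_nat (f x) (g x) n)" for n x
  proof (induction n)
    case 0
    show ?case by (simp add: computes_PrimRec_0 pf)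
  next
    case (Suc n)
    show ?case
      using computes_PrimRec_Suc[OF Suc, of "g x n (rec_nat (f x) (g x) n)"]
        pg[of "(n, rec_nat (f x) (g x) n, x)"] by simp
  qed
  have "rc A (\<lambda>p. rec_nat (f (snd p)) (g (snd p)) (fst p))"
    unfolding rc_nat_iff by (rule exI[of _ "PrimRec pf pg"]) (use * in auto)
  from rc_comp[OF this, of "\<lambda>x. (h x, x)"] h show ?thesis
    by (simp add: rc_Pair rc_id)
qed

lemma rc_plus [rc_intros]:
  assumes "rc A f" "rc A g" shows "rc A (\<lambda>x. f x + g x :: nat)"
proof -
  have "rec_nat m (\<lambda>_. Suc) n = m + n" for m n by (induction n) auto
  then have "rc A (\<lambda>x. f x + g x) = rc A (\<lambda>x. rec_nat (f x) (\<lambda>n y. Suc y) (g x))" by simp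
  then show ?thesis using assms by (simp only:) (intro rc_intros)
qed

lemma rc_mult [rc_intros]:
  assumes "rc A f" "rc A g" shows "rc A (\<lambda>x. f x * g x :: nat)"
proof -
  have "rec_nat 0 (\<lambda>_ y. y + m) n = m * n" for m n :: nat by (induction n) auto
  then have "rc A (\<lambda>x. f x * g x) = rc A (\<lambda>x. rec_nat 0 (\<lambda>n y. y + f x) (g x))" by simp
  then show ?thesis using assms by (simp only:) (intro rc_intros rc_comp[OF assms(1)])
qed

lemma rc_power [rc_intros]:
  assumes "rc A f" "rc A g" shows "rc A (\<lambda>x. f x ^ g x :: nat)"
proof -
  have "rec_nat 1 (\<lambda>_ y. m * y) n = m ^ n" for m n :: nat by (induction n) auto
  then have "rc A (\<lambda>x. f x ^ g x) = rc A (\<lambda>x. rec_nat 1 (\<lambda>n y. f x * y) (g x))" by simp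
  then show ?thesis using assms by (simp only:) (intro rc_intros rc_comp[OF assms(1)])
qed

lemma rc_diff [rc_intros]:
  assumes "rc A f" "rc A g" shows "rc A (\<lambda>x. f x - g x :: nat)"
proof -
  \<comment> \<open>Recursion that ignores the previous value computes the predecessor; iterating
    the predecessor gives truncated subtraction.\<close>
  have p: "rec_nat 0 (\<lambda>n y. n) k = k - 1" for k :: nat by (induction k) auto
  have "rec_nat m (\<lambda>_ y. rec_nat 0 (\<lambda>n y. n) y) n = m - n" for m n :: nat by (induction n) (auto simp: p)
  then have "rc A (\<lambda>x. f x - g x) =
      rc A (\<lambda>x. rec_nat (f x) (\<lambda>n y. rec_nat 0 (\<lambda>n y. n) y) (g x))" by simp
  then show ?thesis using assms by (simp only:) (intro rc_intros)
qed

lemma rc_sum [rc_intros]: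
  fixes f :: "'a::ctx \<Rightarrow> nat \<Rightarrow> nat"
  assumes "rc A h" "rc A (\<lambda>p. f (fst p) (snd p))"
  shows "rc A (\<lambda>x. \<Sum>i<h x. f x i)"
proof -
  have e: "(\<Sum>i<n. f x i) = rec_nat 0 (\<lambda>i y. y + f x i) n" for x n by (induction n) auto
  have "rc A (\<lambda>p. f (snd (snd p)) (fst p))" 
    using rc_comp[OF assms(2), of "\<lambda>p. (snd (snd p), fst p)"] by (simp add: rc_intros)
  with assms show ?thesis unfolding e by (intro rc_intros)
qed

section \<open>Decidable predicates and functions with decidable graph\<close>

lemma dec_comp: "dec A P \<Longrightarrow> rc A g \<Longrightarrow> dec A (\<lambda>x. P (g x))"
  unfolding dec_def by (rule rc_comp)

lemma dec_comp2:
  "dec A (\<lambda>p. P (fst p) (snd p)) \<Longrightarrow> rc A f \<Longrightarrow> rc A g \<Longrightarrow> dec A (\<lambda>x. P (f x) (g x))"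
  using dec_comp[of A "\<lambda>p. P (fst p) (snd p)" "\<lambda>x. (f x, g x)"] by (simp add: rc_Pair)

lemma rc_comp2:
  "rc A (\<lambda>p. P (fst p) (snd p)) \<Longrightarrow> rc A f \<Longrightarrow> rc A g \<Longrightarrow> rc A (\<lambda>x. P (f x) (g x))"
  using rc_comp[of A "\<lambda>p. P (fst p) (snd p)" "\<lambda>x. (f x, g x)"] by (simp add: rc_Pair)

lemma rc_of_bool [rc_intros]: "dec A P \<Longrightarrow> rc A (\<lambda>x. of_bool (P x) :: nat)"
  by (simp add: dec_def)

lemma dec_iff_pos: "rc A f \<Longrightarrow> (\<And>x. P x \<longleftrightarrow> f x > (0::nat)) \<Longrightarrow> dec A P"
proof -
  assume f: "rc A f" and P: "\<And>x. P x \<longleftrightarrow> f x > (0::nat)"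
  \<comment> \<open>Truncated subtraction from \<open>1\<close>, done twice, sends every positive
    number to \<open>1\<close> and keeps \<open>0\<close>.\<close>
  have "of_bool (P x) = 1 - (1 - f x)" for x by (auto simp: P)
  then show ?thesis unfolding dec_def using f by (simp add: rc_intros)
qed

lemma dec_less [rc_intros]:
  assumes "rc A f" "rc A g" shows "dec A (\<lambda>x. f x < (g x :: nat))"
  by (rule dec_iff_pos[of _ "\<lambda>x. g x - f x"]) (use assms in \<open>intro rc_intros | force\<close>)+

lemma dec_le [rc_intros]:
  assumes "rc A f" "rc A g" shows "dec A (\<lambda>x. f x \<le> (g x :: nat))"
  by (rule dec_iff_pos[of _ "\<lambda>x. Suc (g x) - f x"]) (use assms in \<open>intro rc_intros | force\<close>)+

lemma dec_conj [rc_intros]: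
  assumes "dec A P" "dec A Q" shows "dec A (\<lambda>x. P x \<and> Q x)"
  by (rule dec_iff_pos[of _ "\<lambda>x. of_bool (P x) * of_bool (Q x)"]) (use assms in \<open>intro rc_intros | force\<close>)+

lemma dec_not [rc_intros]:
  assumes "dec A P" shows "dec A (\<lambda>x. \<not> P x)"
  by (rule dec_iff_pos[of _ "\<lambda>x. 1 - of_bool (P x)"]) (use assms in \<open>intro rc_intros | force\<close>)+

lemma dec_disj [rc_intros]:
  assumes "dec A P" "dec A Q" shows "dec A (\<lambda>x. P x \<or> Q x)"
  by (rule dec_iff_pos[of _ "\<lambda>x. of_bool (P x) + of_bool (Q x)"]) (use assms in \<open>intro rc_intros | force\<close>)+

lemma dec_eq [rc_intros]:
  assumes "rc A f" "rc A g" shows "dec A (\<lambda>x. f x = (g x :: nat))"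
  using assms unfolding order_eq_iff by (intro rc_intros)

lemma dec_const [rc_intros]: "dec A (\<lambda>x. b)"
  unfolding dec_def by (intro rc_intros)

lemma dec_bex [rc_intros]:
  assumes "rc A h" "dec A (\<lambda>p. P (fst p) (snd p))"
  shows "dec A (\<lambda>x. \<exists>i<h x::nat. P x i)"
proof (rule dec_iff_pos)
  show "rc A (\<lambda>x. \<Sum>i<h x. of_bool (P x i) :: nat)" using assms by (intro rc_intros)
  show "(\<exists>i<h x. P x i) \<longleftrightarrow> (\<Sum>i<h x. of_bool (P x i)) > (0::nat)" for x
    by (subst zero_less_iff_neq_zero, subst sum_eq_0_iff) auto
qed

lemma dec_bex_le [rc_intros]:
  assumes "rc A h" "dec A (\<lambda>p. P (fst p) (snd p))"
  shows "dec A (\<lambda>x. \<exists>i\<le>h x::nat. P x i)"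
  using assms unfolding less_Suc_eq_le[symmetric] by (intro rc_intros)

lemma dec_ball [rc_intros]:
  assumes "rc A h" "dec A (\<lambda>p. P (fst p) (snd p))"
  shows "dec A (\<lambda>x. \<forall>i<h x::nat. P x i)"
proof -
  have "dec A (\<lambda>x. \<not> (\<exists>i<h x. \<not> P x i))" using assms by (intro rc_intros)
  then show ?thesis by simp
qed

text \<open>A total function with decidable graph is computed by unbounded search for its value.
  Since \<open>Mu\<close> looks for a zero, the negated graph is programmed.\<close>

lemma rc_graph:
  fixes f :: "'a::ctx \<Rightarrow> nat"
  assumes "dec A (\<lambda>p. P (fst p) (snd p))" "\<And>x y. P x y \<longleftrightarrow> y = f x"
  shows "rc A f"
proof -
  have "rc A (\<lambda>p. of_bool (\<not> P (snd p) (fst p)) :: nat)"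
    by (intro rc_intros dec_comp2[OF assms(1)])
  then obtain q where q: "\<And>y x. computes A q (y # vals x) (of_bool (\<not> P x y))"
    unfolding rc_nat_iff by (metis append_Cons append_Nil fst_conv snd_conv vals_nat_def vals_prod_def)
  have "computes A (Mu q) (vals x) (f x)" for x
  proof (rule computes_Mu)
    show "computes A q (f x # vals x) 0" using q[of "f x" x] assms(2) by simp
    show "\<forall>m<f x. \<exists>y>0. computes A q (m # vals x) y"
      using q[of _ x] assms(2) by (metis less_irrefl_nat of_bool_eq(2) zero_less_one)
  qed
  then show ?thesis unfolding rc_nat_iff by blast
qed

lemma rc_div [rc_intros]:
  assumes "rc A f" "rc A g" shows "rc A (\<lambda>x. f x div g x :: nat)"
proof -
  have "rc A (\<lambda>p. fst p div snd p :: nat)"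
  proof (rule rc_graph)
    fix x :: "nat \<times> nat" and y
    \<comment> \<open>The first disjunct is the convention that division by \<open>0\<close> gives
      \<open>0\<close>.\<close>
    have "(b = 0 \<and> y = 0) \<or> (b > 0 \<and> y * b \<le> a \<and> a < Suc y * b) \<longleftrightarrow> y = a div b" for a b :: nat
    proof (cases "b = 0")
      case False
      moreover have "a < Suc (a div b) * b" "a div b * b \<le> a"
        using False dividend_less_div_times[of b a] by auto
      moreover have "y = a div b" if "y * b \<le> a" "a < Suc y * b"
        using that by (metis div_nat_eqI mult.commute)
      ultimately show ?thesis by blast
    qed simp
    then show "(snd x = 0 \<and> y = 0) \<or> (snd x > 0 \<and> y * snd x \<le> fst x \<and> fst x < Suc y * snd x)
      \<longleftrightarrow> y = fst x div snd x" .
  qed (intro rc_intros)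
  from rc_comp2[OF this assms] show ?thesis .
qed

lemma rc_mod [rc_intros]:
  assumes "rc A f" "rc A g" shows "rc A (\<lambda>x. f x mod g x :: nat)"
  unfolding modulo_nat_def using assms by (intro rc_intros)

lemma dec_even [rc_intros]: "rc A f \<Longrightarrow> dec A (\<lambda>x. even (f x :: nat))"
  unfolding even_iff_mod_2_eq_zero by (intro rc_intros)

lemma rc_prod_encode [rc_intros]:
  assumes "rc A f" shows "rc A (\<lambda>x. prod_encode (f x))"
proof -
  have "prod_encode p = (fst p + snd p) * Suc (fst p + snd p) div 2 + fst p" for p
    by (cases p) (simp add: prod_encode_def triangle_def)
  then show ?thesis using assms by (simp only:) (intro rc_intros)
qed

text \<open>Both components are bounded by the code, so the graph of each one is decidable by
  bounded search.\<close>

lemma rc_prod_decode [rc_intros]: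
  assumes "rc A f" shows "rc A (\<lambda>x. prod_decode (f x))"
proof -
  have "rc A (\<lambda>n. fst (prod_decode n))"
  proof (rule rc_graph)
    show "(\<exists>b\<le>x. prod_encode (y, b) = x) \<longleftrightarrow> y = fst (prod_decode x)" for x y
      by (metis fst_conv le_prod_encode_2 prod.collapse prod_decode_inverse prod_encode_inverse)
  qed (intro rc_intros)
  moreover have "rc A (\<lambda>n. snd (prod_decode n))"
  proof (rule rc_graph)
    show "(\<exists>a\<le>x. prod_encode (a, y) = x) \<longleftrightarrow> y = snd (prod_decode x)" for x y
      by (metis snd_conv le_prod_encode_1 prod.collapse prod_decode_inverse prod_encode_inverse)
  qed (intro rc_intros)
  ultimately have "rc A (\<lambda>n. (fst (prod_decode n), snd (prod_decode n)))" by (rule rc_Pair)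
  from rc_comp[OF this assms] show ?thesis by simp
qed

section \<open>Step-bounded evaluation and enumerability\<close>

text \<open>The value \<open>0\<close> stands for no output within \<open>s\<close> steps, and \<open>Suc y\<close> for output \<open>y\<close>.
  In the search of \<open>Mu\<close>, a state \<open>1\<close> means that some earlier value is missing, and
  \<open>Suc (Suc n)\<close> that \<open>n\<close> is the least zero.\<close>

fun evp :: "(nat \<Rightarrow> bool) \<Rightarrow> nat \<Rightarrow> prog \<Rightarrow> nat list \<Rightarrow> nat" where
  "evp A s Zero xs = 1"
| "evp A s Succ xs = (if length xs = 1 then Suc (Suc (hd xs)) else 0)"
| "evp A s (Proj i) xs = (if i < length xs then Suc (xs ! i) else 0)"
| "evp A s Query xs = (if length xs = 1 then Suc (of_bool (A (hd xs))) else 0)"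
| "evp A s (Comp f gs) xs =
    of_bool (\<forall>g\<in>set gs. evp A s g xs \<noteq> 0) * evp A s f (map (\<lambda>g. evp A s g xs - 1) gs)"
| "evp A s (PrimRec f g) xs = (if xs = [] then 0 else
    rec_nat (evp A s f (tl xs)) (\<lambda>m r. of_bool (r \<noteq> 0) * evp A s g (m # (r - 1) # tl xs)) (hd xs))"
| "evp A s (Mu f) xs =
    rec_nat 0 (\<lambda>n r. if r \<noteq> 0 then r else if evp A s f (n # xs) = 0 then 1
      else if evp A s f (n # xs) = 1 then Suc (Suc n) else 0) s - 1"

text \<open>An invariant of the search state, proved by induction on the number of steps. The final
  subtraction sends the states \<open>0\<close> (still searching) and \<open>1\<close> (stuck) both
  to the absence of a value.\<close>

lemma evp_Mu_iff: "evp A s (Mu f) xs = Suc n \<longleftrightarrow>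
    n < s \<and> evp A s f (n # xs) = 1 \<and> (\<forall>m<n. evp A s f (m # xs) > 1)"
proof -
  let ?e = "\<lambda>n. evp A s f (n # xs)"
  let ?r = "rec_nat (0::nat) (\<lambda>n r. if r \<noteq> 0 then r else if ?e n = 0 then 1
      else if ?e n = 1 then Suc (Suc n) else 0)"
  have "(?r t = 0 \<longleftrightarrow> (\<forall>m<t. ?e m > 1)) \<and>
    (\<forall>n. ?r t = Suc (Suc n) \<longleftrightarrow> n < t \<and> ?e n = 1 \<and> (\<forall>m<n. ?e m > 1))" for t
  proof (induction t)
    case (Suc t)
    show ?case
    proof (cases "?r t = 0")
      case True
      with Suc have *: "\<forall>m<t. ?e m > 1" and n: "\<And>n. \<not> (n < t \<and> ?e n = 1 \<and> (\<forall>m<n. ?e m > 1))"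
        by auto
      consider "?e t = 0" | "?e t = 1" | "?e t > 1" by linarith
      then show ?thesis
        by cases (use True * n in \<open>auto simp: less_Suc_eq\<close>)
    next
      case False
      with Suc have *: "\<not> (\<forall>m<t. ?e m > 1)" by auto
      have n: "\<And>n. ?r t = Suc (Suc n) \<longleftrightarrow> n < t \<and> ?e n = 1 \<and> (\<forall>m<n. ?e m > 1)" using Suc by auto
      from False have r: "?r (Suc t) = ?r t" by simp
      show ?thesis unfolding r n using * False by (auto simp: less_Suc_eq)
    qed
  qed simp
  moreover have "evp A s (Mu f) xs = Suc n \<longleftrightarrow> ?r s = Suc (Suc n)" by simp linarith
  ultimately show ?thesis by blast
qed

lemma evp_sound: "evp A s p xs = Suc y \<Longrightarrow> computes A p xs y"
proof (induction p arbitrary: xs y)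
  case (Comp f gs)
  then have d: "\<forall>g\<in>set gs. evp A s g xs \<noteq> 0" and
    f: "evp A s f (map (\<lambda>g. evp A s g xs - 1) gs) = Suc y"
    by (auto simp: of_bool_def split: if_splits)
  show ?case
  proof (rule computes_Comp)
    show "list_all2 (\<lambda>g. computes A g xs) gs (map (\<lambda>g. evp A s g xs - 1) gs)"
      unfolding list_all2_map2 by (rule list_all2_same[THEN iffD2]) (use d Comp.IH(2) in auto)
    show "computes A f (map (\<lambda>g. evp A s g xs - 1) gs) y" using Comp.IH(1) f by blast
  qed
next
  case (PrimRec f g)
  then obtain n ys where xs: "xs = n # ys" by (cases xs) auto
  have "rec_nat (evp A s f ys) (\<lambda>m r. of_bool (r \<noteq> 0) * evp A s g (m # (r - 1) # ys)) n = Suc y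
    \<Longrightarrow> computes A (PrimRec f g) (n # ys) y" for y n
  proof (induction n arbitrary: y)
    case 0
    then show ?case using PrimRec.IH(1) by (auto intro: computes_PrimRec_0)
  next
    case (Suc n)
    let ?r = "rec_nat (evp A s f ys) (\<lambda>m r. of_bool (r \<noteq> 0) * evp A s g (m # (r - 1) # ys)) n"
    from Suc.prems obtain z where z: "?r = Suc z" by (cases ?r) auto
    with Suc.prems have "evp A s g (n # z # ys) = Suc y" by simp
    with Suc.IH[OF z] PrimRec.IH(2) show ?case by (auto intro: computes_PrimRec_Suc)
  qed
  with PrimRec.prems show ?case by (simp add: xs)
next
  case (Mu f)
  from Mu.prems have *: "evp A s f (y # xs) = Suc 0" "\<forall>m<y. evp A s f (m # xs) > 1"
    by (auto simp: evp_Mu_iff simp del: evp.simps)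
  show ?case
  proof (rule computes_Mu)
    show "computes A f (y # xs) 0" using Mu.IH * by blast
    show "\<forall>m<y. \<exists>z>0. computes A f (m # xs) z"
    proof (intro allI impI)
      fix m assume "m < y"
      with * have "evp A s f (m # xs) = Suc (Suc (evp A s f (m # xs) - 2))" by auto
      from Mu.IH[OF this] show "\<exists>z>0. computes A f (m # xs) z" by blast
    qed
  qed
qed (auto simp: length_Suc_conv split: if_splits intro: computes.intros simp del: of_bool_eq_iff)

text \<open>Stated for all late stages rather than for some stage, so that finitely many
  subcomputations meet at a common stage.\<close>

lemma evp_complete: "computes A p xs y \<Longrightarrow> eventually (\<lambda>s. evp A s p xs = Suc y) sequentially"
proof (induction rule: computes.induct)
  case (computes_Comp xs gs ys f z)
  have "eventually (\<lambda>s. list_all2 (\<lambda>g y. evp A s g xs = Suc y) gs ys) sequentially"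
    using computes_Comp.IH(1)
  proof (induction rule: list_all2_induct)
    case (Cons g gs y ys)
    from Cons(1) have "eventually (\<lambda>s. evp A s g xs = Suc y) sequentially" by simp
    from eventually_conj[OF this Cons(3)] show ?case by simp
  qed simp
  with computes_Comp.IH(2) show ?case
  proof eventually_elim
    case (elim s)
    have "map (\<lambda>g. evp A s g xs - 1) gs = ys" "\<forall>g\<in>set gs. evp A s g xs \<noteq> 0"
      using elim(2) by (induction rule: list_all2_induct) auto
    with elim(1) show ?case by simp
  qed
next
  case (computes_PrimRec_Suc f g n xs y z)
  from computes_PrimRec_Suc.IH show ?case by eventually_elim simp
next
  case (computes_Mu f n xs)
  have "eventually (\<lambda>s. \<forall>m\<in>{..<n}. evp A s f (m # xs) > 1) sequentially"
  proof (rule eventually_ball_finite, simp, rule ballI)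
    fix m assume "m \<in> {..<n}"
    with computes_Mu.IH obtain y where "y > 0" "eventually (\<lambda>s. evp A s f (m # xs) = Suc y) sequentially"
      by auto
    from this(2) show "eventually (\<lambda>s. evp A s f (m # xs) > 1) sequentially"
      by eventually_elim (use \<open>y > 0\<close> in simp)
  qed
  moreover have "eventually (\<lambda>s. evp A s f (n # xs) = Suc 0) sequentially" 
    using computes_Mu.IH by simp
  moreover have "eventually (\<lambda>s. n < s) sequentially" by (rule eventually_gt_at_top)
  ultimately show ?case
    by eventually_elim (auto simp: evp_Mu_iff simp del: evp.simps)
qed (auto simp: hd_conv_nth)

section \<open>Recursiveness of step-bounded evaluation\<close>

text \<open>The induction over programs changes the number of arguments, which the typed contexts of
  \<open>rc\<close> fix by a type. Here the arity is the number \<open>k\<close>, over which an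
  induction can generalise.\<close>

definition lrec :: "(nat \<Rightarrow> bool) \<Rightarrow> nat \<Rightarrow> (nat list \<Rightarrow> nat) \<Rightarrow> bool" where
  "lrec A k f \<longleftrightarrow> (\<exists>p. \<forall>xs. length xs = k \<longrightarrow> computes A p xs (f xs))"

lemma lrec_cong: "lrec A k f \<Longrightarrow> (\<And>xs. length xs = k \<Longrightarrow> f xs = g xs) \<Longrightarrow> lrec A k g"
  unfolding lrec_def by metis

lemma lrec_nth: "i < k \<Longrightarrow> lrec A k (\<lambda>xs. xs ! i)"
  unfolding lrec_def by (intro exI[of _ "Proj i"]) (auto intro: computes_Proj)

lemma lrec_comp:
  assumes "lrec A n f" "\<And>h. h \<in> set hs \<Longrightarrow> lrec A k h" "length hs = n"
  shows "lrec A k (\<lambda>xs. f (map (\<lambda>h. h xs) hs))"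
proof -
  obtain p where p: "\<And>xs. length xs = n \<Longrightarrow> computes A p xs (f xs)"
    using assms(1) unfolding lrec_def by auto
  obtain q where q: "\<And>h xs. h \<in> set hs \<Longrightarrow> length xs = k \<Longrightarrow> computes A (q h) xs (h xs)"
    using assms(2) unfolding lrec_def by metis
  show ?thesis unfolding lrec_def
  proof (intro exI[of _ "Comp p (map q hs)"] allI impI)
    fix xs :: "nat list" assume xs: "length xs = k"
    show "computes A (Comp p (map q hs)) xs (f (map (\<lambda>h. h xs) hs))"
    proof (rule computes_Comp)
      show "list_all2 (\<lambda>g. computes A g xs) (map q hs) (map (\<lambda>h. h xs) hs)"
        unfolding list_all2_map1 list_all2_map2
        by (rule list_all2_same[THEN iffD2]) (use q xs in auto)
      show "computes A p (map (\<lambda>h. h xs) hs) (f (map (\<lambda>h. h xs) hs))" using p assms(3) by simp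
    qed
  qed
qed

lemma lrec_rc:
  assumes "rc A f" shows "lrec A 1 (\<lambda>xs. f (hd xs))"
proof -
  obtain p where "\<And>x. computes A p (vals x) (f x)" using assms unfolding rc_nat_iff by auto
  then show ?thesis unfolding lrec_def by (intro exI[of _ p]) (auto simp: length_Suc_conv)
qed

lemma lrec_rc1:
  assumes "rc A f" "lrec A k g" shows "lrec A k (\<lambda>xs. f (g xs))"
  using lrec_comp[OF lrec_rc[OF assms(1)], of "[g]"] assms(2) by simp

lemma lrec_const: "lrec A k (\<lambda>_. c)"
proof -
  obtain p where p: "\<And>x::nat. computes A p [x] c"
    using rc_const_nat[of A c, where 'a = nat] unfolding rc_nat_iff by auto
  have "\<forall>xs. length xs = k \<longrightarrow> computes A (Comp p [Zero]) xs c"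
    by (auto intro!: computes_Comp[of _ _ _ "[0]"] computes_Zero p)
  then show ?thesis unfolding lrec_def by blast
qed

lemma lrec_rc2:
  assumes "rc A (\<lambda>p. f (fst p) (snd p))" "lrec A k g" "lrec A k h"
  shows "lrec A k (\<lambda>xs. f (g xs) (h xs))"
proof -
  have "lrec A 2 (\<lambda>xs. f (xs ! 0) (xs ! 1))"
  proof -
    obtain p where "\<And>x. computes A p (vals x) (f (fst x) (snd x))"
      using assms(1) unfolding rc_nat_iff by auto
    then have "computes A p [x, y] (f x y)" for x y
      by (metis append_Cons append_Nil fst_conv snd_conv vals_nat_def vals_prod_def)
    then show ?thesis unfolding lrec_def
      by (intro exI[of _ p]) (auto simp: length_Suc_conv numeral_2_eq_2)
  qed
  from lrec_comp[OF this, of "[g, h]" k] assms show ?thesis by auto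
qed

lemma lrec_rec_nat:
  assumes "lrec A k f" "lrec A (Suc (Suc k)) g" "lrec A k h"
  shows "lrec A k (\<lambda>xs. rec_nat (f xs) (\<lambda>n y. g (n # y # xs)) (h xs))"
proof -
  obtain pf where pf: "\<And>xs. length xs = k \<Longrightarrow> computes A pf xs (f xs)"
    using assms(1) unfolding lrec_def by auto
  obtain pg where pg: "\<And>xs. length xs = Suc (Suc k) \<Longrightarrow> computes A pg xs (g xs)"
    using assms(2) unfolding lrec_def by auto
  have "computes A (PrimRec pf pg) (n # xs) (rec_nat (f xs) (\<lambda>n y. g (n # y # xs)) n)"
    if "length xs = k" for n xs
    by (induction n) (use that in \<open>auto intro!: computes_PrimRec_0 computes_PrimRec_Suc pf pg\<close>)
  then have "lrec A (Suc k) (\<lambda>xs. rec_nat (f (tl xs)) (\<lambda>n y. g (n # y # tl xs)) (hd xs))"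
    unfolding lrec_def by (intro exI[of _ "PrimRec pf pg"]) (auto simp: length_Suc_conv)
  moreover have "lrec A k h'" if "h' \<in> set (h # map (\<lambda>i xs. xs ! i) [0..<k])" for h'
    using that assms(3) by (auto intro: lrec_nth)
  moreover have "length (h # map (\<lambda>i xs. xs ! i) [0..<k]) = Suc k" by simp
  ultimately have "lrec A k (\<lambda>xs. (\<lambda>xs. rec_nat (f (tl xs)) (\<lambda>n y. g (n # y # tl xs)) (hd xs))
      (map (\<lambda>h. h xs) (h # map (\<lambda>i xs. xs ! i) [0..<k])))" by (rule lrec_comp)
  then have "lrec A k (\<lambda>xs. rec_nat (f (map (\<lambda>i. xs ! i) [0..<k]))
     (\<lambda>n y. g (n # y # map (\<lambda>i. xs ! i) [0..<k])) (h xs))"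
    by (simp add: comp_def)
  then show ?thesis by (rule lrec_cong) (metis map_nth)
qed

lemma lrec_reindex:
  assumes "lrec A n f" "length js = n" "\<And>j. j \<in> set js \<Longrightarrow> j < k"
  shows "lrec A k (\<lambda>xs. f (map (\<lambda>j. xs ! j) js))"
proof -
  have "lrec A k (\<lambda>xs. f (map (\<lambda>h. h xs) (map (\<lambda>j xs. xs ! j) js)))"
    by (rule lrec_comp[OF assms(1)]) (use assms in \<open>auto intro: lrec_nth\<close>)
  then show ?thesis by (simp add: comp_def)
qed

lemma rec_nat_arg_cong:
  "a = a' \<Longrightarrow> (\<And>m r. g m r = g' m r) \<Longrightarrow> n = n' \<Longrightarrow> rec_nat a g n = rec_nat a' g' n'"
  by presburger

lemma map_nth_tail2: "map ((!) (a # b # ys)) [2..<Suc (Suc (length ys))] = ys"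
  by (auto intro!: nth_equalityI simp: numeral_eq_Suc simp del: upt_Suc)

lemma map_nth_tail3: "map ((!) (a # b # c # ys)) [3..<Suc (Suc (Suc (length ys)))] = ys"
  by (auto intro!: nth_equalityI simp: numeral_eq_Suc simp del: upt_Suc)

lemma map_nth_tail4: "map ((!) (a # b # c # d # ys)) [4..<Suc (Suc (Suc (Suc (length ys))))] = ys"
  by (auto intro!: nth_equalityI simp: numeral_eq_Suc simp del: upt_Suc)

text \<open>Each program is treated separately by induction over its syntax, with the step bound as
  an additional first argument. \<open>k\<close> varies because \<open>Comp\<close>,
  \<open>PrimRec\<close> and \<open>Mu\<close> run their parts on lists of other lengths; at an
  unsuitable length the value is constantly \<open>0\<close>.\<close>

lemma lrec_evp: "lrec A (Suc k) (\<lambda>l. evp A (hd l) p (tl l))"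
proof (induction p arbitrary: k)
  case Zero
  show ?case by (simp add: lrec_const)
next
  case Succ
  show ?case
  proof (cases "k = 1")
    case True
    have "lrec A (Suc k) (\<lambda>l. Suc (Suc (l ! 1)))"
      using True by (intro lrec_rc1[of A "\<lambda>x. Suc (Suc x)"] lrec_nth) (simp_all add: rc_intros)
    then show ?thesis by (rule lrec_cong) (auto simp: True length_Suc_conv)
  next
    case False
    show ?thesis by (rule lrec_cong[OF lrec_const[of _ _ 0]]) (use False in auto)
  qed
next
  case (Proj i)
  show ?case
  proof (cases "i < k")
    case True
    have "lrec A (Suc k) (\<lambda>l. Suc (l ! Suc i))"
      using True by (intro lrec_rc1[of A "\<lambda>x. Suc x"] lrec_nth) (simp_all add: rc_intros)
    then show ?thesis by (rule lrec_cong) (use True in \<open>auto simp: length_Suc_conv\<close>)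
  next
    case False
    show ?thesis by (rule lrec_cong[OF lrec_const[of _ _ 0]]) (use False in auto)
  qed
next
  case Query
  show ?case
  proof (cases "k = 1")
    case True
    have "lrec A (Suc k) (\<lambda>l. Suc (of_bool (A (l ! 1))))"
      using True by (intro lrec_rc1[of A "\<lambda>x. Suc (of_bool (A x))"] lrec_nth rc_Suc rc_oracle) simp_all
    then show ?thesis by (rule lrec_cong) (auto simp: True length_Suc_conv)
  next
    case False
    show ?thesis by (rule lrec_cong[OF lrec_const[of _ _ 0]]) (use False in auto)
  qed
next
  case (Comp f gs)
  have "lrec A (Suc k) (\<lambda>l. of_bool (\<forall>g\<in>set hs. evp A (hd l) g (tl l) \<noteq> 0))" if "set hs \<subseteq> set gs" for hs
    using that
  proof (induction hs)
    case Nil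
    show ?case by (simp add: lrec_const)
  next
    case (Cons g hs)
    have "lrec A (Suc k) (\<lambda>l. (\<lambda>x y. of_bool (x \<noteq> 0) * y) (evp A (hd l) g (tl l))
        (of_bool (\<forall>g\<in>set hs. evp A (hd l) g (tl l) \<noteq> 0)))"
      by (rule lrec_rc2) (use Cons Comp.IH(2) in \<open>auto intro!: rc_intros\<close>)
    then show ?case by (rule lrec_cong) auto
  qed
  then have a: "lrec A (Suc k) (\<lambda>l. of_bool (\<forall>g\<in>set gs. evp A (hd l) g (tl l) \<noteq> 0))" by simp
  have 1: "lrec A (Suc k) (\<lambda>l. evp A (hd l) g (tl l) - 1)" if "g \<in> set gs" for g
    by (rule lrec_rc1[of A "\<lambda>x. x - 1"]) (use Comp.IH(2) that in \<open>auto intro!: rc_intros\<close>)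
  have "lrec A (Suc k) (\<lambda>l. (\<lambda>l. evp A (hd l) f (tl l)) (map (\<lambda>h. h l)
      ((\<lambda>l. l ! 0) # map (\<lambda>g l. evp A (hd l) g (tl l) - 1) gs)))"
    by (rule lrec_comp[OF Comp.IH(1)[of "length gs"]]) (use 1 in \<open>auto intro: lrec_nth\<close>)
  from lrec_rc2[of A "\<lambda>x y. x * y", OF _ a this]
  have "lrec A (Suc k) (\<lambda>l. of_bool (\<forall>g\<in>set gs. evp A (hd l) g (tl l) \<noteq> 0) *
     evp A (l ! 0) f (map (\<lambda>g. evp A (hd l) g (tl l) - 1) gs))"
    by (simp add: comp_def rc_intros)
  then show ?case by (rule lrec_cong) (auto simp: length_Suc_conv)
next
  case (PrimRec f g)
  show ?case
  proof (cases k)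
    case 0
    show ?thesis by (rule lrec_cong[OF lrec_const[of _ _ 0]]) (use 0 in \<open>auto simp: length_Suc_conv\<close>)
  next
    case (Suc j)
    \<comment> \<open>The list is step bound, recursion argument, parameters, so parameters start at
      position \<open>2\<close>. Inside the recursion, counter and previous value come in front, and
      parameters start at position \<open>4\<close>.\<close>
    have f: "lrec A (Suc k) (\<lambda>l. (\<lambda>l. evp A (hd l) f (tl l)) (map (\<lambda>i. l ! i) (0 # [2..<Suc k])))"
      by (rule lrec_reindex[OF PrimRec.IH(1)[of j]]) (auto simp: Suc)
    have 1: "lrec A (Suc (Suc (Suc k))) (\<lambda>l. l ! 1 - 1)"
      by (rule lrec_rc1[of A "\<lambda>x. x - 1", OF _ lrec_nth]) (simp_all add: rc_intros)
    have g: "lrec A (Suc (Suc (Suc k))) (\<lambda>l. (\<lambda>l. evp A (hd l) g (tl l)) (map (\<lambda>h. h l)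
       ((\<lambda>l. l ! 2) # (\<lambda>l. l ! 0) # (\<lambda>l. l ! 1 - 1) # map (\<lambda>i l. l ! i) [4..<Suc (Suc (Suc k))])))"
      by (rule lrec_comp[OF PrimRec.IH(2)[of "Suc (Suc j)"]]) (use 1 in \<open>auto simp: Suc intro: lrec_nth\<close>)
    have "lrec A (Suc (Suc (Suc k))) (\<lambda>l. of_bool (l ! 1 \<noteq> 0) *
       evp A (l ! 2) g (l ! 0 # (l ! 1 - 1) # map (\<lambda>i. l ! i) [4..<Suc (Suc (Suc k))]))"
      using lrec_rc2[of A "\<lambda>x y. of_bool (x \<noteq> 0) * y", OF _ lrec_nth[of 1] g]
      by (simp add: comp_def rc_intros del: upt_Suc)
    from lrec_rec_nat[OF f this lrec_nth[of 1]] Suc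
    have "lrec A (Suc k) (\<lambda>l. rec_nat (evp A (l ! 0) f (map (\<lambda>i. l ! i) [2..<Suc k]))
       (\<lambda>m r. of_bool (r \<noteq> 0) * evp A (l ! 0) g (m # (r - 1) #
          map (\<lambda>i. (m # r # l) ! i) [4..<Suc (Suc (Suc k))])) (l ! 1))"
      by (simp del: upt_Suc)
    then show ?thesis
      by (rule lrec_cong) (auto simp: Suc length_Suc_conv map_nth_tail4 map_nth_tail2 simp del: upt_Suc
        cong: rec_nat_arg_cong)
  qed
next
  case (Mu f)
  have e: "lrec A (Suc (Suc (Suc k))) (\<lambda>l. (\<lambda>l. evp A (hd l) f (tl l))
     (map (\<lambda>i. l ! i) (2 # 0 # [3..<Suc (Suc (Suc k))])))"
    by (rule lrec_reindex[OF Mu.IH[of "Suc k"]]) auto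
  \<comment> \<open>The transition of the search state, given counter, state and tested value. The
    equation below writes it arithmetically, so that recursiveness is immediate.\<close>
  define F where "F n r y = (if r \<noteq> 0 then r else if y = 0 then 1 else if y = 1 then Suc (Suc n) else 0)"
    for n r y :: nat
  have F: "F n r y = r + of_bool (r = 0) * (of_bool (y = 0) + of_bool (y = 1) * Suc (Suc n))" for n r y
    by (auto simp: F_def)
  have "rc A (\<lambda>p. F (fst p) (fst (snd p)) (snd (snd p)))"
    unfolding F by (intro rc_intros)
  then have "lrec A 3 (\<lambda>xs. F (xs ! 0) (xs ! 1) (xs ! 2))"
  proof -
    assume "rc A (\<lambda>p. F (fst p) (fst (snd p)) (snd (snd p)))"
    then obtain p where "\<And>x. computes A p (vals x) (F (fst x) (fst (snd x)) (snd (snd x)))"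
      unfolding rc_nat_iff by auto
    then have "computes A p [x, y, z] (F x y z)" for x y z
      by (metis append_Cons append_Nil fst_conv snd_conv vals_nat_def vals_prod_def)
    then show "lrec A 3 (\<lambda>xs. F (xs ! 0) (xs ! 1) (xs ! 2))" unfolding lrec_def
      by (intro exI[of _ p]) (auto simp: length_Suc_conv numeral_eq_Suc)
  qed
  have "lrec A (Suc (Suc (Suc k))) (\<lambda>l. (\<lambda>xs. F (xs ! 0) (xs ! 1) (xs ! 2)) (map (\<lambda>h. h l)
    [\<lambda>l. l ! 0, \<lambda>l. l ! 1,
     \<lambda>l. evp A (l ! 2) f (l ! 0 # map (\<lambda>i. l ! i) [3..<Suc (Suc (Suc k))])]))"
    by (rule lrec_comp[OF \<open>lrec A 3 _\<close>]) (use e in \<open>auto simp del: upt_Suc intro: lrec_nth\<close>)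
  then have "lrec A (Suc (Suc (Suc k))) (\<lambda>l. F (l ! 0) (l ! 1)
      (evp A (l ! 2) f (l ! 0 # map (\<lambda>i. l ! i) [3..<Suc (Suc (Suc k))])))"
    by (simp del: upt_Suc)
  from lrec_rec_nat[OF lrec_const[of _ _ 0] this lrec_nth[of 0]]
  have "lrec A (Suc k) (\<lambda>l. rec_nat 0 (\<lambda>n r. F n r (evp A (l ! 0) f (n # 
      map (\<lambda>i. (n # r # l) ! i) [3..<Suc (Suc (Suc k))]))) (l ! 0))"
    by (simp del: upt_Suc)
  from lrec_rc1[of A "\<lambda>x. x - 1", OF _ this]
  have "lrec A (Suc k) (\<lambda>l. rec_nat 0 (\<lambda>n r. F n r (evp A (l ! 0) f (n # 
      map (\<lambda>i. (n # r # l) ! i) [3..<Suc (Suc (Suc k))]))) (l ! 0) - 1)"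
    by (simp add: rc_intros del: upt_Suc)
  then show ?case
    by (rule lrec_cong) (auto simp: length_Suc_conv F_def map_nth_tail3 simp del: upt_Suc
      cong: rec_nat_arg_cong if_cong)
qed

section \<open>Enumerable predicates\<close>

definition re :: "(nat \<Rightarrow> bool) \<Rightarrow> ('a::ctx \<Rightarrow> bool) \<Rightarrow> bool" where
  "re A P \<longleftrightarrow> (\<exists>Q. dec A (\<lambda>p. Q (fst p) (snd p)) \<and> (\<forall>x. P x \<longleftrightarrow> (\<exists>s::nat. Q x s)))"

text \<open>Bounding the search by the stage makes the witness monotone. Conjunctions and number
  quantifiers can then be handled at one common stage.\<close>

lemma re_mono_witness:
  assumes "re A P"
  obtains Q where "dec A (\<lambda>p. Q (fst p) (snd p))" "\<And>x. P x \<longleftrightarrow> (\<exists>s::nat. Q x s)"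
    "\<And>x s t. Q x s \<Longrightarrow> s \<le> t \<Longrightarrow> Q x t"
proof -
  obtain Q where Q: "dec A (\<lambda>p. Q (fst p) (snd p))" "\<And>x. P x \<longleftrightarrow> (\<exists>s::nat. Q x s)"
    using assms unfolding re_def by auto
  show thesis
  proof (rule that[of "\<lambda>x s. \<exists>t\<le>s. Q x t"])
    show "dec A (\<lambda>p. \<exists>t\<le>snd p. Q (fst p) t)"
      by (intro rc_intros dec_comp2[OF Q(1)])
  qed (use Q(2) in \<open>auto intro: order_trans\<close>)
qed

lemma re_dec: "dec A P \<Longrightarrow> re A P"
  unfolding re_def by (rule exI[of _ "\<lambda>x s. P x"]) (auto intro!: dec_comp[of A P] rc_intros)

lemma re_comp:
  assumes "re A P" "rc A f"
  shows "re A (\<lambda>x. P (f x))"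
proof -
  obtain Q where Q: "dec A (\<lambda>p. Q (fst p) (snd p))" "\<And>x. P x \<longleftrightarrow> (\<exists>s::nat. Q x s)"
    using assms(1) unfolding re_def by auto
  have "dec A (\<lambda>p. Q (f (fst p)) (snd p))"
    by (intro rc_intros dec_comp2[OF Q(1)] rc_comp[OF assms(2)])
  with Q(2) show ?thesis unfolding re_def by (intro exI[of _ "\<lambda>x. Q (f x)"]) auto
qed

lemma re_comp2:
  "re A (\<lambda>p. P (fst p) (snd p)) \<Longrightarrow> rc A f \<Longrightarrow> rc A g \<Longrightarrow> re A (\<lambda>x. P (f x) (g x))"
  using re_comp[of A "\<lambda>p. P (fst p) (snd p)" "\<lambda>x. (f x, g x)"] by (simp add: rc_Pair)

lemma re_conj:
  assumes "re A P" "re A P'" shows "re A (\<lambda>x. P x \<and> P' x)"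
proof -
  obtain Q where Q: "dec A (\<lambda>p. Q (fst p) (snd p))" "\<And>x. P x \<longleftrightarrow> (\<exists>s::nat. Q x s)"
    "\<And>x s t. Q x s \<Longrightarrow> s \<le> t \<Longrightarrow> Q x t"
    using re_mono_witness[OF assms(1)] by metis
  obtain Q' where Q': "dec A (\<lambda>p. Q' (fst p) (snd p))" "\<And>x. P' x \<longleftrightarrow> (\<exists>s::nat. Q' x s)"
    "\<And>x s t. Q' x s \<Longrightarrow> s \<le> t \<Longrightarrow> Q' x t"
    using re_mono_witness[OF assms(2)] by metis
  have "P x \<and> P' x \<longleftrightarrow> (\<exists>s. Q x s \<and> Q' x s)" for x
    unfolding Q(2) Q'(2) using Q(3) Q'(3) by (meson nat_le_linear)
  moreover have "dec A (\<lambda>p. Q (fst p) (snd p) \<and> Q' (fst p) (snd p))"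
    by (intro rc_intros Q Q')
  ultimately show ?thesis unfolding re_def by (intro exI[of _ "\<lambda>x s. Q x s \<and> Q' x s"]) auto
qed

lemma re_ex:
  assumes "re A (\<lambda>p. P (fst p) (snd p))" shows "re A (\<lambda>x. \<exists>n::nat. P x n)"
proof -
  obtain Q where Q: "dec A (\<lambda>p. Q (fst p) (snd p))"
      "\<And>p. P (fst p) (snd p) \<longleftrightarrow> (\<exists>s::nat. Q p s)"
      "\<And>x s t. Q x s \<Longrightarrow> s \<le> t \<Longrightarrow> Q x t"
    using re_mono_witness[OF assms] by metis
  have "(\<exists>n. P x n) \<longleftrightarrow> (\<exists>s. \<exists>n\<le>s. Q (x, n) s)" for x
    using Q(2)[of "(x, _)"] Q(3) by simp (meson nat_le_linear)
  moreover have "dec A (\<lambda>p. \<exists>n\<le>snd p. Q (fst p, n) (snd p))"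
    by (intro rc_intros dec_comp2[OF Q(1)])
  ultimately show ?thesis unfolding re_def by (intro exI[of _ "\<lambda>x s. \<exists>n\<le>s. Q (x, n) s"]) auto
qed

text \<open>A normal form theorem: a computation halts iff step-bounded evaluation shows a value at
  some stage, and conversely an unbounded search over stages halts exactly on the members of
  \<open>W\<close>.\<close>

lemma ce_in_iff_re: "ce_in A W \<longleftrightarrow> re A (\<lambda>n. n \<in> W)"
proof
  assume "ce_in A W"
  then obtain p where W: "W = {n. \<exists>y. computes A p [n] y}" by (auto simp: ce_in_def)
  obtain q where q: "\<And>xs. length xs = 2 \<Longrightarrow> computes A q xs (evp A (hd xs) p (tl xs))"
    using lrec_evp[of A 1 p] unfolding lrec_def by (auto simp: numeral_2_eq_2)
  have e: "rc A (\<lambda>x. evp A (fst x) p [snd x])"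
    unfolding rc_nat_iff by (rule exI[of _ q]) (use q[of "[_, _]"] in auto)
  have "dec A (\<lambda>x. evp A (snd x) p [fst x] \<noteq> 0)"
    by (intro rc_intros rc_comp2[OF e])
  moreover have "(\<exists>y. computes A p [n] y) \<longleftrightarrow> (\<exists>s. evp A s p [n] \<noteq> 0)" for n
  proof
    assume "\<exists>y. computes A p [n] y"
    then obtain y where "computes A p [n] y" ..
    from evp_complete[OF this] obtain s where "evp A s p [n] = Suc y"
      by (auto simp: eventually_sequentially)
    then show "\<exists>s. evp A s p [n] \<noteq> 0" by (intro exI[of _ s]) simp
  next
    assume "\<exists>s. evp A s p [n] \<noteq> 0"
    then obtain s y where "evp A s p [n] = Suc y" by (metis not0_implies_Suc)
    from evp_sound[OF this] show "\<exists>y. computes A p [n] y" ..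
  qed
  ultimately show "re A (\<lambda>n. n \<in> W)" unfolding re_def W
    by (intro exI[of _ "\<lambda>n s. evp A s p [n] \<noteq> 0"]) auto
next
  assume "re A (\<lambda>n. n \<in> W)"
  then obtain Q where Q: "dec A (\<lambda>p. Q (fst p) (snd p))" "\<And>x. x \<in> W \<longleftrightarrow> (\<exists>s::nat. Q x s)"
    unfolding re_def by auto
  have "rc A (\<lambda>p. of_bool (\<not> Q (snd p) (fst p)) :: nat)"
    by (intro rc_intros dec_comp2[OF Q(1)])
  then obtain q where "\<forall>x. computes A q (vals x) (of_bool (\<not> Q (snd x) (fst x)))"
    unfolding rc_nat_iff by blast
  then have q: "computes A q [s, n] (of_bool (\<not> Q n s))" for s n
    by (drule_tac spec[of _ "(s, n)"]) simp
  have "n \<in> W \<longleftrightarrow> (\<exists>y. computes A (Mu q) [n] y)" for n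
  proof
    assume "n \<in> W"
    then have ex: "\<exists>s. Q n s" by (simp add: Q(2))
    define s where "s = (LEAST s. Q n s)"
    have "Q n s" using ex unfolding s_def by (rule LeastI_ex)
    moreover have "\<not> Q n t" if "t < s" for t using that not_less_Least unfolding s_def by blast
    ultimately have "computes A (Mu q) [n] s"
      using q[of s n] q[of _ n] by (intro computes_Mu) (auto, metis of_bool_eq(2) zero_less_one)
    then show "\<exists>y. computes A (Mu q) [n] y" ..
  next
    assume "\<exists>y. computes A (Mu q) [n] y"
    then obtain s where "computes A (Mu q) [n] s" ..
    from evp_complete[OF this] obtain t where "evp A t (Mu q) [n] = Suc s"
      by (auto simp: eventually_sequentially simp del: evp.simps)
    then have t: "evp A t q [s, n] = Suc 0" by (simp add: evp_Mu_iff del: evp.simps)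
    \<comment> \<open>Two computations of \<open>q\<close> on the same input agree at a late stage
      of \<open>evp\<close>; this supplies determinism of \<open>computes\<close>.\<close>
    from evp_complete[OF q[of s n]] obtain t' where "\<forall>t\<ge>t'. evp A t q [s, n] = Suc (of_bool (\<not> Q n s))"
      by (auto simp: eventually_sequentially)
    from evp_complete[OF evp_sound[OF t]] obtain u where "\<forall>t\<ge>u. evp A t q [s, n] = Suc 0"
      by (auto simp: eventually_sequentially)
    then have "Q n s" using \<open>\<forall>t\<ge>t'. _ t\<close> by (metis max.cobounded1 max.cobounded2 nat.inject of_bool_eq_0_iff)
    then show "n \<in> W" using Q(2) by blast
  qed
  then show "ce_in A W" unfolding ce_in_def by blast
qed

section \<open>Cantor space\<close>

text \<open>A string is represented by its length \<open>n\<close> and the number with these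
  \<open>n\<close> binary digits, most significant first. Truncation to length \<open>j\<close>
  becomes division by \<open>2 ^ (n - j)\<close>, and division by \<open>2 ^ n\<close> gives the
  left end of the dyadic interval of the string.\<close>

primrec pref :: "(nat \<Rightarrow> bool) \<Rightarrow> nat \<Rightarrow> nat" where
  "pref X 0 = 0"
| "pref X (Suc n) = 2 * pref X n + of_bool (X n)"

definition cyl :: "nat \<Rightarrow> nat \<Rightarrow> (nat \<Rightarrow> bool) set" where
  "cyl n m = {X. pref X n = m}"

lemma pref_less: "pref X n < 2 ^ n"
  by (induction n) auto

lemma pref_div: "j \<le> n \<Longrightarrow> pref X n div 2 ^ (n - j) = pref X j"
proof (induction n)
  case (Suc n)
  show ?case
  proof (cases "j = Suc n")
    case False
    then have "pref X (Suc n) div 2 ^ (Suc n - j) = (pref X (Suc n) div 2) div 2 ^ (n - j)"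
      using Suc.prems by (simp add: Suc_diff_le div_mult2_eq)
    also have "pref X (Suc n) div 2 = pref X n" by simp
    finally show ?thesis using Suc False by simp
  qed simp
qed simp

lemma odd_pref: "i < n \<Longrightarrow> odd (pref X n div 2 ^ (n - Suc i)) \<longleftrightarrow> X i"
  using pref_div[of "Suc i" n X] by simp

lemma pref_cong: "(\<And>i. i < n \<Longrightarrow> X i = Y i) \<Longrightarrow> pref X n = pref Y n"
  by (induction n) auto

lemma pref_eq_iff: "pref X n = pref Y n \<longleftrightarrow> (\<forall>i<n. X i = Y i)"
  by (metis odd_pref pref_cong)

lemma pref_surj: "m < 2 ^ n \<Longrightarrow> \<exists>X. pref X n = m"
proof (induction n arbitrary: m)
  case (Suc n)
  then obtain X where X: "pref X n = m div 2" by (metis less_mult_imp_div_less mult.commute power_Suc)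
  have "pref (X(n := odd m)) n = pref X n" by (rule pref_cong) auto
  then have "pref (X(n := odd m)) (Suc n) = m" using X by (simp add: of_bool_def)
  then show ?case by blast
qed simp

section \<open>The coin-tossing measure\<close>

abbreviation \<mu> :: "(nat \<Rightarrow> bool) set \<Rightarrow> real" where
  "\<mu> \<equiv> measure cantor_measure"

interpretation coin: product_prob_space "\<lambda>_::nat. measure_pmf (bernoulli_pmf (1 / 2))" UNIV
  by standard

interpretation cantor: prob_space cantor_measure
  unfolding cantor_measure_def by (rule prob_space_PiM) (rule prob_space_measure_pmf)

lemma space_cantor [simp]: "space cantor_measure = UNIV"
  by (simp add: cantor_measure_def space_PiM)

lemma measurable_bit [measurable]: "(\<lambda>X. X i) \<in> measurable cantor_measure (count_space UNIV)"
  unfolding cantor_measure_def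
  using measurable_component_singleton[of i UNIV "\<lambda>_. measure_pmf (bernoulli_pmf (1 / 2))"]
  by (simp cong: measurable_cong_sets)

lemma measurable_pref [measurable]: "(\<lambda>X. pref X n) \<in> measurable cantor_measure (count_space UNIV)"
proof (induction n)
  case (Suc n)
  have "(\<lambda>X. 2 * pref X n + of_bool (X n)) \<in> measurable cantor_measure (count_space UNIV)"
    using Suc by measurable
  then show ?case by simp
qed simp

lemma pred_pref [measurable]: "Measurable.pred cantor_measure (\<lambda>X. P (pref X n))"
  using measurable_compose[OF measurable_pref[of n], of P "count_space UNIV"] by simp

lemma sets_pref [measurable, simp]: "{X. P (pref X n)} \<in> sets cantor_measure"
  using pred_pref[of P n] by (simp add: pred_def)

lemma sets_pref_ex [measurable, simp]: "{X. \<exists>n. P n (pref X n)} \<in> sets cantor_measure"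
proof -
  have "{X. \<exists>n. P n (pref X n)} = (\<Union>n. {X. P n (pref X n)})" by auto
  then show ?thesis by auto
qed

lemma sets_cyl [measurable, simp]: "cyl n m \<in> sets cantor_measure"
  unfolding cyl_def by simp

lemma measure_assignment:
  assumes "finite J"
  shows "\<mu> {X. \<forall>i\<in>J. X i = Y i} = (1 / 2) ^ card J"
proof -
  have "{X. \<forall>i\<in>J. X i = Y i} =
    prod_emb UNIV (\<lambda>_. measure_pmf (bernoulli_pmf (1 / 2))) J (\<Pi>\<^sub>E i\<in>J. {Y i})"
    by (simp add: prod_emb_def restrict_PiE_iff PiE_UNIV_domain set_eq_iff Pi_iff)
  also have "\<mu> \<dots> = (\<Prod>i\<in>J. measure (measure_pmf (bernoulli_pmf (1 / 2))) {Y i})"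
    unfolding cantor_measure_def using assms by (intro coin.measure_PiM_emb) auto
  also have "\<dots> = (\<Prod>i\<in>J. 1 / 2)"
  proof (rule prod.cong)
    fix i show "measure (measure_pmf (bernoulli_pmf (1 / 2))) {Y i} = 1 / 2"
      by (cases "Y i") (simp_all add: measure_pmf_single)
  qed simp
  finally show ?thesis by simp
qed

lemma measure_cyl: "m < 2 ^ n \<Longrightarrow> \<mu> (cyl n m) = (1 / 2) ^ n"
proof -
  assume "m < 2 ^ n"
  then obtain Y where "pref Y n = m" using pref_surj by blast
  then have "cyl n m = {X. \<forall>i\<in>{..<n}. X i = Y i}" by (auto simp: cyl_def pref_eq_iff)
  then show ?thesis using measure_assignment[of "{..<n}" Y] by simp
qed

lemma sets_ball_bits [measurable, simp]: "finite J \<Longrightarrow> {X. \<forall>i\<in>J. X i = Y i} \<in> sets cantor_measure"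
proof -
  assume "finite J"
  have "Measurable.pred cantor_measure (\<lambda>X. \<forall>i\<in>J. X i = Y i)"
    using \<open>finite J\<close> by measurable
  then show ?thesis by (simp add: pred_def)
qed

text \<open>Having some one in \<open>J e\<close> is the complement of having only zeros there, and
  the all-zero case is again of the given form, with \<open>K\<close> enlarged by
  \<open>J e\<close>. This is why fixed bits \<open>K\<close> with arbitrary values \<open>Y\<close>
  are carried through the induction.\<close>

lemma measure_blocks:
  assumes "finite F" "finite K" "\<And>e. e \<in> F \<Longrightarrow> finite (J e)" "disjoint_family_on J F"
    "\<And>e. e \<in> F \<Longrightarrow> K \<inter> J e = {}"
  shows "\<mu> {X. (\<forall>i\<in>K. X i = Y i) \<and> (\<forall>e\<in>F. \<exists>i\<in>J e. X i)} =
    (1 / 2) ^ card K * (\<Prod>e\<in>F. 1 - (1 / 2) ^ card (J e))"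
  using assms
proof (induction F arbitrary: K Y rule: finite_induct)
  case empty
  then show ?case using measure_assignment by simp
next
  case (insert e F)
  let ?S = "{X. (\<forall>i\<in>K. X i = Y i) \<and> (\<forall>e\<in>F. \<exists>i\<in>J e. X i)}"
  \<comment> \<open>Agrees with \<open>Y\<close> on \<open>K\<close> and prescribes zeros on
    \<open>J e\<close>, which is disjoint from \<open>K\<close>.\<close>
  let ?Y = "\<lambda>i. i \<in> K \<and> Y i"
  let ?T = "{X. (\<forall>i\<in>K \<union> J e. X i = ?Y i) \<and> (\<forall>e\<in>F. \<exists>i\<in>J e. X i)}"
  have d: "disjoint_family_on J F" "\<And>e'. e' \<in> F \<Longrightarrow> J e \<inter> J e' = {}"
    using insert.prems(3) insert.hyps by (auto simp: disjoint_family_on_def)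
  have S: "\<mu> ?S = (1 / 2) ^ card K * (\<Prod>e\<in>F. 1 - (1 / 2) ^ card (J e))"
    using insert.prems d by (intro insert.IH) auto
  have "(K \<union> J e) \<inter> J e' = {}" if "e' \<in> F" for e'
    using d(2)[OF that] insert.prems(4)[of e'] that by blast
  then have "\<mu> ?T = (1 / 2) ^ card (K \<union> J e) * (\<Prod>e\<in>F. 1 - (1 / 2) ^ card (J e))"
    using insert.prems d(1) by (intro insert.IH) auto
  also have "card (K \<union> J e) = card K + card (J e)"
    using insert.prems by (intro card_Un_disjoint) auto
  finally have T: "\<mu> ?T = (1 / 2) ^ card K * (1 / 2) ^ card (J e) * (\<Prod>e\<in>F. 1 - (1 / 2) ^ card (J e))"
    by (simp add: power_add)
  have "Measurable.pred cantor_measure (\<lambda>X. \<exists>i\<in>J e. X i)" if "e \<in> F" for e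
    using insert.prems(2) that by (intro pred_intros_finite) auto
  then have m: "Measurable.pred cantor_measure (\<lambda>X. \<forall>e\<in>F. \<exists>i\<in>J e. X i)"
    using insert.hyps(1) by (intro pred_intros_finite(3))
  have k: "Measurable.pred cantor_measure (\<lambda>X. \<forall>i\<in>K. X i = Y i)" if "finite K" for K Y
    using that by (intro pred_intros_finite) auto
  have "finite (K \<union> J e)" using insert.prems(1,2) by auto
  from pred_intros_logic(3)[OF k[OF this, of ?Y] m] pred_intros_logic(3)[OF k[OF insert.prems(1), of Y] m]
  have "?S \<in> sets cantor_measure" "?T \<in> sets cantor_measure" by (auto simp: pred_def)
  then have "\<mu> (?S - ?T) = \<mu> ?S - \<mu> ?T"
    using insert.prems(4) by (intro cantor.finite_measure_Diff) auto
  moreover have "?S - ?T = {X. (\<forall>i\<in>K. X i = Y i) \<and> (\<forall>e\<in>insert e F. \<exists>i\<in>J e. X i)}"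
    using insert.prems(4)[of e] by auto
  ultimately have "\<mu> {X. (\<forall>i\<in>K. X i = Y i) \<and> (\<forall>e\<in>insert e F. \<exists>i\<in>J e. X i)} =
    (1 / 2) ^ card K * (\<Prod>e\<in>F. 1 - (1 / 2) ^ card (J e)) -
    (1 / 2) ^ card K * (1 / 2) ^ card (J e) * (\<Prod>e\<in>F. 1 - (1 / 2) ^ card (J e))"
    unfolding S T by metis
  also have "\<dots> = (1 / 2) ^ card K * ((1 - (1 / 2) ^ card (J e)) * (\<Prod>e\<in>F. 1 - (1 / 2) ^ card (J e)))"
    by (simp only: left_diff_distrib right_diff_distrib mult.assoc mult_1)
  also have "(1 - (1 / 2) ^ card (J e)) * (\<Prod>e\<in>F. 1 - (1 / 2) ^ card (J e)) =
      (\<Prod>e\<in>insert e F. 1 - (1 / 2) ^ card (J e) :: real)"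
    using insert.hyps by (rule prod.insert[symmetric])
  finally show ?case .
qed

section \<open>Effectively open sets\<close>

definition copen :: "(nat \<Rightarrow> bool) \<Rightarrow> ('a::ctx \<Rightarrow> (nat \<Rightarrow> bool) set) \<Rightarrow> bool" where
  "copen A U \<longleftrightarrow> (\<exists>R. re A (\<lambda>p. R (fst p) (fst (snd p)) (snd (snd p))) \<and>
    (\<forall>x. U x = {X. \<exists>n. R x n (pref X n)}))"

lemma sets_copen [measurable_dest, simp]: "copen A U \<Longrightarrow> U x \<in> sets cantor_measure"
  by (auto simp: copen_def)

text \<open>\<open>D x n m\<close> holds if some initial segment of the string has appeared by stage
  \<open>n\<close>, the length doubling as the stage. Delaying strings in this way turns an
  enumerable set of strings into a decidable one, closed under extension, that generates the same
  open set.\<close>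

lemma string_witness:
  fixes R :: "'a::ctx \<Rightarrow> nat \<Rightarrow> nat \<Rightarrow> bool"
  assumes "re A (\<lambda>p. R (fst p) (fst (snd p)) (snd (snd p)))"
  obtains D where "dec A (\<lambda>p. D (fst p) (fst (snd p)) (snd (snd p)))"
    "\<And>x i j m. D x i (m div 2 ^ (j - i)) \<Longrightarrow> i \<le> j \<Longrightarrow> D x j m"
    "\<And>x n m. D x n m \<Longrightarrow> \<exists>k\<le>n. R x k (m div 2 ^ (n - k))"
    "\<And>x k m. R x k m \<Longrightarrow> \<exists>t\<ge>k. \<forall>m'. m' div 2 ^ (t - k) = m \<longrightarrow> D x t m'"
proof -
  obtain Q where Q: "dec A (\<lambda>p. Q (fst p) (snd p))"
    "\<And>p. R (fst p) (fst (snd p)) (snd (snd p)) \<longleftrightarrow> (\<exists>s::nat. Q p s)"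
    "\<And>x s t. Q x s \<Longrightarrow> s \<le> t \<Longrightarrow> Q x t"
    by (rule re_mono_witness[OF assms]) (rule that)
  have RQ: "R x n m \<longleftrightarrow> (\<exists>s. Q (x, n, m) s)" for x n m using Q(2)[of "(x, n, m)"] by simp
  define D where "D x n m = (\<exists>k\<le>n. Q (x, k, m div 2 ^ (n - k)) n)" for x n m
  show thesis
  proof (rule that[of D])
    show "dec A (\<lambda>p. D (fst p) (fst (snd p)) (snd (snd p)))"
      unfolding D_def by (intro rc_intros dec_comp2[OF Q(1)])
    show "D x j m" if D: "D x i (m div 2 ^ (j - i))" and ij: "i \<le> j" for x i j m
    proof -
      obtain k where k: "k \<le> i" "Q (x, k, m div 2 ^ (j - i) div 2 ^ (i - k)) i"
        using D unfolding D_def by auto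
      have "m div 2 ^ (j - i) div 2 ^ (i - k) = m div 2 ^ (j - k)"
        using k(1) ij by (simp add: div_mult2_eq[symmetric] power_add[symmetric])
      with k Q(3)[OF k(2) ij] ij show ?thesis unfolding D_def by (intro exI[of _ k]) auto
    qed
    show "\<exists>k\<le>n. R x k (m div 2 ^ (n - k))" if "D x n m" for x n m
      using that unfolding D_def RQ by blast
    show "\<exists>t\<ge>k. \<forall>m'. m' div 2 ^ (t - k) = m \<longrightarrow> D x t m'" if R: "R x k m" for x k m
    proof -
      obtain s where s: "Q (x, k, m) s" using R RQ by blast
      have "Q (x, k, m) (max k s)" by (rule Q(3)[OF s]) simp
      then have "D x (max k s) m'" if "m' div 2 ^ (max k s - k) = m" for m'
        unfolding D_def using that by (intro exI[of _ k]) auto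
      then show ?thesis by (intro exI[of _ "max k s"]) auto
    qed
  qed
qed

lemma copen_witness:
  assumes "copen A U"
  obtains D where "dec A (\<lambda>p. D (fst p) (fst (snd p)) (snd (snd p)))"
    "\<And>x i j m. D x i (m div 2 ^ (j - i)) \<Longrightarrow> i \<le> j \<Longrightarrow> D x j m"
    "\<And>x. U x = {X. \<exists>n. D x n (pref X n)}"
proof -
  obtain R where R: "re A (\<lambda>p. R (fst p) (fst (snd p)) (snd (snd p)))"
    "\<And>x. U x = {X. \<exists>n. R x n (pref X n)}"
    using assms unfolding copen_def by blast
  obtain D where D: "dec A (\<lambda>p. D (fst p) (fst (snd p)) (snd (snd p)))"
    "\<And>x i j m. D x i (m div 2 ^ (j - i)) \<Longrightarrow> i \<le> j \<Longrightarrow> D x j m"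
    "\<And>x n m. D x n m \<Longrightarrow> \<exists>k\<le>n. R x k (m div 2 ^ (n - k))"
    "\<And>x k m. R x k m \<Longrightarrow> \<exists>t\<ge>k. \<forall>m'. m' div 2 ^ (t - k) = m \<longrightarrow> D x t m'"
    by (rule string_witness[OF R(1)]) (rule that)
  have "(\<exists>n. R x n (pref X n)) \<longleftrightarrow> (\<exists>n. D x n (pref X n))" for x X
  proof
    assume "\<exists>n. R x n (pref X n)"
    then obtain n t where "n \<le> t" "\<And>m'. m' div 2 ^ (t - n) = pref X n \<Longrightarrow> D x t m'"
      using D(4) by blast
    then show "\<exists>n. D x n (pref X n)" using pref_div by blast
  next
    assume "\<exists>n. D x n (pref X n)"
    then obtain n k where "k \<le> n" "R x k (pref X n div 2 ^ (n - k))" using D(3) by blast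
    then have "R x k (pref X k)" by (simp add: pref_div)
    then show "\<exists>n. R x n (pref X n)" ..
  qed
  then have "U x = {X. \<exists>n. D x n (pref X n)}" for x unfolding R(2) by blast
  with D(1,2) show thesis by (rule that)
qed

lemma copenI:
  "re A (\<lambda>p. R (fst p) (fst (snd p)) (snd (snd p))) \<Longrightarrow> (\<And>x. U x = {X. \<exists>n. R x n (pref X n)}) \<Longrightarrow> copen A U"
  unfolding copen_def by blast

section \<open>Strings as numbers and as coded lists\<close>

definition strcode :: "nat \<Rightarrow> nat \<Rightarrow> nat" where
  "strcode k m = rec_nat 0 (\<lambda>j c. Suc (prod_encode ((m div 2 ^ j) mod 2, c))) k"

text \<open>The recursion consumes digits from the least significant one, that is, from the end of
  the string, and so mirrors the way \<open>list_encode\<close> puts the head in front of an encoded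
  tail.\<close>

lemma strcode_pref: "strcode k (pref X k) = string_code (map X [0..<k])"
proof -
  have "rec_nat 0 (\<lambda>j c. Suc (prod_encode ((pref X k div 2 ^ j) mod 2, c))) j =
    list_encode (map (\<lambda>i. of_bool (X i)) [k - j..<k])" if "j \<le> k" for j
    using that
  proof (induction j)
    case (Suc j)
    have "[k - Suc j..<k] = (k - Suc j) # [k - j..<k]"
      using Suc.prems by (metis Suc_diff_Suc Suc_le_lessD diff_less less_le_trans upt_conv_Cons zero_less_Suc)
    moreover have "(pref X k div 2 ^ j) mod 2 = of_bool (X (k - Suc j))"
      using odd_pref[of "k - Suc j" k X] Suc.prems
      by (auto simp: of_bool_def odd_iff_mod_2_eq_one)
    ultimately show ?case using Suc by simp
  qed simp
  from this[of k] show ?thesis by (simp add: strcode_def string_code_def comp_def)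
qed

lemma string_code_inject: "string_code \<sigma> = string_code \<tau> \<longleftrightarrow> \<sigma> = \<tau>"
proof
  assume "string_code \<sigma> = string_code \<tau>"
  then have "map of_bool \<sigma> = (map of_bool \<tau> :: nat list)" by (simp add: string_code_def list_encode_eq)
  then show "\<sigma> = \<tau>" by (subst (asm) inj_map_eq_map) (auto simp: inj_def)
qed simp

lemma rc_strcode [rc_intros]:
  assumes "rc A f" "rc A g" shows "rc A (\<lambda>x. strcode (f x) (g x))"
  unfolding strcode_def by (intro rc_intros assms rc_comp[OF assms(2)])

lemma mem_cylinder_iff: "X \<in> cylinder \<sigma> \<longleftrightarrow> \<sigma> = map X [0..<length \<sigma>]"
  by (subst list_eq_iff_nth_eq) (auto simp: cylinder_def)

lemma ml_test_iff: "ml_test A U \<longleftrightarrow> copen A U \<and> (\<forall>n. \<mu> (U n) \<le> (1 / 2) ^ n)"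
proof -
  have "(\<exists>W. ce_in A W \<and> (\<forall>n. U n = (\<Union>\<sigma>\<in>{\<sigma>. prod_encode (n, string_code \<sigma>) \<in> W}. cylinder \<sigma>)))
      \<longleftrightarrow> copen A U"
  proof
    assume "\<exists>W. ce_in A W \<and> (\<forall>n. U n = (\<Union>\<sigma>\<in>{\<sigma>. prod_encode (n, string_code \<sigma>) \<in> W}. cylinder \<sigma>))"
    then obtain W where W: "re A (\<lambda>n. n \<in> W)"
      "\<And>n. U n = (\<Union>\<sigma>\<in>{\<sigma>. prod_encode (n, string_code \<sigma>) \<in> W}. cylinder \<sigma>)"
      unfolding ce_in_iff_re by auto
    show "copen A U"
    proof (rule copenI)
      show "re A (\<lambda>p. prod_encode (fst p, strcode (fst (snd p)) (snd (snd p))) \<in> W)"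
        by (intro re_comp[OF W(1)] rc_intros)
      show "U n = {X. \<exists>k. prod_encode (n, strcode k (pref X k)) \<in> W}" for n
      proof (intro equalityI subsetI)
        fix X assume "X \<in> U n"
        then obtain \<sigma> where \<sigma>: "prod_encode (n, string_code \<sigma>) \<in> W" "X \<in> cylinder \<sigma>"
          unfolding W(2) by blast
        from \<sigma>(2) have "map X [0..<length \<sigma>] = \<sigma>" by (simp only: mem_cylinder_iff[symmetric] eq_commute)
        with \<sigma>(1) have "prod_encode (n, strcode (length \<sigma>) (pref X (length \<sigma>))) \<in> W"
          by (simp only: strcode_pref)
        then show "X \<in> {X. \<exists>k. prod_encode (n, strcode k (pref X k)) \<in> W}" by blast
      next
        fix X assume "X \<in> {X. \<exists>k. prod_encode (n, strcode k (pref X k)) \<in> W}"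
        then obtain k where "prod_encode (n, string_code (map X [0..<k])) \<in> W"
          by (auto simp: strcode_pref)
        moreover have "X \<in> cylinder (map X [0..<k])" by (simp add: mem_cylinder_iff)
        ultimately show "X \<in> U n" unfolding W(2) by blast
      qed
    qed
  next
    assume "copen A U"
    then obtain R where R: "re A (\<lambda>p. R (fst p) (fst (snd p)) (snd (snd p)))"
      "\<And>x. U x = {X. \<exists>n. R x n (pref X n)}"
      unfolding copen_def by blast
    \<comment> \<open>The bound on \<open>m\<close> matters: \<open>strcode\<close> reads only the
      last \<open>k\<close> digits, so a larger \<open>m\<close> would produce the code of a
      different string.\<close>
    let ?W = "{x. \<exists>n k m. (x = prod_encode (n, strcode k m) \<and> m < 2 ^ k) \<and> R n k m}"
    have "re A (\<lambda>x. x \<in> ?W)"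
      unfolding mem_Collect_eq
      by (intro re_ex re_conj re_dec rc_intros
        re_comp[OF R(1), of "\<lambda>p. (snd (fst (fst p)), snd (fst p), snd p)", simplified])
    moreover have "U n = (\<Union>\<sigma>\<in>{\<sigma>. prod_encode (n, string_code \<sigma>) \<in> ?W}. cylinder \<sigma>)" for n
    proof (intro equalityI subsetI)
      fix X assume "X \<in> U n"
      then obtain k where k: "R n k (pref X k)" by (auto simp: R(2))
      have "prod_encode (n, string_code (map X [0..<k])) \<in> ?W"
        using k pref_less[of X k] by (auto simp: strcode_pref[symmetric])
      moreover have "X \<in> cylinder (map X [0..<k])" by (simp add: mem_cylinder_iff)
      ultimately show "X \<in> (\<Union>\<sigma>\<in>{\<sigma>. prod_encode (n, string_code \<sigma>) \<in> ?W}. cylinder \<sigma>)" by blast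
    next
      fix X assume "X \<in> (\<Union>\<sigma>\<in>{\<sigma>. prod_encode (n, string_code \<sigma>) \<in> ?W}. cylinder \<sigma>)"
      then obtain \<sigma> k m where X: "X \<in> cylinder \<sigma>" "string_code \<sigma> = strcode k m" "m < 2 ^ k" "R n k m"
        by auto
      obtain Y where Y: "m = pref Y k" using pref_surj[OF X(3)] by blast
      with X(2) have \<sigma>: "\<sigma> = map Y [0..<k]" by (simp add: strcode_pref string_code_inject)
      with X(1) have "pref X k = pref Y k" by (auto simp: cylinder_def pref_eq_iff)
      with X(4) Y have "R n k (pref X k)" by simp
      then show "X \<in> U n" unfolding R(2) by blast
    qed
    ultimately show "\<exists>W. ce_in A W \<and> (\<forall>n. U n = (\<Union>\<sigma>\<in>{\<sigma>. prod_encode (n, string_code \<sigma>) \<in> W}. cylinder \<sigma>))"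
      unfolding ce_in_iff_re by blast
  qed
  then show ?thesis unfolding ml_test_def by blast
qed

text \<open>By Markov's inequality, the points lying in at least \<open>L * 2 ^ n\<close> of the
  sets have measure at most \<open>(1 / 2) ^ n\<close> when \<open>L\<close> bounds the total
  measure. They form an effectively open set uniformly in \<open>n\<close>, and a point in
  infinitely many sets is in all of these.\<close>

lemma solovay:
  fixes S :: "nat \<Rightarrow> (nat \<Rightarrow> bool) set"
  assumes S: "copen A S" and fin: "\<And>n. (\<Sum>e<n. \<mu> (S e)) \<le> K" and inf: "infinite {e. X \<in> S e}"
  shows "\<not> ml_random A X"
proof -
  obtain D where D: "dec A (\<lambda>p. D (fst p) (fst (snd p)) (snd (snd p)))"
    "\<And>x i j m. D x i (m div 2 ^ (j - i)) \<Longrightarrow> i \<le> j \<Longrightarrow> D x j m"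
    "\<And>x. S x = {X. \<exists>n. D x n (pref X n)}"
    by (rule copen_witness[OF S]) (rule that)
  have mono: "D e t (pref X t)" if "D e s (pref X s)" "s \<le> t" for e s t X
    using D(2)[of e s "pref X t" t] that by (simp add: pref_div)
  obtain L where L: "K \<le> real L" "L > 0" 
    by (metis gr0I less_eq_real_def not_less of_nat_0 of_nat_less_iff of_nat_1 order_trans real_arch_simple zero_less_one)
  \<comment> \<open>Stage \<open>s\<close> of \<open>U n\<close>: only sets with index below
    \<open>s\<close> are counted, and membership is judged by the first \<open>s\<close>
    bits.\<close>
  define V where "V n s = {X. L * 2 ^ n \<le> (\<Sum>e<s. of_bool (D e s (pref X s)) :: nat)}" for n s
  define U where "U n = {X. \<exists>s. L * 2 ^ n \<le> (\<Sum>e<s. of_bool (D e s (pref X s)) :: nat)}" for n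
  have U_V: "U n = (\<Union>s. V n s)" for n by (auto simp: U_def V_def)
  have Vsets: "V n s \<in> sets cantor_measure" for n s unfolding V_def by (rule sets_pref)
  have "copen A U"
  proof (rule copenI)
    show "re A (\<lambda>p. L * 2 ^ fst p \<le> (\<Sum>e<fst (snd p). of_bool (D e (fst (snd p)) (snd (snd p))) :: nat))"
      by (intro re_dec rc_intros
         dec_comp[OF D(1), of "\<lambda>p. (snd p, fst (snd (fst p)), snd (snd (fst p)))", simplified])
  qed (simp add: U_def)
  moreover have "\<mu> (U n) \<le> (1 / 2) ^ n" for n
  proof -
    have "\<mu> (V n s) \<le> (1 / 2) ^ n" for s
    proof -
      have "real (L * 2 ^ n) * \<mu> (V n s) = (\<integral>X. real (L * 2 ^ n) * indicator (V n s) X \<partial>cantor_measure)"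
        using Vsets by simp
      also have "\<dots> \<le> (\<integral>X. (\<Sum>e<s. indicator (S e) X) \<partial>cantor_measure)"
      proof (rule integral_mono)
        fix X
        show "real (L * 2 ^ n) * indicator (V n s) X \<le> (\<Sum>e<s. indicator (S e) X :: real)"
        proof (cases "X \<in> V n s")
          case True
          then have "real (L * 2 ^ n) \<le> real (\<Sum>e<s. of_bool (D e s (pref X s)))"
            unfolding V_def by (simp only: mem_Collect_eq of_nat_le_iff)
          also have "\<dots> = (\<Sum>e<s. of_bool (D e s (pref X s)))" by simp
          also have "\<dots> \<le> (\<Sum>e<s. indicator (S e) X :: real)"
          proof (rule sum_mono)
            fix e
            have "X \<in> S e" if "D e s (pref X s)" using that by (auto simp: D(3))
            then show "of_bool (D e s (pref X s)) \<le> (indicator (S e) X :: real)" by (auto simp: indicator_def)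
          qed
          finally show ?thesis using True by simp
        qed (simp add: sum_nonneg)
      qed (use Vsets S in \<open>auto intro!: Bochner_Integration.integrable_sum simp: cantor.emeasure_eq_measure\<close>)
      also have "\<dots> = (\<Sum>e<s. \<mu> (S e))"
        using S by (subst Bochner_Integration.integral_sum) (auto simp: cantor.emeasure_eq_measure)
      also have "\<dots> \<le> L" using fin L by (meson order_trans)
      finally show ?thesis using L by (simp add: field_simps power_one_over)
    qed
    moreover have "(\<lambda>s. \<mu> (V n s)) \<longlonglongrightarrow> \<mu> (U n)"
      unfolding U_V
    proof (rule cantor.finite_Lim_measure_incseq)
      show "incseq (V n)"
      proof (rule incseq_SucI, rule subsetI)
        fix s X assume "X \<in> V n s"
        then have "L * 2 ^ n \<le> (\<Sum>e<s. of_bool (D e s (pref X s)) :: nat)" by (simp add: V_def)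
        also have "\<dots> \<le> (\<Sum>e<s. of_bool (D e (Suc s) (pref X (Suc s))))"
          using mono[of _ s X "Suc s"] by (intro sum_mono) (auto simp del: pref.simps)
        also have "\<dots> \<le> (\<Sum>e<Suc s. of_bool (D e (Suc s) (pref X (Suc s))))" by simp
        finally show "X \<in> V n (Suc s)" by (simp add: V_def)
      qed
    qed (use Vsets in auto)
    ultimately show ?thesis by (intro LIMSEQ_le_const2) auto
  qed
  ultimately have "ml_test A U" by (simp add: ml_test_iff)
  moreover have "X \<in> U n" for n
  proof -
    obtain F where F: "finite F" "card F = L * 2 ^ n" "F \<subseteq> {e. X \<in> S e}"
      using infinite_arbitrarily_large[OF inf] by blast
    then have "\<forall>e\<in>F. \<exists>t. D e t (pref X t)" by (auto simp: D(3))
    then obtain t where t: "\<And>e. e \<in> F \<Longrightarrow> D e (t e) (pref X (t e))" by metis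
    \<comment> \<open>A common bound for the chosen indices and for the stages at which
      \<open>X\<close> enters their sets.\<close>
    define s where "s = (\<Sum>e\<in>F. t e + Suc e)"
    have le: "t e + Suc e \<le> s" if "e \<in> F" for e
      unfolding s_def using member_le_sum[of e F "\<lambda>e. t e + Suc e"] F(1) that by simp
    have Ds: "D e s (pref X s)" if "e \<in> F" for e
      by (rule mono[OF t[OF that]]) (use le[OF that] in simp)
    have "F \<subseteq> {..<s}" using le by force
    have "L * 2 ^ n = (\<Sum>e\<in>F. 1)" using F by simp
    also have "\<dots> = (\<Sum>e\<in>F. of_bool (D e s (pref X s)))"
      using Ds by (intro sum.cong) auto
    also have "\<dots> \<le> (\<Sum>e<s. of_bool (D e s (pref X s)))"
      using \<open>F \<subseteq> {..<s}\<close> by (intro sum_mono2) auto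
    finally show ?thesis unfolding U_def by blast
  qed
  ultimately show ?thesis unfolding ml_random_def by blast
qed

section \<open>Single effectively open sets\<close>

abbreviation sig1 :: "(nat \<Rightarrow> bool) \<Rightarrow> (nat \<Rightarrow> bool) set \<Rightarrow> bool" where
  "sig1 A V \<equiv> copen A (\<lambda>_::nat. V)"

lemma re_disj:
  assumes "re A P" "re A P'" shows "re A (\<lambda>x. P x \<or> P' x)"
proof -
  obtain Q where Q: "dec A (\<lambda>p. Q (fst p) (snd p))" "\<And>x. P x \<longleftrightarrow> (\<exists>s::nat. Q x s)"
    using assms(1) unfolding re_def by blast
  obtain Q' where Q': "dec A (\<lambda>p. Q' (fst p) (snd p))" "\<And>x. P' x \<longleftrightarrow> (\<exists>s::nat. Q' x s)"
    using assms(2) unfolding re_def by blast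
  have "dec A (\<lambda>p. Q (fst p) (snd p) \<or> Q' (fst p) (snd p))"
    by (intro rc_intros Q Q')
  then show ?thesis unfolding re_def
    by (intro exI[of _ "\<lambda>x s. Q x s \<or> Q' x s"]) (use Q(2) Q'(2) in blast)
qed

lemma sig1I:
  assumes "re A (\<lambda>p. R (fst p) (snd p))" "V = {X. \<exists>n. R n (pref X n)}"
  shows "sig1 A V"
proof (rule copenI)
  show "re A (\<lambda>p :: nat \<times> nat \<times> nat. R (fst (snd p)) (snd (snd p)))"
    by (intro re_comp2[OF assms(1)] rc_intros)
qed (rule assms(2))

lemma sig1_witness:
  assumes "sig1 A V"
  obtains D where "dec A (\<lambda>p. D (fst p) (snd p))"
    "\<And>i j m. D i (m div 2 ^ (j - i)) \<Longrightarrow> i \<le> j \<Longrightarrow> D j m"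
    "V = {X. \<exists>n. D n (pref X n)}"
proof -
  obtain D where D: "dec A (\<lambda>p :: nat \<times> nat \<times> nat. D (fst p) (fst (snd p)) (snd (snd p)))"
    "\<And>x i j m. D x i (m div 2 ^ (j - i)) \<Longrightarrow> i \<le> j \<Longrightarrow> D x j m"
    "\<And>x. V = {X. \<exists>n. D x n (pref X n)}"
    by (rule copen_witness[OF assms]) (rule that)
  show thesis
  proof (rule that[of "D 0"])
    show "dec A (\<lambda>p. D 0 (fst p) (snd p))"
      using dec_comp[OF D(1), of "\<lambda>p. (0, p)"] by (simp add: rc_intros)
  qed (use D in blast)+
qed

lemma sig1_copen: "copen A U \<Longrightarrow> sig1 A (U x)"
proof -
  assume "copen A U"
  then obtain R where R: "re A (\<lambda>p. R (fst p) (fst (snd p)) (snd (snd p)))"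
    "\<And>x. U x = {X. \<exists>n. R x n (pref X n)}"
    unfolding copen_def by blast
  show ?thesis
  proof (rule sig1I)
    show "re A (\<lambda>p. R x (fst p) (snd p))"
      using re_comp[OF R(1), of "\<lambda>p. (x, p)"] by (simp add: rc_intros)
  qed (rule R(2))
qed

lemma sig1_Un:
  assumes "sig1 A V" "sig1 A V'"
  shows "sig1 A (V \<union> V')"
proof -
  obtain D where D: "dec A (\<lambda>p. D (fst p) (snd p))" "V = {X. \<exists>n. D n (pref X n)}"
    by (rule sig1_witness[OF assms(1)]) (rule that)
  obtain D' where D': "dec A (\<lambda>p. D' (fst p) (snd p))" "V' = {X. \<exists>n. D' n (pref X n)}"
    by (rule sig1_witness[OF assms(2)]) (rule that)
  have "dec A (\<lambda>p. D (fst p) (snd p) \<or> D' (fst p) (snd p))"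
    by (intro rc_intros D D')
  from re_dec[OF this] show ?thesis by (rule sig1I) (use D(2) D'(2) in blast)
qed

lemma sig1_empty: "sig1 A {}"
  by (rule sig1I[of _ "\<lambda>_ _. False"]) (auto intro!: re_dec rc_intros)

lemma sig1_open:
  assumes "sig1 A V" "X \<in> V"
  obtains k where "cyl k (pref X k) \<subseteq> V"
proof -
  obtain D where D: "V = {X. \<exists>n. D n (pref X n)}" by (rule sig1_witness[OF assms(1)]) (rule that)
  with assms(2) obtain k where "D k (pref X k)" by blast
  then have "cyl k (pref X k) \<subseteq> V" unfolding D cyl_def by (auto intro: exI[of _ k])
  then show thesis by (rule that)
qed

lemma cyl_mono:
  assumes "X \<in> cyl n m" "n \<le> k" shows "cyl k (pref X k) \<subseteq> cyl n m"
proof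
  fix Y assume "Y \<in> cyl k (pref X k)"
  then have "pref Y k div 2 ^ (k - n) = pref X k div 2 ^ (k - n)" by (simp add: cyl_def)
  with assms show "Y \<in> cyl n m" by (simp add: pref_div cyl_def)
qed

section \<open>Forcing against sets with small covers\<close>

text \<open>The cover may depend on \<epsilon> noneffectively, unlike in a Martin-Loef test. The
  covers for density use this freedom: they depend on a stage that is obtained from a limit.\<close>

definition small_cover :: "(nat \<Rightarrow> bool) \<Rightarrow> (nat \<Rightarrow> bool) set \<Rightarrow> bool" where
  "small_cover A N \<longleftrightarrow> (\<forall>\<epsilon>>0. \<exists>V. sig1 A V \<and> N \<subseteq> V \<and> \<mu> V < \<epsilon>)"

lemma measure_cyl_split:
  assumes "S \<in> sets cantor_measure"
  shows "\<mu> S = (\<Sum>m<2 ^ n. \<mu> (cyl n m \<inter> S))"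
proof -
  have "S = (\<Union>m\<in>{..<2 ^ n}. cyl n m \<inter> S)" using pref_less by (auto simp: cyl_def)
  then have "\<mu> S = \<mu> (\<Union>m\<in>{..<2 ^ n}. cyl n m \<inter> S)" by simp
  also have "\<dots> = (\<Sum>m<2 ^ n. \<mu> (cyl n m \<inter> S))"
    using assms by (intro cantor.finite_measure_finite_Union) (auto simp: disjoint_family_on_def cyl_def)
  finally show ?thesis .
qed

text \<open>A condition \<open>cyl n m - V\<close> has positive measure. Step \<open>i\<close>
  enlarges \<open>V\<close> by a cover of \<open>N i\<close> and then shrinks the cylinder into some
  \<open>E e\<close> with \<open>e \<ge> i\<close>. Each \<open>E e\<close> depends on finitely many
  bits, so a long enough cylinder meeting it lies inside it.\<close>

lemma forcing:
  fixes E :: "nat \<Rightarrow> (nat \<Rightarrow> bool) set"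
  assumes N: "\<And>i::nat. small_cover A (N i)"
    and E: "\<And>e. \<exists>l. \<forall>X Y. pref X l = pref Y l \<longrightarrow> X \<in> E e \<longrightarrow> Y \<in> E e" "\<And>e. E e \<in> sets cantor_measure"
    and step: "\<And>n m V k. sig1 A V \<Longrightarrow> \<mu> (cyl n m - V) > 0 \<Longrightarrow> \<exists>e\<ge>k. e \<in> W \<and> \<mu> (cyl n m \<inter> E e - V) > 0"
  obtains X where "\<And>i. X \<notin> N i" "infinite {e \<in> W. X \<in> E e}"
proof -
  define P where "P = (\<lambda>_::nat. \<lambda>(n, m, V). sig1 A V \<and> \<mu> (cyl n m - V) > 0)"
  define Q where "Q = (\<lambda>i. \<lambda>(n::nat, m, V). \<lambda>(n', m', V').
    n < n' \<and> cyl n' m' \<subseteq> cyl n m \<and> V \<subseteq> V' \<and> N i \<subseteq> V' \<and> (\<exists>e\<ge>i. e \<in> W \<and> cyl n' m' \<subseteq> E e))"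
  have "\<exists>f. \<forall>i. P i (f i) \<and> Q i (f i) (f (Suc i))"
  proof (rule dependent_nat_choice)
    have "P 0 (0, 0, {})" using measure_cyl[of 0 0] by (simp add: P_def sig1_empty)
    then show "\<exists>s. P 0 s" ..
  next
    fix s i assume "P i s"
    then obtain n m V where s: "s = (n, m, V)" and V: "sig1 A V" and pos: "\<mu> (cyl n m - V) > 0"
      by (cases s) (auto simp: P_def)
    \<comment> \<open>A cover of measure below that of the condition leaves a remainder of positive
      measure.\<close>
    obtain V0 where V0: "sig1 A V0" "N i \<subseteq> V0" "\<mu> V0 < \<mu> (cyl n m - V)"
      using N pos unfolding small_cover_def by blast
    let ?V = "V \<union> V0"
    have V': "sig1 A ?V" by (rule sig1_Un[OF V V0(1)])
    have ms: "V \<in> sets cantor_measure" "V0 \<in> sets cantor_measure" "?V \<in> sets cantor_measure"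
      using V V0(1) V' by (auto dest: sets_copen)
    have "\<mu> (cyl n m - V) \<le> \<mu> ((cyl n m - ?V) \<union> V0)"
      using ms by (intro cantor.finite_measure_mono) auto
    also have "\<dots> \<le> \<mu> (cyl n m - ?V) + \<mu> V0"
      using ms by (intro measure_Un_le) auto
    finally have "\<mu> (cyl n m - ?V) > 0" using V0(3) by linarith
    from step[OF V' this, of i] obtain e where e: "e \<ge> i" "e \<in> W" "\<mu> (cyl n m \<inter> E e - ?V) > 0" by blast
    obtain l where l: "\<And>X Y. pref X l = pref Y l \<Longrightarrow> X \<in> E e \<Longrightarrow> Y \<in> E e" using E(1) by blast
    \<comment> \<open>Long enough to decide \<open>E e\<close>, and longer than \<open>n\<close>, so
      that the cylinders converge to a point.\<close>
    let ?n = "max (Suc n) l"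
    have S: "cyl n m \<inter> E e - ?V \<in> sets cantor_measure" using ms E(2) by auto
    have "\<exists>m'<2 ^ ?n. \<mu> (cyl ?n m' \<inter> (cyl n m \<inter> E e - ?V)) \<noteq> 0"
    proof (rule ccontr)
      assume "\<not> ?thesis"
      then have "(\<Sum>m'<2 ^ ?n. \<mu> (cyl ?n m' \<inter> (cyl n m \<inter> E e - ?V))) = 0"
        by (intro sum.neutral) auto
      with measure_cyl_split[OF S, of ?n] e(3) show False by simp
    qed
    then obtain m' where m': "\<mu> (cyl ?n m' \<inter> (cyl n m \<inter> E e - ?V)) \<noteq> 0" by blast
    then obtain X where X: "X \<in> cyl ?n m'" "X \<in> cyl n m" "X \<in> E e" 
      by (metis DiffD1 IntD1 IntD2 equals0I measure_empty)
    have "\<mu> (cyl ?n m' \<inter> (cyl n m \<inter> E e - ?V)) \<le> \<mu> (cyl ?n m' - ?V)"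
      using ms by (intro cantor.finite_measure_mono) auto
    then have pos': "\<mu> (cyl ?n m' - ?V) > 0"
      using m' measure_nonneg[of cantor_measure "cyl ?n m' \<inter> (cyl n m \<inter> E e - ?V)"] by linarith
    have m'_eq: "m' = pref X ?n" using X(1) by (simp add: cyl_def)
    have "cyl ?n m' \<subseteq> cyl n m" unfolding m'_eq by (rule cyl_mono[OF X(2)]) simp
    moreover have "cyl ?n m' \<subseteq> E e"
    proof
      fix Y assume "Y \<in> cyl ?n m'"
      moreover have "cyl ?n (pref X ?n) \<subseteq> cyl l (pref X l)"
        by (rule cyl_mono) (auto simp: cyl_def)
      ultimately have "pref X l = pref Y l" using m'_eq by (auto simp: cyl_def)
      then show "Y \<in> E e" using l X(3) by blast
    qed
    ultimately have "P (Suc i) (?n, m', ?V) \<and> Q i s (?n, m', ?V)"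
      using V' pos' V0(2) e unfolding P_def Q_def s by auto
    then show "\<exists>y. P (Suc i) y \<and> Q i s y" ..
  qed
  then obtain f where "\<forall>i. P i (f i) \<and> Q i (f i) (f (Suc i))" ..
  then obtain n m V where inv: "\<And>i. sig1 A (V i)" "\<And>i. \<mu> (cyl (n i) (m i) - V i) > 0"
    and nxt: "\<And>i. n i < n (Suc i)" "\<And>i. cyl (n (Suc i)) (m (Suc i)) \<subseteq> cyl (n i) (m i)"
      "\<And>i. V i \<subseteq> V (Suc i)" "\<And>i. N i \<subseteq> V (Suc i)"
      "\<And>i. \<exists>e\<ge>i. e \<in> W \<and> cyl (n (Suc i)) (m (Suc i)) \<subseteq> E e"
    by (atomize_elim, intro exI[of _ "\<lambda>i. fst (f i)"] exI[of _ "\<lambda>i. fst (snd (f i))"]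
      exI[of _ "\<lambda>i. snd (snd (f i))"]) (auto simp: P_def Q_def case_prod_beta)
  have V_mono: "V i \<subseteq> V j" if "i \<le> j" for i j using that nxt(3) by (rule lift_Suc_mono_le[rotated])
  have cyl_anti: "cyl (n j) (m j) \<subseteq> cyl (n i) (m i)" if "i \<le> j" for i j
    by (rule lift_Suc_antimono_le[of "\<lambda>i. cyl (n i) (m i)"]) (use nxt(2) that in auto)
  have n_ge: "i \<le> n i" for i
  proof (induction i)
    case (Suc i) then show ?case using nxt(1)[of i] by linarith
  qed simp
  have "\<exists>Y. Y \<in> cyl (n i) (m i)" for i
    using inv(2)[of i] by (metis Diff_empty Diff_eq_empty_iff equals0I empty_subsetI less_irrefl measure_empty)
  then obtain Y where Y: "\<And>i. Y i \<in> cyl (n i) (m i)" by metis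
  \<comment> \<open>Bit \<open>j\<close> is settled at stage \<open>Suc j\<close>, because
    \<open>n (Suc j)\<close> exceeds \<open>j\<close>.\<close>
  define X where "X j = Y (Suc j) j" for j
  have Y_eq: "Y i j = Y k j" if "j < n i" "i \<le> k" for i j k
  proof -
    have "Y k \<in> cyl (n i) (m i)" using Y[of k] cyl_anti[OF that(2)] by blast
    with Y[of i] have "pref (Y i) (n i) = pref (Y k) (n i)" by (simp add: cyl_def)
    with that(1) show ?thesis by (simp add: pref_eq_iff)
  qed
  have X: "X \<in> cyl (n i) (m i)" for i
  proof -
    have "X j = Y i j" if "j < n i" for j
    proof (cases "i \<le> Suc j")
      case True
      then show ?thesis using Y_eq[OF that True] by (simp add: X_def)
    next
      case False
      have "j < n (Suc j)" using n_ge[of "Suc j"] by simp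
      from Y_eq[OF this, of i] False show ?thesis by (simp add: X_def)
    qed
    then have "pref X (n i) = pref (Y i) (n i)" by (rule pref_cong)
    then show ?thesis using Y[of i] by (simp add: cyl_def)
  qed
  show thesis
  proof (rule that)
    fix i
    \<comment> \<open>If \<open>X\<close> were in the open set \<open>V i\<close>, a whole cylinder
      around \<open>X\<close> would be, and a later condition would be empty.\<close>
    have "X \<notin> V i" for i
    proof
      assume "X \<in> V i"
      then obtain k where k: "cyl k (pref X k) \<subseteq> V i" by (rule sig1_open[OF inv(1)])
      let ?t = "max i k"
      have "cyl (n ?t) (m ?t) = cyl (n ?t) (pref X (n ?t))" using X[of ?t] by (simp add: cyl_def)
      also have "\<dots> \<subseteq> cyl k (pref X k)"
        by (rule cyl_mono) (use n_ge[of ?t] in \<open>auto simp: cyl_def\<close>)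
      also have "\<dots> \<subseteq> V ?t" using k V_mono[of i ?t] by auto
      finally have "cyl (n ?t) (m ?t) - V ?t = {}" by auto
      with inv(2)[of ?t] show False by simp
    qed
    with nxt(4) show "X \<notin> N i" by blast
  next
    have "\<exists>e>i. e \<in> {e \<in> W. X \<in> E e}" for i
    proof -
      obtain e where "e \<ge> Suc i" "e \<in> W" "cyl (n (Suc (Suc i))) (m (Suc (Suc i))) \<subseteq> E e"
        using nxt(5) by blast
      with X[of "Suc (Suc i)"] show ?thesis by (intro exI[of _ e]) auto
    qed
    then show "infinite {e \<in> W. X \<in> E e}" unfolding infinite_nat_iff_unbounded by blast
  qed
qed

section \<open>Covering enumerable sets of finite weight\<close>

definition block :: "(nat \<Rightarrow> nat) \<Rightarrow> nat \<Rightarrow> (nat \<Rightarrow> bool) set" where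
  "block len e = {X. \<forall>j<len e. \<not> X (prod_encode (e, j))}"

lemma block_eq_bits: "block len e = {X. \<forall>i\<in>(\<lambda>j. prod_encode (e, j)) ` {..<len e}. X i = False}"
  by (auto simp: block_def)

lemma card_block_bits: "card ((\<lambda>j. prod_encode (e, j)) ` {..<l}) = l"
  by (subst card_image) (auto simp: inj_on_def)

lemma measure_block: "\<mu> (block len e) = (1 / 2) ^ len e"
  unfolding block_eq_bits by (subst measure_assignment) (auto simp: card_block_bits)

lemma sets_block [simp, measurable]: "block len e \<in> sets cantor_measure"
  unfolding block_eq_bits by (rule sets_ball_bits) auto

text \<open>Reads the block from a string. It is faithful only if all positions of the block are
  below \<open>n\<close>, which is what \<open>decided\<close> expresses.\<close>

definition inblock :: "(nat \<Rightarrow> nat) \<Rightarrow> nat \<Rightarrow> nat \<Rightarrow> nat \<Rightarrow> bool" where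
  "inblock len e n m \<longleftrightarrow> (\<forall>j<len e. even (m div 2 ^ (n - Suc (prod_encode (e, j)))))"

definition decided :: "(nat \<Rightarrow> nat) \<Rightarrow> nat \<Rightarrow> nat \<Rightarrow> bool" where
  "decided len e n \<longleftrightarrow> (\<forall>j<len e. prod_encode (e, j) < n)"

lemma inblock_iff: "decided len e n \<Longrightarrow> inblock len e n (pref X n) \<longleftrightarrow> X \<in> block len e"
  unfolding decided_def inblock_def block_def mem_Collect_eq using odd_pref by metis

lemma decided_mono: "decided len e n \<Longrightarrow> n \<le> k \<Longrightarrow> decided len e k"
  by (auto simp: decided_def)

lemma ex_decided: "\<exists>n. decided len e n"
proof
  have "prod_encode (e, j) \<le> (\<Sum>i<len e. prod_encode (e, i))" if "j < len e" for j
    using that by (intro member_le_sum) auto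
  then show "decided len e (Suc (\<Sum>i<len e. prod_encode (e, i)))" by (auto simp: decided_def le_imp_less_Suc)
qed

lemma dec_inblock [rc_intros]:
  assumes "rc A len" "rc A f" "rc A g" "rc A h"
  shows "dec A (\<lambda>x. inblock len (f x) (g x) (h x))"
  unfolding inblock_def
  by (intro rc_intros rc_comp[OF assms(1)] assms rc_comp[OF assms(2)] rc_comp[OF assms(3)] rc_comp[OF assms(4)])

lemma dec_decided [rc_intros]:
  assumes "rc A len" "rc A f" "rc A g"
  shows "dec A (\<lambda>x. decided len (f x) (g x))"
  unfolding decided_def
  by (intro rc_intros rc_comp[OF assms(1)] assms rc_comp[OF assms(2)] rc_comp[OF assms(3)])

lemma copen_block:
  assumes "rc A len" "re A (\<lambda>e. e \<in> W)"
  shows "copen A (\<lambda>e. if e \<in> W then block len e else {})"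
proof (rule copenI)
  show "re A (\<lambda>p. fst p \<in> W \<and> decided len (fst p) (fst (snd p)) \<and> inblock len (fst p) (fst (snd p)) (snd (snd p)))"
    by (intro re_conj re_comp[OF assms(2)] re_dec rc_intros assms(1))
  show "(if e \<in> W then block len e else {}) =
    {X. \<exists>n. e \<in> W \<and> decided len e n \<and> inblock len e n (pref X n)}" for e
    using ex_decided[of len e] inblock_iff[of len e] by auto
qed

lemma measure_pref: "\<mu> {X. P (pref X n)} = real (\<Sum>m<2 ^ n. of_bool (P m)) / 2 ^ n"
proof -
  have "\<mu> {X. P (pref X n)} = (\<Sum>m<2 ^ n. \<mu> (cyl n m \<inter> {X. P (pref X n)}))"
    by (rule measure_cyl_split) simp
  also have "\<dots> = (\<Sum>m<2 ^ n. of_bool (P m) / 2 ^ n)"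
  proof (rule sum.cong)
    fix m :: nat assume m: "m \<in> {..<2 ^ n}"
    have "cyl n m \<inter> {X. P (pref X n)} = (if P m then cyl n m else {})" by (auto simp: cyl_def)
    then show "\<mu> (cyl n m \<inter> {X. P (pref X n)}) = of_bool (P m) / 2 ^ n"
      using m measure_cyl[of m n] by (simp add: power_one_over)
  qed simp
  finally show ?thesis by (simp only: of_nat_sum of_nat_of_bool sum_divide_distrib)
qed

text \<open>Along the stages of \<open>V\<close>, the measure of the remainder decreases to its
  limit, so a strict upper bound is already visible at some stage. There the measure is a count of
  strings of length \<open>t\<close> divided by \<open>2 ^ t\<close>, and the comparison becomes one
  of natural numbers.\<close>

lemma re_residual_less:
  assumes "rc A len" "sig1 A V"
  shows "re A (\<lambda>e. \<mu> (cyl n m \<inter> block len e - V) < (1 / 2) ^ (c + e))"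
proof -
  obtain D where D: "dec A (\<lambda>p. D (fst p) (snd p))"
    "\<And>i j m. D i (m div 2 ^ (j - i)) \<Longrightarrow> i \<le> j \<Longrightarrow> D j m"
    "V = {X. \<exists>n. D n (pref X n)}"
    by (rule sig1_witness[OF assms(2)]) (rule that)
  have mono: "D j (pref X j)" if "D i (pref X i)" "i \<le> j" for i j X
    using D(2)[of i "pref X j" j] that by (simp add: pref_div)
  define B where "B e t x \<longleftrightarrow> x div 2 ^ (t - n) = m \<and> inblock len e t x \<and> \<not> D t x" for e t x
  have B_eq: "{X. B e t (pref X t)} = cyl n m \<inter> block len e - {X. D t (pref X t)}"
    if "n \<le> t" "decided len e t" for e t
    using that by (auto simp: B_def pref_div cyl_def inblock_iff)
  let ?S = "\<lambda>e t. n \<le> t \<and> decided len e t \<and> (\<Sum>x<2 ^ t. of_bool (B e t x)) * 2 ^ (c + e) < (2 :: nat) ^ t"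
  have S_iff: "(\<Sum>x<2 ^ t. of_bool (B e t x)) * 2 ^ (c + e) < (2 :: nat) ^ t \<longleftrightarrow>
    \<mu> (cyl n m \<inter> block len e - {X. D t (pref X t)}) < (1 / 2) ^ (c + e)" 
    if "n \<le> t" "decided len e t" for e t
  proof -
    have "(\<Sum>x<2 ^ t. of_bool (B e t x)) * 2 ^ (c + e) < (2 :: nat) ^ t \<longleftrightarrow>
      real (\<Sum>x<2 ^ t. of_bool (B e t x)) * 2 ^ (c + e) < 2 ^ t"
      by (subst of_nat_less_iff[where 'a = real, symmetric]) (simp only: of_nat_mult of_nat_power of_nat_numeral)
    also have "\<dots> \<longleftrightarrow> real (\<Sum>x<2 ^ t. of_bool (B e t x)) / 2 ^ t < (1 / 2) ^ (c + e)"
      by (simp add: field_simps power_one_over del: of_nat_sum)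
    finally show ?thesis unfolding B_eq[OF that, symmetric] measure_pref .
  qed
  have "\<mu> (cyl n m \<inter> block len e - V) < (1 / 2) ^ (c + e) \<longleftrightarrow> (\<exists>t. ?S e t)" for e
  proof
    let ?C = "\<lambda>t. cyl n m \<inter> block len e - {X. D t (pref X t)}"
    assume less: "\<mu> (cyl n m \<inter> block len e - V) < (1 / 2) ^ (c + e)"
    have "(\<lambda>t. \<mu> (?C t)) \<longlonglongrightarrow> \<mu> (\<Inter>t. ?C t)"
    proof (rule cantor.finite_Lim_measure_decseq)
      show "decseq ?C" by (rule decseq_SucI) (use mono in \<open>auto simp del: pref.simps\<close>)
    qed auto
    also have "(\<Inter>t. ?C t) = cyl n m \<inter> block len e - V" unfolding D(3) by auto
    finally have "eventually (\<lambda>t. \<mu> (?C t) < (1 / 2) ^ (c + e)) sequentially"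
      using less by (rule order_tendstoD)
    moreover obtain t0 where "decided len e t0" using ex_decided by blast
    then have "eventually (\<lambda>t. decided len e t) sequentially"
      unfolding eventually_sequentially using decided_mono by blast
    moreover have "eventually (\<lambda>t. n \<le> t) sequentially" by (rule eventually_ge_at_top)
    ultimately have "eventually (?S e) sequentially"
      by eventually_elim (simp only: S_iff simp_thms)
    then show "\<exists>t. ?S e t" by (auto simp: eventually_sequentially)
  next
    assume "\<exists>t. ?S e t"
    then obtain t where t: "\<mu> (cyl n m \<inter> block len e - {X. D t (pref X t)}) < (1 / 2) ^ (c + e)"
      using S_iff by blast
    have "\<mu> (cyl n m \<inter> block len e - V) \<le> \<mu> (cyl n m \<inter> block len e - {X. D t (pref X t)})"
      by (rule cantor.finite_measure_mono) (auto simp: D(3))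
    with t show "\<mu> (cyl n m \<inter> block len e - V) < (1 / 2) ^ (c + e)" by linarith
  qed
  moreover have "dec A (\<lambda>p. ?S (fst p) (snd p))"
    unfolding B_def by (intro rc_intros assms(1) dec_comp2[OF D(1)])
  ultimately show ?thesis unfolding re_def by (intro exI[of _ ?S]) (rule conjI, assumption, rule allI)
qed

text \<open>At least half of \<open>cyl n m - V\<close> lies outside all blocks, so the points of
  the cylinder that avoid the blocks have measure at least half of the condition. By independence
  that measure is at most the product of the factors \<open>1 - (1 / 2) ^ len e\<close>, hence at
  most \<open>exp\<close> of minus the total weight; taking logarithms gives the bound.\<close>

lemma weight_bound:
  assumes V: "V \<in> sets cantor_measure" and F: "finite F" "\<And>e. e \<in> F \<Longrightarrow> n \<le> e" and m: "m < 2 ^ n"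
    and res: "(\<Sum>e\<in>F. \<mu> (cyl n m \<inter> block len e - V)) \<le> \<mu> (cyl n m - V) / 2"
    and pos: "\<mu> (cyl n m - V) > 0"
  shows "(\<Sum>e\<in>F. (1 / 2) ^ len e) \<le> - ln (\<mu> (cyl n m - V) / 2)"
proof -
  let ?J = "\<lambda>e. (\<lambda>j. prod_encode (e, j)) ` {..<len e}"
  let ?T = "{X \<in> cyl n m. \<forall>e\<in>F. X \<notin> block len e}"
  obtain Y where Y: "pref Y n = m" using pref_surj[OF m] by blast
  have T_eq: "?T = {X. (\<forall>i\<in>{..<n}. X i = Y i) \<and> (\<forall>e\<in>F. \<exists>i\<in>?J e. X i)}"
    unfolding block_eq_bits cyl_def Y[symmetric] pref_eq_iff by auto
  have "\<mu> ?T = (1 / 2) ^ card {..<n} * (\<Prod>e\<in>F. 1 - (1 / 2) ^ card (?J e))"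
    unfolding T_eq
  proof (rule measure_blocks)
    show "disjoint_family_on ?J F" by (auto simp: disjoint_family_on_def)
    \<comment> \<open>A pair code is at least its first component, so blocks with
      \<open>e \<ge> n\<close> avoid the bits that the cylinder fixes.\<close>
    show "{..<n} \<inter> ?J e = {}" if "e \<in> F" for e
    proof -
      have "n \<le> prod_encode (e, j)" for j using F(2)[OF that] le_prod_encode_1[of e j] by linarith
      then show ?thesis by (fastforce simp: not_less[symmetric])
    qed
  qed (use F in auto)
  also have "\<dots> \<le> 1 * (\<Prod>e\<in>F. exp (- ((1 / 2) ^ len e)))"
  proof (intro mult_mono prod_mono conjI)
    fix e
    show "0 \<le> 1 - (1 / 2 :: real) ^ card (?J e)" by (simp add: power_le_one)
    show "1 - (1 / 2 :: real) ^ card (?J e) \<le> exp (- ((1 / 2) ^ len e))"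
      using exp_ge_add_one_self[of "- ((1 / 2) ^ len e)"] by (simp add: card_block_bits)
  qed (auto simp: power_le_one intro!: prod_nonneg)
  also have "\<dots> = exp (- (\<Sum>e\<in>F. (1 / 2) ^ len e))"
    using F(1) by (simp add: exp_sum[symmetric] sum_negf)
  finally have T: "\<mu> ?T \<le> exp (- (\<Sum>e\<in>F. (1 / 2) ^ len e))" .
  have "?T = cyl n m - (\<Union>e\<in>F. block len e)" by auto
  then have mT: "?T \<in> sets cantor_measure" using F(1) by auto
  have "\<mu> (cyl n m - V) \<le> \<mu> (?T \<union> (\<Union>e\<in>F. cyl n m \<inter> block len e - V))"
    using mT V F(1) by (intro cantor.finite_measure_mono) auto
  also have "\<dots> \<le> \<mu> ?T + \<mu> (\<Union>e\<in>F. cyl n m \<inter> block len e - V)"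
    using mT V F(1) by (intro measure_Un_le) auto
  also have "\<mu> (\<Union>e\<in>F. cyl n m \<inter> block len e - V) \<le> (\<Sum>e\<in>F. \<mu> (cyl n m \<inter> block len e - V))"
    using V F(1) by (intro measure_UNION_le) auto
  finally have "\<mu> (cyl n m - V) / 2 \<le> exp (- (\<Sum>e\<in>F. (1 / 2) ^ len e))" using T res by linarith
  then have "ln (\<mu> (cyl n m - V) / 2) \<le> - (\<Sum>e\<in>F. (1 / 2) ^ len e)"
    using pos by (subst ln_exp[symmetric], subst ln_le_cancel_iff) auto
  then show ?thesis by linarith
qed

text \<open>
  The blocks of distinct codes are independent, and the block of \<open>e\<close> has measure \<open>2\<close> to the
  power \<open>- len e\<close>. If every condition could be extended into a further block of \<open>W\<close>, forcing
  would yield a point outside all \<open>N i\<close> in infinitely many blocks of \<open>W\<close>, against Solovay's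
  criterion. So below some condition \<open>cyl n m - V\<close> almost all blocks of \<open>W\<close> are null; having a small
  trace there is \<open>B\<close>-enumerable, and by independence only a set of codes of finite weight has it.
\<close>

lemma finite_weight_cover:
  fixes len :: "nat \<Rightarrow> nat"
  assumes N: "\<And>i::nat. small_cover B (N i)" and low: "\<And>X. (\<And>i. X \<notin> N i) \<Longrightarrow> ml_random A X"
    and len: "rc A len" "rc B len" and W: "re A (\<lambda>e. e \<in> W)"
    and fin: "\<And>n. (\<Sum>e<n. of_bool (e \<in> W) * (1 / 2 :: real) ^ len e) \<le> K"
  obtains W' K' where "re B (\<lambda>e. e \<in> W')" "W \<subseteq> W'"
    "\<And>n. (\<Sum>e<n. of_bool (e \<in> W') * (1 / 2 :: real) ^ len e) \<le> K'"
proof -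
  have "\<exists>n m V k. sig1 B V \<and> \<mu> (cyl n m - V) > 0 \<and> (\<forall>e\<ge>k. e \<in> W \<longrightarrow> \<not> \<mu> (cyl n m \<inter> block len e - V) > 0)"
  proof (rule ccontr)
    assume "\<not> ?thesis"
    then have step: "\<And>n m V k. sig1 B V \<Longrightarrow> \<mu> (cyl n m - V) > 0 \<Longrightarrow>
      \<exists>e\<ge>k. e \<in> W \<and> \<mu> (cyl n m \<inter> block len e - V) > 0" by blast
    have clopen: "\<exists>l. \<forall>X Y. pref X l = pref Y l \<longrightarrow> X \<in> block len e \<longrightarrow> Y \<in> block len e" for e
      using ex_decided[of len e] inblock_iff[of len e] by metis
    obtain X where X: "\<And>i. X \<notin> N i" "infinite {e \<in> W. X \<in> block len e}"
      by (rule forcing[of B N "block len" W, OF N clopen sets_block step]) (assumption+, rule that)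
    have "\<not> ml_random A X"
    proof (rule solovay[OF copen_block[OF len(1) W]])
      have "\<mu> (if e \<in> W then block len e else {}) = of_bool (e \<in> W) * (1 / 2) ^ len e" for e
        by (simp add: measure_block)
      then show "(\<Sum>e<n. \<mu> (if e \<in> W then block len e else {})) \<le> K" for n using fin[of n] by simp
      have "{e. X \<in> (if e \<in> W then block len e else {})} = {e \<in> W. X \<in> block len e}" by auto
      then show "infinite {e. X \<in> (if e \<in> W then block len e else {})}" using X(2) by simp
    qed
    with low X(1) show False by blast
  qed
  then obtain n m V k where V: "sig1 B V" and pos: "\<mu> (cyl n m - V) > 0"
    and null: "\<And>e. e \<ge> k \<Longrightarrow> e \<in> W \<Longrightarrow> \<not> \<mu> (cyl n m \<inter> block len e - V) > 0" by blast
  have m: "m < 2 ^ n"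
  proof (rule ccontr)
    assume "\<not> m < 2 ^ n"
    then have "cyl n m = {}" using pref_less[of _ n] by (auto simp: cyl_def)
    with pos show False by simp
  qed
  let ?k = "max k n"
  let ?\<delta> = "\<mu> (cyl n m - V)"
  \<comment> \<open>With this \<open>c\<close> the thresholds \<open>(1 / 2) ^ (c + e)\<close> sum
    to at most half of the measure of the condition, as \<open>weight_bound\<close> demands.\<close>
  obtain c where c: "(1 / 2 :: real) ^ c < ?\<delta> / 4"
    using real_arch_pow_inv[of "?\<delta> / 4" "1 / 2"] pos by auto
  \<comment> \<open>The codes below \<open>?k\<close> are added by hand: those below
    \<open>k\<close> may belong to \<open>W\<close> with a large trace, and those below
    \<open>n\<close> may have blocks that share bits with the cylinder.\<close>
  define W' where "W' = {e. e < ?k \<or> \<mu> (cyl n m \<inter> block len e - V) < (1 / 2) ^ (c + e)}"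
  show thesis
  proof (rule that)
    show "re B (\<lambda>e. e \<in> W')" unfolding W'_def mem_Collect_eq
      by (intro re_disj re_residual_less re_dec rc_intros len(2) V)
    show "W \<subseteq> W'"
    proof
      fix e assume e: "e \<in> W"
      show "e \<in> W'"
      proof (cases "e < ?k")
        case False
        then have "k \<le> e" by simp
        from null[OF this e] have "\<mu> (cyl n m \<inter> block len e - V) \<le> 0" by linarith
        also have "0 < (1 / 2 :: real) ^ (c + e)" by simp
        finally show ?thesis by (simp add: W'_def)
      qed (simp add: W'_def)
    qed
    fix N
    let ?F = "{e. e < N \<and> e \<in> W' \<and> ?k \<le> e}"
    have "(\<Sum>e\<in>?F. \<mu> (cyl n m \<inter> block len e - V)) \<le> (\<Sum>e\<in>?F. (1 / 2) ^ (c + e))"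
      by (rule sum_mono) (auto simp: W'_def)
    also have "\<dots> \<le> (\<Sum>e<N. (1 / 2) ^ (c + e))" by (rule sum_mono2) auto
    also have "\<dots> = (1 / 2) ^ c * (\<Sum>e<N. (1 / 2) ^ e)" by (simp add: power_add sum_distrib_left)
    also have "(\<Sum>e<N. (1 / 2 :: real) ^ e) \<le> 2"
      by (subst sum_gp_strict) simp
    finally have res: "(\<Sum>e\<in>?F. \<mu> (cyl n m \<inter> block len e - V)) \<le> ?\<delta> / 2" using c by simp
    have "(\<Sum>e<N. of_bool (e \<in> W') * (1 / 2 :: real) ^ len e) \<le> (\<Sum>e\<in>?F \<union> {..<?k}. (1 / 2) ^ len e)"
    proof -
      have "(\<Sum>e<N. of_bool (e \<in> W') * (1 / 2 :: real) ^ len e) =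
          (\<Sum>e<N. if e \<in> W' then (1 / 2) ^ len e else 0)"
        by (intro sum.cong) auto
      also have "\<dots> = (\<Sum>e\<in>{e\<in>{..<N}. e \<in> W'}. (1 / 2) ^ len e)"
        by (rule sum.inter_filter[symmetric]) simp
      also have "\<dots> \<le> (\<Sum>e\<in>?F \<union> {..<?k}. (1 / 2) ^ len e)" by (rule sum_mono2) auto
      finally show ?thesis .
    qed
    also have "\<dots> = (\<Sum>e\<in>?F. (1 / 2) ^ len e) + (\<Sum>e<?k. (1 / 2) ^ len e)"
      by (rule sum.union_disjoint) auto
    also have "(\<Sum>e\<in>?F. (1 / 2) ^ len e) \<le> - ln (?\<delta> / 2)"
      by (rule weight_bound[OF _ _ _ m res pos]) (use sets_copen[OF V] in auto)
    finally show "(\<Sum>e<N. of_bool (e \<in> W') * (1 / 2 :: real) ^ len e) \<le>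
      - ln (?\<delta> / 2) + (\<Sum>e<?k. (1 / 2) ^ len e)" by simp
  qed
qed

section \<open>Binary expansions\<close>

lemma pref_sum: "(\<Sum>i<n. of_bool (X i) / 2 ^ Suc i) = (real (pref X n) / 2 ^ n :: real)"
  by (induction n) (auto simp: field_simps)

lemma binary_summable: "summable (\<lambda>n. of_bool (X n) / 2 ^ Suc n :: real)"
  by (rule summable_comparison_test[OF _ sums_summable[OF power_half_series]])
    (auto simp: power_one_over)

lemma binary_real_bounds:
  "real (pref X n) / 2 ^ n \<le> binary_real X" "binary_real X \<le> (real (pref X n) + 1) / 2 ^ n"
proof -
  let ?r = "\<lambda>i. of_bool (X (i + n)) / 2 ^ Suc (i + n) :: real"
  have s: "summable ?r" using binary_summable[of X] by (subst summable_iff_shift)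
  have e: "binary_real X = suminf ?r + real (pref X n) / 2 ^ n"
    unfolding binary_real_def using suminf_split_initial_segment[OF binary_summable, of X n]
    by (simp only: pref_sum)
  have "0 \<le> suminf ?r" by (rule suminf_nonneg[OF s]) simp
  with e show "real (pref X n) / 2 ^ n \<le> binary_real X" by simp
  have h: "(\<lambda>i. (1 / 2) ^ Suc i * (1 / 2 ^ n)) sums (1 * (1 / 2 ^ n) :: real)"
    by (intro sums_mult2 power_half_series)
  have "suminf ?r \<le> 1 * (1 / 2 ^ n)"
    by (rule sums_le[OF _ summable_sums[OF s] h]) (auto simp: power_one_over power_add)
  with e show "binary_real X \<le> (real (pref X n) + 1) / 2 ^ n"
    by (simp add: add_divide_distrib)
qed

lemma binary_real_range: "binary_real X \<in> {0..1}"
  using binary_real_bounds[of X 0] by simp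

lemma measurable_binary_real [measurable]: "binary_real \<in> borel_measurable cantor_measure"
proof -
  have [measurable]: "(\<lambda>X. of_bool (X n) :: real) \<in> borel_measurable cantor_measure" for n
    by (rule measurable_compose[OF measurable_bit]) simp
  show ?thesis unfolding binary_real_def by measurable
qed

lemma measure_pref_less: "m \<le> 2 ^ n \<Longrightarrow> \<mu> {X. pref X n < m} = real m / 2 ^ n"
proof -
  assume "m \<le> 2 ^ n"
  then have "{x. x < 2 ^ n \<and> x < m} = {..<m}" by auto
  then have "(\<Sum>x<2 ^ n. of_bool (x < m)) = m"
    by (simp add: of_bool_def sum.If_cases Int_def)
  then show ?thesis using measure_pref[of "\<lambda>x. x < m" n] by simp
qed

text \<open>The distribution functions agree: for \<open>x\<close> in the unit interval, the event
  \<open>binary_real X \<le> x\<close> lies between two events about the first \<open>n\<close>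
  bits, which confine its measure to within \<open>(1 / 2) ^ n\<close> of \<open>x\<close>.\<close>

lemma distr_binary_real: "distr cantor_measure borel binary_real = uniform_measure lborel {0..1::real}"
proof (rule cdf_unique)
  interpret d: prob_space "distr cantor_measure borel binary_real"
    by (rule cantor.prob_space_distr) measurable
  show d: "real_distribution (distr cantor_measure borel binary_real)"
    by unfold_locales simp_all
  interpret u: prob_space "uniform_measure lborel {0..1::real}"
    by (rule prob_space_uniform_measure) simp_all
  show "real_distribution (uniform_measure lborel {0..1::real})"
    by unfold_locales simp_all
  show "cdf (distr cantor_measure borel binary_real) = cdf (uniform_measure lborel {0..1::real})"
  proof
    fix x :: real
    have u: "cdf (uniform_measure lborel {0..1}) x = measure lborel ({0..1} \<inter> {..x})"
      by (simp add: cdf_def measure_uniform_measure)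
    have "binary_real -` {..x} \<inter> space cantor_measure = {X. binary_real X \<le> x}" by auto
    then have d: "cdf (distr cantor_measure borel binary_real) x = \<mu> {X. binary_real X \<le> x}"
      by (simp add: cdf_def measure_distr)
    have [measurable]: "{X. binary_real X \<le> x} \<in> sets cantor_measure"
      using measurable_sets[OF measurable_binary_real, of "{..x}"] by (simp add: vimage_def)
    consider "x < 0" | "0 \<le> x" "x < 1" | "1 \<le> x" by linarith
    then show "cdf (distr cantor_measure borel binary_real) x = cdf (uniform_measure lborel {0..1}) x"
      unfolding u d
    proof cases
      case 1
      have "{X. binary_real X \<le> x} = {}" "{0..1} \<inter> {..x} = {}"
        using 1 binary_real_range by (auto simp: not_le intro: less_le_trans)
      then show "\<mu> {X. binary_real X \<le> x} = measure lborel ({0..1} \<inter> {..x})" by simp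
    next
      case 3
      have "{X. binary_real X \<le> x} = UNIV" "{0..1} \<inter> {..x} = {0..1}"
        using 3 binary_real_range by (auto intro: order_trans)
      then show "\<mu> {X. binary_real X \<le> x} = measure lborel ({0..1} \<inter> {..x})"
        using cantor.prob_space by simp
    next
      case 2
      have "\<bar>\<mu> {X. binary_real X \<le> x} - x\<bar> \<le> (1 / 2) ^ n" for n
      proof -
        define m where "m = nat \<lfloor>x * 2 ^ n\<rfloor>"
        have m: "real m \<le> x * 2 ^ n" "x * 2 ^ n < real m + 1" using 2 by (auto simp: m_def)
        have "x * 2 ^ n < 2 ^ n" using 2 by simp
        with m(1) have "real m < 2 ^ n" by linarith
        also have "\<dots> = real (2 ^ n)" by simp
        finally have "real m < real (2 ^ n)" .
        then have m2: "m < 2 ^ n" unfolding of_nat_less_iff .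
        have "{X. pref X n < m} \<subseteq> {X. binary_real X \<le> x}"
        proof (clarify)
          fix X assume "pref X n < m"
          then have "real (pref X n) + 1 \<le> real m" by linarith
          then have "(real (pref X n) + 1) / 2 ^ n \<le> x" using m(1) by (simp add: divide_le_eq)
          with binary_real_bounds(2)[of X n] show "binary_real X \<le> x" by linarith
        qed
        moreover have "{X. binary_real X \<le> x} \<subseteq> {X. pref X n < Suc m}"
        proof (clarify)
          fix X assume "binary_real X \<le> x"
          with binary_real_bounds(1)[of X n] have "real (pref X n) / 2 ^ n \<le> x" by linarith
          then have "real (pref X n) \<le> x * 2 ^ n" by (simp add: divide_le_eq)
          with m(2) show "pref X n < Suc m" by linarith
        qed
        ultimately have "\<mu> {X. pref X n < m} \<le> \<mu> {X. binary_real X \<le> x}"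
          "\<mu> {X. binary_real X \<le> x} \<le> \<mu> {X. pref X n < Suc m}"
          by (auto intro!: cantor.finite_measure_mono)
        moreover have "\<mu> {X. pref X n < m} = real m / 2 ^ n" "\<mu> {X. pref X n < Suc m} = real (Suc m) / 2 ^ n"
          using m2 by (intro measure_pref_less; simp)+
        moreover have "real m / 2 ^ n \<le> x" "x \<le> real (Suc m) / 2 ^ n"
          using m by (simp_all add: field_simps)
        ultimately show ?thesis by (simp add: add_divide_distrib power_one_over abs_le_iff)
      qed
      moreover have "(\<lambda>n. (1 / 2 :: real) ^ n) \<longlonglongrightarrow> 0" by (rule LIMSEQ_realpow_zero) auto
      ultimately have "\<bar>\<mu> {X. binary_real X \<le> x} - x\<bar> \<le> 0" by (intro LIMSEQ_le_const) auto
      moreover have "{0..1} \<inter> {..x} = {0..x}" using 2 by auto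
      ultimately show "\<mu> {X. binary_real X \<le> x} = measure lborel ({0..1} \<inter> {..x})" using 2 by simp
    qed
  qed
qed

lemma measure_binary_real:
  assumes "S \<in> sets borel" "S \<subseteq> {0..1}"
  shows "measure lborel S = \<mu> {X. binary_real X \<in> S}"
proof -
  have "\<mu> {X. binary_real X \<in> S} = measure (distr cantor_measure borel binary_real) S"
    using assms(1) by (subst measure_distr) (auto simp: vimage_def)
  also have "\<dots> = measure lborel ({0..1} \<inter> S)"
    unfolding distr_binary_real using assms(1) by (simp add: measure_uniform_measure)
  also have "{0..1} \<inter> S = S" using assms(2) by auto
  finally show ?thesis ..
qed

text \<open>The integer parts of \<open>x * 2 ^ n\<close> are the prefixes of an expansion of
  \<open>x\<close>. At \<open>x = 1\<close> this would break down already for \<open>n = 0\<close>,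
  where the prefix has to be \<open>0\<close>.\<close>

lemma binary_real_surj: "x \<in> {0..<1} \<Longrightarrow> \<exists>X. binary_real X = x"
proof -
  assume x: "x \<in> {0..<1}"
  define f where "f n = nat \<lfloor>x * 2 ^ n\<rfloor>" for n :: nat
  have f: "real (f n) \<le> x * 2 ^ n" "x * 2 ^ n < real (f n) + 1" for n
    using x by (auto simp: f_def)
  define X where "X n = odd (f (Suc n))" for n
  have p: "pref X n = f n" for n
  proof (induction n)
    case 0
    have "real (f 0) < 1" using f(1)[of 0] x by simp
    then show ?case by simp
  next
    case (Suc n)
    have "real (f (Suc n)) < 2 * real (f n) + 2" "2 * real (f n) < real (f (Suc n)) + 1"
      using f[of n] f[of "Suc n"] by simp_all
    then have "f (Suc n) = 2 * f n \<or> f (Suc n) = Suc (2 * f n)" by linarith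
    with Suc show ?case by (auto simp: X_def)
  qed
  have "\<bar>binary_real X - x\<bar> \<le> (1 / 2) ^ n" for n
  proof -
    have "real (f n) / 2 ^ n \<le> x" "x \<le> (real (f n) + 1) / 2 ^ n"
      using f[of n] by (simp_all add: field_simps)
    with binary_real_bounds[of X n] show ?thesis
      unfolding p by (simp add: add_divide_distrib power_one_over abs_le_iff)
  qed
  moreover have "(\<lambda>n. (1 / 2 :: real) ^ n) \<longlonglongrightarrow> 0" by (rule LIMSEQ_realpow_zero) auto
  ultimately have "\<bar>binary_real X - x\<bar> \<le> 0" by (intro LIMSEQ_le_const) auto
  then show ?thesis by auto
qed

section \<open>Effectively closed sets of reals\<close>

lemma borel_effectively_closed: "effectively_closed A C \<Longrightarrow> C \<in> sets borel"
proof -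
  assume "effectively_closed A C"
  then obtain W where W: "C \<subseteq> {0..1}" "{0..1} - C = {0..1} \<inter> (\<Union>c\<in>W. interval_of_code c)"
    by (auto simp: effectively_closed_def)
  then have "C = {0..1} - (\<Union>c\<in>W. interval_of_code c)" by blast
  moreover have "open (\<Union>c\<in>W. interval_of_code c)"
    by (auto simp: interval_of_code_def split: prod.split)
  ultimately show ?thesis by auto
qed

text \<open>Compares a coded rational with a dyadic one after clearing denominators. Odd numerator
  codes stand for negative integers, which lie to the left of every dyadic interval
  considered.\<close>

definition insideL :: "nat \<Rightarrow> nat \<Rightarrow> nat \<Rightarrow> bool" where
  "insideL c n m \<longleftrightarrow> (let i = fst (prod_decode c); j = snd (prod_decode c) in
     odd i \<or> (i div 2) * 2 ^ n < m * Suc j)"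

definition insideR :: "nat \<Rightarrow> nat \<Rightarrow> nat \<Rightarrow> bool" where
  "insideR c n m \<longleftrightarrow> (let i = fst (prod_decode c); j = snd (prod_decode c) in
     even i \<and> Suc m * Suc j < (i div 2) * 2 ^ n)"

lemma int_decode_odd: "odd i \<Longrightarrow> int_decode i < 0"
  by (simp add: int_decode_def sum_decode_def)

lemma int_decode_even: "even i \<Longrightarrow> int_decode i = int (i div 2)"
  by (simp add: int_decode_def sum_decode_def)

lemma frac_less_frac_iff: "0 < b \<Longrightarrow> 0 < d \<Longrightarrow> a / b < c / d \<longleftrightarrow> a * d < c * (b :: real)"
  by (simp add: field_simps)

lemma insideL_iff: "insideL c n m \<longleftrightarrow> rat_of_code c < real m / 2 ^ n"
proof -
  obtain i j where c: "prod_decode c = (i, j)" by (cases "prod_decode c")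
  show ?thesis
  proof (cases "odd i")
    case True
    then have "real_of_int (int_decode i) / real (Suc j) < 0"
      using int_decode_odd by (intro divide_neg_pos) auto
    also have "0 \<le> real m / 2 ^ n" by simp
    finally show ?thesis using True c by (simp add: insideL_def rat_of_code_def)
  next
    case False
    then have "rat_of_code c = real (i div 2) / real (Suc j)"
      using c by (simp add: rat_of_code_def int_decode_even)
    also have "\<dots> < real m / 2 ^ n \<longleftrightarrow> real (i div 2) * 2 ^ n < real m * real (Suc j)"
      by (subst frac_less_frac_iff) auto
    also have "\<dots> \<longleftrightarrow> real ((i div 2) * 2 ^ n) < real (m * Suc j)"
      by (simp only: of_nat_mult of_nat_power of_nat_numeral)
    also have "\<dots> \<longleftrightarrow> (i div 2) * 2 ^ n < m * Suc j" by (simp only: of_nat_less_iff)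
    finally show ?thesis using False c by (simp add: insideL_def)
  qed
qed

lemma insideR_iff: "insideR c n m \<longleftrightarrow> (real m + 1) / 2 ^ n < rat_of_code c"
proof -
  obtain i j where c: "prod_decode c = (i, j)" by (cases "prod_decode c")
  show ?thesis
  proof (cases "odd i")
    case True
    then have "real_of_int (int_decode i) / real (Suc j) < 0"
      using int_decode_odd by (intro divide_neg_pos) auto
    also have "0 \<le> (real m + 1) / 2 ^ n" by simp
    finally show ?thesis using True c by (simp add: insideR_def rat_of_code_def)
  next
    case False
    then have "rat_of_code c = real (i div 2) / real (Suc j)"
      using c by (simp add: rat_of_code_def int_decode_even)
    also have "(real m + 1) / 2 ^ n < \<dots> \<longleftrightarrow> real (Suc m) * real (Suc j) < real (i div 2) * 2 ^ n"
      by (subst frac_less_frac_iff) (auto simp: add.commute)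
    also have "\<dots> \<longleftrightarrow> real (Suc m * Suc j) < real ((i div 2) * 2 ^ n)"
      by (simp only: of_nat_mult of_nat_power of_nat_numeral)
    also have "\<dots> \<longleftrightarrow> Suc m * Suc j < (i div 2) * 2 ^ n" by (simp only: of_nat_less_iff)
    finally show ?thesis using False c by (simp add: insideR_def)
  qed
qed

definition inside :: "nat \<Rightarrow> nat \<Rightarrow> nat \<Rightarrow> bool" where
  "inside c n m \<longleftrightarrow> insideL (fst (prod_decode c)) n m \<and> insideR (snd (prod_decode c)) n m"

lemma inside_iff: "inside c n m \<longleftrightarrow> {real m / 2 ^ n..(real m + 1) / 2 ^ n} \<subseteq> interval_of_code c"
proof -
  have "real m / 2 ^ n \<le> (real m + 1) / 2 ^ n" by (simp add: divide_right_mono)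
  then show ?thesis unfolding inside_def insideL_iff insideR_iff
    by (auto simp: interval_of_code_def split: prod.split)
qed

lemma dec_inside [rc_intros]:
  assumes "rc A f" "rc A g" "rc A h"
  shows "dec A (\<lambda>x. inside (f x) (g x) (h x))"
  unfolding inside_def insideL_def insideR_def Let_def
  by (intro rc_intros assms)

text \<open>A point of an open interval has, for large \<open>n\<close>, the whole dyadic interval
  of its prefix inside, and this is decidable from the prefix. The dyadic interval is taken closed
  because \<open>binary_real X\<close> may be one of its ends.\<close>

lemma sig1_complement:
  assumes "effectively_closed A C"
  shows "sig1 A {X. binary_real X \<notin> C}"
proof -
  obtain W where W: "re A (\<lambda>n. n \<in> W)" "C \<subseteq> {0..1}" "{0..1} - C = {0..1} \<inter> (\<Union>c\<in>W. interval_of_code c)"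
    using assms by (auto simp: effectively_closed_def ce_in_iff_re)
  show ?thesis
  proof (rule sig1I)
    show "re A (\<lambda>p. \<exists>c. c \<in> W \<and> inside c (fst p) (snd p))"
      by (intro re_ex re_conj re_comp[OF W(1)] re_dec rc_intros)
    have "binary_real X \<notin> C \<longleftrightarrow> (\<exists>n c. c \<in> W \<and> inside c n (pref X n))" for X
    proof
      assume "binary_real X \<notin> C"
      then obtain c where c: "c \<in> W" "binary_real X \<in> interval_of_code c"
        using W(3) binary_real_range[of X] by blast
      have "open (interval_of_code c)" by (simp add: interval_of_code_def split: prod.split)
      with c(2) obtain e where e: "e > 0" "cball (binary_real X) e \<subseteq> interval_of_code c"
        by (meson open_contains_cball)
      obtain n where n: "(1 / 2 :: real) ^ n < e" using real_arch_pow_inv[OF e(1), of "1/2"] by auto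
      have "{real (pref X n) / 2 ^ n..(real (pref X n) + 1) / 2 ^ n} \<subseteq> cball (binary_real X) e"
        using binary_real_bounds[of X n] n
        by (auto simp: dist_real_def abs_le_iff power_one_over add_divide_distrib)
      with e(2) have "inside c n (pref X n)" unfolding inside_iff by blast
      with c(1) show "\<exists>n c. c \<in> W \<and> inside c n (pref X n)" by blast
    next
      assume "\<exists>n c. c \<in> W \<and> inside c n (pref X n)"
      then obtain n c where "c \<in> W" "inside c n (pref X n)" by blast
      then have "binary_real X \<in> (\<Union>c\<in>W. interval_of_code c)"
        unfolding inside_iff using binary_real_bounds[of X n] by fastforce
      then show "binary_real X \<notin> C" using W(3) binary_real_range[of X] by blast
    qed
    then show "{X. binary_real X \<notin> C} = {X. \<exists>n c. c \<in> W \<and> inside c n (pref X n)}" by blast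
  qed
qed

text \<open>The integer \<open>m\<close> has code \<open>2 * m\<close>, and the denominator is
  stored as its predecessor.\<close>

definition dyadic_code :: "nat \<Rightarrow> nat \<Rightarrow> nat" where
  "dyadic_code n m = prod_encode (prod_encode (2 * m, 2 ^ n - 1), prod_encode (2 * Suc m, 2 ^ n - 1))"

lemma rc_dyadic_code [rc_intros]: "rc A f \<Longrightarrow> rc A g \<Longrightarrow> rc A (\<lambda>x. dyadic_code (f x) (g x))"
  unfolding dyadic_code_def by (intro rc_intros)

lemma interval_dyadic_code:
  "interval_of_code (dyadic_code n m) = {real m / 2 ^ n<..<(real m + 1) / 2 ^ n}"
proof -
  have "rat_of_code (prod_encode (2 * k, 2 ^ n - 1)) = real k / 2 ^ n" for k
    by (simp add: rat_of_code_def int_decode_even of_nat_diff)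
  note this[of m] this[of "Suc m"]
  then show ?thesis by (simp add: interval_of_code_def dyadic_code_def add.commute)
qed

lemma effectively_closed_dyadic:
  assumes "re A (\<lambda>p. R (fst p) (snd p))"
  shows "effectively_closed A ({0..1} - {x. \<exists>n m. R n m \<and> x \<in> {real m / 2 ^ n<..<(real m + 1) / 2 ^ n}})"
proof -
  have "re A (\<lambda>c. c \<in> {c. \<exists>n m. c = dyadic_code n m \<and> R n m})"
    unfolding mem_Collect_eq
    by (intro re_ex re_conj re_dec rc_intros re_comp2[OF assms])
  moreover have "{0..1} - ({0..1} - {x. \<exists>n m. R n m \<and> x \<in> {real m / 2 ^ n<..<(real m + 1) / 2 ^ n}}) =
    {0..1} \<inter> (\<Union>c\<in>{c. \<exists>n m. c = dyadic_code n m \<and> R n m}. interval_of_code c)"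
  proof -
    have "(\<Union>c\<in>{c. \<exists>n m. c = dyadic_code n m \<and> R n m}. interval_of_code c) =
      {x. \<exists>n m. R n m \<and> x \<in> interval_of_code (dyadic_code n m)}" by blast
    then show ?thesis unfolding interval_dyadic_code by blast
  qed
  ultimately show ?thesis unfolding effectively_closed_def ce_in_iff_re by blast
qed

section \<open>Density points\<close>

text \<open>Dual to \<open>re_residual_less\<close>: measures of effectively open sets are
  approximated from below, so a strict lower bound shows at some stage.\<close>

lemma re_measure_greater:
  assumes "copen A U" "rc A k"
  shows "re A (\<lambda>x. (1 / 2) ^ k x < \<mu> (U x))"
proof -
  obtain D where D: "dec A (\<lambda>p. D (fst p) (fst (snd p)) (snd (snd p)))"
    "\<And>x i j m. D x i (m div 2 ^ (j - i)) \<Longrightarrow> i \<le> j \<Longrightarrow> D x j m"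
    "\<And>x. U x = {X. \<exists>n. D x n (pref X n)}"
    by (rule copen_witness[OF assms(1)]) (rule that)
  have mono: "D x j (pref X j)" if "D x i (pref X i)" "i \<le> j" for x i j X
    using D(2)[of x i "pref X j" j] that by (simp add: pref_div)
  let ?U = "\<lambda>x t. {X. D x t (pref X t)}"
  have U: "U x = (\<Union>t. ?U x t)" for x unfolding D(3) by blast
  have iff: "2 ^ t < (\<Sum>y<2 ^ t. of_bool (D x t y)) * (2 :: nat) ^ k x \<longleftrightarrow> (1 / 2) ^ k x < \<mu> (?U x t)" for x t
  proof -
    have "2 ^ t < (\<Sum>y<2 ^ t. of_bool (D x t y)) * (2 :: nat) ^ k x \<longleftrightarrow>
      2 ^ t < real (\<Sum>y<2 ^ t. of_bool (D x t y)) * 2 ^ k x"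
      by (subst of_nat_less_iff[where 'a = real, symmetric]) (simp only: of_nat_mult of_nat_power of_nat_numeral)
    also have "\<dots> \<longleftrightarrow> (1 / 2) ^ k x < real (\<Sum>y<2 ^ t. of_bool (D x t y)) / 2 ^ t"
      by (simp add: field_simps power_one_over del: of_nat_sum)
    finally show ?thesis unfolding measure_pref .
  qed
  have "(1 / 2) ^ k x < \<mu> (U x) \<longleftrightarrow> (\<exists>t. (1 / 2) ^ k x < \<mu> (?U x t))" for x
  proof
    assume less: "(1 / 2) ^ k x < \<mu> (U x)"
    have "(\<lambda>t. \<mu> (?U x t)) \<longlonglongrightarrow> \<mu> (U x)" unfolding U
    proof (rule cantor.finite_Lim_measure_incseq)
      show "incseq (?U x)" by (rule incseq_SucI) (use mono in \<open>auto simp del: pref.simps\<close>)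
    qed auto
    from order_tendstoD(1)[OF this less] show "\<exists>t. (1 / 2) ^ k x < \<mu> (?U x t)"
      by (auto simp: eventually_sequentially)
  next
    assume "\<exists>t. (1 / 2) ^ k x < \<mu> (?U x t)"
    then obtain t where t: "(1 / 2) ^ k x < \<mu> (?U x t)" ..
    have "\<mu> (?U x t) \<le> \<mu> (U x)"
      using sets_copen[OF assms(1)] by (intro cantor.finite_measure_mono) (auto simp: D(3))
    with t show "(1 / 2) ^ k x < \<mu> (U x)" by linarith
  qed
  then have "(1 / 2) ^ k x < \<mu> (U x) \<longleftrightarrow> (\<exists>t. 2 ^ t < (\<Sum>y<2 ^ t. of_bool (D x t y)) * (2 :: nat) ^ k x)" for x
    unfolding iff .
  moreover have "dec A (\<lambda>p. 2 ^ snd p < (\<Sum>y<2 ^ snd p. of_bool (D (fst p) (snd p) y)) * (2 :: nat) ^ k (fst p))"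
    by (intro rc_intros rc_comp[OF assms(2)]
      dec_comp[OF D(1), of "\<lambda>q. (fst (fst q), snd (fst q), snd q)", simplified])
  ultimately show ?thesis unfolding re_def
    by (intro exI[of _ "\<lambda>x t. 2 ^ t < (\<Sum>y<2 ^ t. of_bool (D x t y)) * (2 :: nat) ^ k x"] conjI allI)
qed

section \<open>Minimal strings and the maximal inequality\<close>

definition minimal :: "(nat \<Rightarrow> nat \<Rightarrow> bool) \<Rightarrow> nat \<Rightarrow> nat \<Rightarrow> bool" where
  "minimal S n m \<longleftrightarrow> S n m \<and> (\<forall>k<n. \<not> S k (m div 2 ^ (n - k)))"

lemma minimal_prefix:
  assumes "S n m" obtains k where "k \<le> n" "minimal S k (m div 2 ^ (n - k))"
proof -
  define k where "k = (LEAST k. S k (m div 2 ^ (n - k)))"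
  have n: "S n (m div 2 ^ (n - n))" using assms by simp
  have "k \<le> n" unfolding k_def using n by (rule Least_le)
  moreover have "S k (m div 2 ^ (n - k))" unfolding k_def using n by (rule LeastI)
  moreover have "\<not> S i (m div 2 ^ (n - k) div 2 ^ (k - i))" if "i < k" for i
  proof -
    have "\<not> S i (m div 2 ^ (n - i))" using not_less_Least that unfolding k_def by blast
    moreover have "2 ^ (n - k) * 2 ^ (k - i) = (2 :: nat) ^ (n - i)"
      using that \<open>k \<le> n\<close> by (simp add: power_add[symmetric])
    ultimately show ?thesis by (simp add: div_mult2_eq[symmetric])
  qed
  ultimately have "minimal S k (m div 2 ^ (n - k))" by (simp add: minimal_def)
  with \<open>k \<le> n\<close> show thesis by (rule that)
qed

abbreviation strlen :: "nat \<Rightarrow> nat" where "strlen e \<equiv> fst (prod_decode e)"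
abbreviation strval :: "nat \<Rightarrow> nat" where "strval e \<equiv> snd (prod_decode e)"

lemma minimal_disjoint:
  assumes "minimal S (strlen e) (strval e)" "minimal S (strlen e') (strval e')"
    "X \<in> cyl (strlen e) (strval e)" "X \<in> cyl (strlen e') (strval e')"
  shows "e = e'"
proof -
  have *: "\<not> n < n'" if "minimal S n (pref X n)" "minimal S n' (pref X n')" for n n'
    using that by (auto simp: minimal_def pref_div)
  have v: "strval e = pref X (strlen e)" "strval e' = pref X (strlen e')"
    using assms(3,4) by (simp_all add: cyl_def)
  with assms(1,2) have "strlen e = strlen e'" using *[of "strlen e" "strlen e'"] *[of "strlen e'" "strlen e"] by simp
  with v have "prod_decode e = prod_decode e'" by (simp add: prod_eq_iff)
  then show ?thesis by (simp add: prod_decode_eq)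
qed

lemma sum_minimal_le:
  assumes "H \<in> sets cantor_measure" "finite F"
    "\<And>e. e \<in> F \<Longrightarrow> minimal S (strlen e) (strval e)"
  shows "(\<Sum>e\<in>F. \<mu> (cyl (strlen e) (strval e) \<inter> H)) \<le> \<mu> H"
proof -
  have "disjoint_family_on (\<lambda>e. cyl (strlen e) (strval e) \<inter> H) F"
    unfolding disjoint_family_on_def using minimal_disjoint assms(3) by blast
  then have "(\<Sum>e\<in>F. \<mu> (cyl (strlen e) (strval e) \<inter> H)) = \<mu> (\<Union>e\<in>F. cyl (strlen e) (strval e) \<inter> H)"
    using assms(1,2) by (intro cantor.finite_measure_finite_Union[symmetric]) auto
  also have "\<dots> \<le> \<mu> H" using assms(1) by (intro cantor.finite_measure_mono) auto
  finally show ?thesis .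
qed

text \<open>An interval of length below \<open>2 * (1 / 2) ^ n\<close> containing a point may cross
  dyadic boundaries, but it meets only dyadic intervals of length \<open>(1 / 2) ^ n\<close> whose
  index differs by at most \<open>2\<close> from that of the point. This gives five neighbours, the
  source of the constant \<open>5\<close>.\<close>

definition near :: "nat \<Rightarrow> nat \<Rightarrow> bool" where
  "near x m \<longleftrightarrow> x \<le> m + 2 \<and> m \<le> x + 2"

lemma near_div: "near x m \<Longrightarrow> near (x div 2 ^ k) (m div 2 ^ k)"
proof -
  have *: "x div 2 ^ k \<le> m div 2 ^ k + 2" if "x \<le> m + 2" for x m :: nat
  proof -
    have "x div 2 ^ k \<le> (m + 2 * 2 ^ k) div 2 ^ k" 
    proof (rule div_le_mono)
      have "m + 2 \<le> m + 2 * 2 ^ k" by simp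
      with that show "x \<le> m + 2 * 2 ^ k" by (rule order_trans)
    qed
    then show ?thesis by simp
  qed
  assume "near x m" then show ?thesis unfolding near_def using * by blast
qed

lemma measure_near: "\<mu> {X. near (pref X n) m \<and> X \<in> S} \<le> (\<Sum>k=m-2..m+2. \<mu> (cyl n k \<inter> S))"
  if "S \<in> sets cantor_measure"
proof -
  have "{X. near (pref X n) m \<and> X \<in> S} = (\<Union>k\<in>{m-2..m+2}. cyl n k \<inter> S)"
    by (auto simp: near_def cyl_def)
  also have "\<mu> \<dots> \<le> (\<Sum>k=m-2..m+2. \<mu> (cyl n k \<inter> S))"
    using that by (intro measure_UNION_le) auto
  finally show ?thesis .
qed

lemma card_near: "card {m-2..m+2 :: nat} \<le> 5" by simp

lemma measure_near_le:
  assumes "S \<in> sets cantor_measure" "\<And>k. near k m \<Longrightarrow> \<mu> (cyl n k \<inter> S) \<le> b"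
  shows "\<mu> {X. near (pref X n) m \<and> X \<in> S} \<le> 5 * b"
proof -
  have b: "0 \<le> b" using order_trans[OF measure_nonneg assms(2)[of m]] by (simp add: near_def)
  have "\<mu> {X. near (pref X n) m \<and> X \<in> S} \<le> (\<Sum>k=m-2..m+2. b)"
    using assms(2) by (intro order_trans[OF measure_near[OF assms(1)] sum_mono]) (auto simp: near_def)
  also have "\<dots> = real (card {m-2..m+2}) * b" by simp
  also have "\<dots> \<le> 5 * b" using b card_near[of m] by (intro mult_right_mono) linarith+
  finally show ?thesis .
qed

lemma measure_cyl_le: "\<mu> (cyl n m) \<le> (1 / 2) ^ n"
proof (cases "m < 2 ^ n")
  case False
  then have "cyl n m = {}" using pref_less[of _ n] by (auto simp: cyl_def)
  then show ?thesis by simp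
qed (simp add: measure_cyl)

text \<open>Dyadic cylinders are nested or disjoint, so minimal strings of \<open>S\<close> provide
  a disjoint selection. Nearness survives truncation, so a point near a string of \<open>S\<close>
  is near its minimal prefix. The neighbourhood of a minimal cylinder has at most
  \<open>5 * 2 ^ j\<close> times the measure of its trace on \<open>H\<close>, and the disjoint
  traces add up to at most that of \<open>H\<close>.\<close>

lemma maximal_inequality:
  assumes H: "H \<in> sets cantor_measure"
    and S: "\<And>n m. S n m \<Longrightarrow> (1 / 2) ^ (n + j) < \<mu> (cyl n m \<inter> H)"
  shows "\<mu> {X. \<exists>n m. S n m \<and> near (pref X n) m} \<le> 5 * 2 ^ j * \<mu> H"
proof -
  let ?M = "\<lambda>e. minimal S (strlen e) (strval e)"
  let ?N = "\<lambda>e. {X. ?M e \<and> near (pref X (strlen e)) (strval e)}"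
  let ?c = "\<lambda>e. cyl (strlen e) (strval e) \<inter> H"
  have sub: "{X. \<exists>n m. S n m \<and> near (pref X n) m} \<subseteq> (\<Union>e. ?N e)"
  proof (clarify)
    fix X n m assume "S n m" and nr: "near (pref X n) m"
    from this(1) obtain k where k: "k \<le> n" "minimal S k (m div 2 ^ (n - k))" by (rule minimal_prefix)
    have "near (pref X k) (m div 2 ^ (n - k))" using near_div[OF nr, of "n - k"] k(1) by (simp add: pref_div)
    with k(2) have "X \<in> ?N (prod_encode (k, m div 2 ^ (n - k)))" by simp
    then show "X \<in> (\<Union>e. ?N e)" by blast
  qed
  have le: "\<mu> (?N e) \<le> of_bool (?M e) * (5 * 2 ^ j * \<mu> (?c e))" for e
  proof (cases "?M e")
    case True
    have "\<mu> {X. near (pref X (strlen e)) (strval e) \<and> X \<in> UNIV} \<le> 5 * (1 / 2) ^ strlen e"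
      by (rule measure_near_le) (simp_all add: measure_cyl_le sets.top[of cantor_measure, simplified])
    also have "(1 / 2 :: real) ^ strlen e = 2 ^ j * (1 / 2) ^ (strlen e + j)"
      by (simp add: power_add power_one_over)
    also have "\<dots> \<le> 2 ^ j * \<mu> (?c e)"
      using True S[of "strlen e" "strval e"] by (intro mult_left_mono) (auto simp: minimal_def)
    finally show ?thesis using True by simp
  qed simp
  have part: "(\<Sum>e<k. \<mu> (?N e)) \<le> 5 * 2 ^ j * \<mu> H" for k
  proof -
    have "(\<Sum>e<k. \<mu> (?N e)) \<le> (\<Sum>e<k. if ?M e then 5 * 2 ^ j * \<mu> (?c e) else 0)"
    proof (rule sum_mono)
      fix e
      show "\<mu> (?N e) \<le> (if ?M e then 5 * 2 ^ j * \<mu> (?c e) else 0)"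
        using le[of e] by (cases "?M e") simp_all
    qed
    also have "\<dots> = (\<Sum>e\<in>{e\<in>{..<k}. ?M e}. 5 * 2 ^ j * \<mu> (?c e))"
      by (rule sum.inter_filter[symmetric]) simp
    also have "\<dots> = 5 * 2 ^ j * (\<Sum>e\<in>{e\<in>{..<k}. ?M e}. \<mu> (?c e))" by (simp only: sum_distrib_left)
    also have "\<dots> \<le> 5 * 2 ^ j * \<mu> H"
      by (intro mult_left_mono sum_minimal_le[OF H]) auto
    finally show ?thesis .
  qed
  have sets: "?N e \<in> sets cantor_measure" for e by (cases "?M e") simp_all
  have sm: "summable (\<lambda>e. \<mu> (?N e))"
    by (rule summableI_nonneg_bounded[of _ "5 * 2 ^ j * \<mu> H"]) (use part in auto)
  have "\<mu> {X. \<exists>n m. S n m \<and> near (pref X n) m} \<le> \<mu> (\<Union>e. ?N e)"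
    using sub sets by (intro cantor.finite_measure_mono) auto
  also have "\<dots> \<le> (\<Sum>e. \<mu> (?N e))"
    using sets sm by (intro cantor.finite_measure_subadditive_countably) auto
  also have "\<dots> \<le> 5 * 2 ^ j * \<mu> H" by (rule suminf_le_const[OF sm part])
  finally show ?thesis .
qed

section \<open>Lower density through eventual inequalities\<close>

definition density_ge :: "real set \<Rightarrow> real \<Rightarrow> real \<Rightarrow> bool" where
  "density_ge C z r \<longleftrightarrow> (\<forall>\<^sub>F (\<gamma>, \<delta>) in at_right 0 \<times>\<^sub>F at_right 0.
     r \<le> measure lborel ({z - \<gamma>..z + \<delta>} \<inter> C) / (\<gamma> + \<delta>))"

lemma density_ge_iff: "density_ge C z r \<longleftrightarrow> (\<forall>\<^sub>F p in at_right 0 \<times>\<^sub>F at_right 0.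
     r \<le> measure lborel ({z - fst p..z + snd p} \<inter> C) / (fst p + snd p))"
  by (simp add: density_ge_def case_prod_unfold)

lemma eventually_right_prod:
  assumes "0 < e" "\<And>\<gamma> \<delta> :: real. 0 < \<gamma> \<Longrightarrow> \<gamma> < e \<Longrightarrow> 0 < \<delta> \<Longrightarrow> \<delta> < e \<Longrightarrow> P (\<gamma>, \<delta>)"
  shows "eventually P (at_right 0 \<times>\<^sub>F at_right 0)"
  unfolding eventually_prod_filter
  by (intro exI[of _ "\<lambda>x. x \<in> {0<..<e}"] conjI eventually_at_right_real[OF assms(1)])
    (use assms(2) in auto)

lemma right_prod_nontrivial: "at_right (0::real) \<times>\<^sub>F at_right (0::real) \<noteq> bot"
  by (simp add: prod_filter_eq_bot)

text \<open>The quotient never exceeds \<open>1\<close>, so only the lower estimate has content, and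
  it reduces to real levels \<open>r\<close> below \<open>1\<close>.\<close>

lemma lower_density_eq_1_iff:
  assumes "C \<in> sets borel"
  shows "lower_density C z = 1 \<longleftrightarrow> (\<forall>r<1. density_ge C z r)"
proof -
  let ?f = "\<lambda>p. measure lborel ({z - fst p..z + snd p} \<inter> C) / (fst p + snd p)"
  let ?F = "at_right (0::real) \<times>\<^sub>F at_right (0::real)"
  have ld: "lower_density C z = Liminf ?F (\<lambda>p. ereal (?f p))"
    by (simp add: lower_density_def case_prod_unfold)
  have "\<forall>\<^sub>F p in ?F. ereal (?f p) \<le> 1"
  proof (rule eventually_right_prod[of 1])
    fix \<gamma> \<delta> :: real assume p: "0 < \<gamma>" "0 < \<delta>"
    have "measure lborel ({z - \<gamma>..z + \<delta>} \<inter> C) \<le> measure lborel {z - \<gamma>..z + \<delta>}"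
      using assms by (intro measure_mono_fmeasurable) (auto simp: fmeasurable_def emeasure_lborel_Icc_eq)
    also have "\<dots> = \<gamma> + \<delta>" using p by simp
    finally show "ereal (?f (\<gamma>, \<delta>)) \<le> 1" using p by (simp add: divide_le_eq)
  qed simp
  then have "Limsup ?F (\<lambda>p. ereal (?f p)) \<le> 1" by (rule Limsup_bounded)
  with Liminf_le_Limsup[OF right_prod_nontrivial] have le: "lower_density C z \<le> 1"
    unfolding ld by (rule order_trans)
  show ?thesis
  proof
    assume eq: "lower_density C z = 1"
    show "\<forall>r<1. density_ge C z r"
    proof (intro allI impI)
      fix r :: real assume "r < 1"
      then have "ereal r < Liminf ?F (\<lambda>p. ereal (?f p))" using eq ld by simp
      from less_LiminfD[OF this] show "density_ge C z r"
        unfolding density_ge_iff by eventually_elim simp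
    qed
  next
    assume d: "\<forall>r<1. density_ge C z r"
    have "1 \<le> lower_density C z"
    proof (rule dense_le_bounded[of "0::ereal"])
      fix w :: ereal assume w: "0 < w" "w < 1"
      then obtain r where r: "w = ereal r" by (cases w) auto
      with w(2) d have "density_ge C z r" by simp
      then show "w \<le> lower_density C z" unfolding ld r density_ge_iff
        by (intro Liminf_bounded) simp
    qed simp
    with le show "lower_density C z = 1" by (rule antisym)
  qed
qed

text \<open>The cover is a finite set of strings near \<open>pref Z n\<close>, so it is effectively
  open whatever \<open>Z\<close> is: the prefix enters as a constant.\<close>

lemma small_cover_fibre: "small_cover A {Y. binary_real Y = binary_real Z}"
  unfolding small_cover_def
proof (intro allI impI)
  fix \<epsilon> :: real assume "\<epsilon> > 0"
  then obtain n where n: "(1 / 2 :: real) ^ n < \<epsilon> / 5"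
    using real_arch_pow_inv[of "\<epsilon> / 5" "1 / 2"] by auto
  let ?V = "{X. near (pref X n) (pref Z n)}"
  have "re A (\<lambda>p. fst p = n \<and> near (snd p) (pref Z n))"
    unfolding near_def by (intro re_dec rc_intros)
  then have "sig1 A ?V" by (rule sig1I) auto
  moreover have "{Y. binary_real Y = binary_real Z} \<subseteq> ?V"
  proof (clarify)
    fix Y assume "binary_real Y = binary_real Z"
    then have "real (pref Y n) / 2 ^ n \<le> (real (pref Z n) + 1) / 2 ^ n"
      "real (pref Z n) / 2 ^ n \<le> (real (pref Y n) + 1) / 2 ^ n"
      using binary_real_bounds[of Y n] binary_real_bounds[of Z n] by linarith+
    then have "real (pref Y n) \<le> real (pref Z n) + 1" "real (pref Z n) \<le> real (pref Y n) + 1"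
      by (simp_all add: divide_le_cancel)
    then show "near (pref Y n) (pref Z n)" by (simp add: near_def)
  qed
  moreover have "\<mu> {X. near (pref X n) (pref Z n) \<and> X \<in> UNIV} \<le> 5 * (1 / 2) ^ n"
    by (rule measure_near_le) (simp_all add: measure_cyl_le sets.top[of cantor_measure, simplified])
  then have "\<mu> ?V < \<epsilon>" using n by simp
  ultimately show "\<exists>V. sig1 A V \<and> {Y. binary_real Y = binary_real Z} \<subseteq> V \<and> \<mu> V < \<epsilon>" by blast
qed

lemma small_cover_subset: "small_cover A N \<Longrightarrow> M \<subseteq> N \<Longrightarrow> small_cover A M"
  unfolding small_cover_def by (meson order_trans)

lemma small_cover_vimage_singleton: "small_cover A {Y. binary_real Y = q}"
proof (cases "\<exists>Z. binary_real Z = q")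
  case True
  then show ?thesis using small_cover_fibre by blast
next
  case False
  then have "{Y. binary_real Y = q} = {}" by blast
  then show ?thesis by (metis empty_subsetI small_cover_subset small_cover_fibre)
qed

lemma small_cover_ml_test:
  assumes "ml_test A U" shows "small_cover A (\<Inter>n. U n)"
  unfolding small_cover_def
proof (intro allI impI)
  fix \<epsilon> :: real assume "\<epsilon> > 0"
  then obtain n where n: "(1 / 2 :: real) ^ n < \<epsilon>" using real_arch_pow_inv[of \<epsilon> "1 / 2"] by auto
  have "copen A U" "\<mu> (U n) \<le> (1 / 2) ^ n" using assms by (auto simp: ml_test_iff)
  then have "sig1 A (U n)" "\<mu> (U n) < \<epsilon>" using n by (auto intro: sig1_copen)
  then show "\<exists>V. sig1 A V \<and> (\<Inter>n. U n) \<subseteq> V \<and> \<mu> V < \<epsilon>" by blast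
qed

definition nondyadic :: "(nat \<Rightarrow> bool) \<Rightarrow> bool" where
  "nondyadic X \<longleftrightarrow> (\<forall>m n. binary_real X \<noteq> real m / 2 ^ n)"

text \<open>
  If \<open>X\<close> escapes the open set \<open>V\<close> below, then every cylinder near \<open>X\<close> of length at least \<open>s\<close>
  meets the part of the complement of \<open>C\<close> enumerated after stage \<open>s\<close> in relative measure at
  most \<open>2\<^sup>-\<^sup>j\<close>, and the part enumerated before stage \<open>s\<close> has positive distance from \<open>X\<close>.
\<close>

lemma small_cover_density:
  assumes C: "effectively_closed A C"
  shows "small_cover A {X. nondyadic X \<and> binary_real X \<in> C \<and> \<not> density_ge C (binary_real X) (1 - 5 / 2 ^ j)}"
    (is "small_cover A ?N")
  unfolding small_cover_def
proof (intro allI impI)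
  fix \<epsilon> :: real assume \<epsilon>: "\<epsilon> > 0"
  note bC = borel_effectively_closed[OF C]
  have sC: "C \<subseteq> {0..1}" using C by (auto simp: effectively_closed_def)
  let ?G = "{X. binary_real X \<notin> C}"
  obtain D where D: "dec A (\<lambda>p. D (fst p) (snd p))"
    "\<And>i j m. D i (m div 2 ^ (j - i)) \<Longrightarrow> i \<le> j \<Longrightarrow> D j m"
    "?G = {X. \<exists>n. D n (pref X n)}"
    by (rule sig1_witness[OF sig1_complement[OF C]]) (rule that)
  have mono: "D j (pref X j)" if "D i (pref X i)" "i \<le> j" for i j X
    using D(2)[of i "pref X j" j] that by (simp add: pref_div)
  have G: "?G \<in> sets cantor_measure" unfolding D(3) by simp
  define H where "H s = ?G - {X. D s (pref X s)}" for s
  have mH: "H s \<in> sets cantor_measure" for s unfolding H_def using G by auto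
  have "(\<lambda>s. \<mu> (H s)) \<longlonglongrightarrow> \<mu> (\<Inter>s. H s)"
  proof (rule cantor.finite_Lim_measure_decseq)
    show "decseq H" unfolding H_def
      by (rule decseq_SucI) (use mono in \<open>auto simp del: pref.simps\<close>)
  qed (use mH in auto)
  also have "(\<Inter>s. H s) = {}" unfolding H_def D(3) by auto
  finally have "(\<lambda>s. \<mu> (H s)) \<longlonglongrightarrow> 0" by simp
  \<comment> \<open>\<open>5 * 2 ^ j\<close> is the factor in
    \<open>maximal_inequality\<close>.\<close>
  from order_tendstoD(2)[OF this, of "\<epsilon> / (5 * 2 ^ j)"] \<epsilon>
  obtain s where s: "\<mu> (H s) < \<epsilon> / (5 * 2 ^ j)" by (auto simp: eventually_sequentially)
  define S where "S n m \<longleftrightarrow> s \<le> n \<and> (1 / 2) ^ (n + j) < \<mu> (cyl n m \<inter> H s)" for n m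
  let ?V = "{X. \<exists>n m. S n m \<and> near (pref X n) m}"
  have "sig1 A ?V"
  proof (rule sig1I)
    have "copen A (\<lambda>p. cyl (fst p) (snd p) \<inter> H s)"
    proof (rule copenI)
      show "re A (\<lambda>p::(nat \<times> nat) \<times> nat \<times> nat.
        fst (fst p) \<le> fst (snd p) \<and> s \<le> fst (snd p) \<and>
        snd (snd p) div 2 ^ (fst (snd p) - fst (fst p)) = snd (fst p) \<and>
        D (fst (snd p)) (snd (snd p)) \<and> \<not> D s (snd (snd p) div 2 ^ (fst (snd p) - s)))"
        by (intro re_dec rc_intros dec_comp2[OF D(1)])
      fix q :: "nat \<times> nat"
      obtain n m where q: "q = (n, m)" by (cases q)
      have "X \<in> cyl n m \<inter> H s \<longleftrightarrow> (\<exists>t. n \<le> t \<and> s \<le> t \<and> pref X t div 2 ^ (t - n) = m \<and>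
          D t (pref X t) \<and> \<not> D s (pref X t div 2 ^ (t - s)))" for X
      proof
        assume X: "X \<in> cyl n m \<inter> H s"
        then obtain u where u: "D u (pref X u)" unfolding H_def D(3) by blast
        let ?t = "u + n + s"
        have "D ?t (pref X ?t)" by (rule mono[OF u]) simp
        with X pref_div[of n ?t X] pref_div[of s ?t X] show "\<exists>t. n \<le> t \<and> s \<le> t \<and> pref X t div 2 ^ (t - n) = m \<and>
          D t (pref X t) \<and> \<not> D s (pref X t div 2 ^ (t - s))"
          by (intro exI[of _ ?t]) (simp add: cyl_def H_def)
      next
        assume "\<exists>t. n \<le> t \<and> s \<le> t \<and> pref X t div 2 ^ (t - n) = m \<and>
          D t (pref X t) \<and> \<not> D s (pref X t div 2 ^ (t - s))"
        then obtain t where "n \<le> t" "s \<le> t" "pref X t div 2 ^ (t - n) = m"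
          "D t (pref X t)" "\<not> D s (pref X t div 2 ^ (t - s))" by blast
        then show "X \<in> cyl n m \<inter> H s" unfolding H_def D(3) by (auto simp: pref_div cyl_def)
      qed
      then show "cyl (fst q) (snd q) \<inter> H s = {X. \<exists>t. fst q \<le> t \<and> s \<le> t \<and>
          pref X t div 2 ^ (t - fst q) = snd q \<and>
          D t (pref X t) \<and> \<not> D s (pref X t div 2 ^ (t - s))}"
        unfolding q fst_conv snd_conv by blast
    qed
    then have "re A (\<lambda>p. (1 / 2) ^ (fst p + j) < \<mu> (cyl (fst p) (snd p) \<inter> H s))"
      by (rule re_measure_greater) (intro rc_intros)
    from re_conj[OF re_dec this, of "\<lambda>p. s \<le> fst p"] have "re A (\<lambda>p. S (fst p) (snd p))"
      unfolding S_def by (simp add: rc_intros)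
    then show "re A (\<lambda>p. \<exists>m. S (fst p) m \<and> near (snd p) m)"
      unfolding near_def by (intro re_ex re_conj re_comp2[OF \<open>re A (\<lambda>p. S (fst p) (snd p))\<close>] re_dec rc_intros)
  qed simp
  moreover have "\<mu> ?V < \<epsilon>"
  proof -
    have "\<mu> ?V \<le> 5 * 2 ^ j * \<mu> (H s)"
      by (rule maximal_inequality[OF mH]) (simp add: S_def)
    also have "\<dots> < \<epsilon>" using s by (simp add: field_simps)
    finally show ?thesis .
  qed
  moreover have "?N \<subseteq> ?V"
  proof
    fix X assume X: "X \<in> ?N"
    let ?z = "binary_real X"
    let ?p = "pref X s"
    show "X \<in> ?V"
    proof (rule ccontr)
      assume nV: "X \<notin> ?V"
      \<comment> \<open>The distance from the ends of the dyadic interval of the first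
        \<open>s\<close> bits, positive because \<open>X\<close> is nondyadic. All expansions of
        points within distance \<open>e\<close> share these bits, and since \<open>X\<close> is not
        enumerated by stage \<open>s\<close>, neither are they.\<close>
      define e where "e = min (?z - real ?p / 2 ^ s) ((real ?p + 1) / 2 ^ s - ?z)"
      have "?z \<noteq> real ?p / 2 ^ s" "?z \<noteq> real (Suc ?p) / 2 ^ s"
        using X unfolding nondyadic_def by blast+
      then have "e > 0" using binary_real_bounds[of X s] by (auto simp: e_def add.commute)
      have "density_ge C ?z (1 - 5 / 2 ^ j)" unfolding density_ge_iff
      proof (rule eventually_right_prod[OF \<open>e > 0\<close>])
        fix \<gamma> \<delta> :: real assume gd: "0 < \<gamma>" "\<gamma> < e" "0 < \<delta>" "\<delta> < e"
        let ?J = "{?z - \<gamma>..?z + \<delta>}"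
        let ?h = "\<gamma> + \<delta>"
        have lo: "real ?p / 2 ^ s < ?z - \<gamma>" and hi: "?z + \<delta> < (real ?p + 1) / 2 ^ s"
          using gd by (auto simp: e_def)
        have "?h < (1 / 2) ^ s" using lo hi by (simp add: add_divide_distrib power_one_over)
        have "0 \<le> real ?p / 2 ^ s" by simp
        moreover have "(real ?p + 1) / 2 ^ s \<le> 1"
        proof -
          have "real (Suc ?p) \<le> real (2 ^ s)" using pref_less[of X s] by (intro of_nat_mono) simp
          then show ?thesis by (simp add: divide_le_eq)
        qed
        ultimately have "0 \<le> ?z - \<gamma>" "?z + \<delta> \<le> 1" using lo hi by linarith+
        then have J01: "?J \<subseteq> {0..1}" by auto
        have pJ: "pref Y s = ?p" if "binary_real Y \<in> ?J" for Y
        proof -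
          have "real ?p / 2 ^ s < (real (pref Y s) + 1) / 2 ^ s" "real (pref Y s) / 2 ^ s < (real ?p + 1) / 2 ^ s"
            using that lo hi binary_real_bounds[of Y s] by auto
          then have "real ?p < real (pref Y s) + 1" "real (pref Y s) < real ?p + 1"
            by (simp_all add: divide_less_cancel)
          then show ?thesis by linarith
        qed
        have nD: "\<not> D s ?p" using X D(3) by blast
        \<comment> \<open>The scale of the interval: minimality of \<open>n\<close> gives
          \<open>(1 / 2) ^ n \<le> ?h < 2 * (1 / 2) ^ n\<close>, so that the interval is covered by
          cylinders near the prefix of \<open>X\<close>.\<close>
        define n where "n = (LEAST n. (1 / 2 :: real) ^ n \<le> ?h)"
        have "0 < ?h" using gd by simp
        from real_arch_pow_inv[OF this, of "1 / 2"] obtain n0 where "(1 / 2 :: real) ^ n0 < ?h" by auto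
        then have "(1 / 2 :: real) ^ n0 \<le> ?h" by (rule less_imp_le)
        then have n: "(1 / 2 :: real) ^ n \<le> ?h" unfolding n_def by (rule LeastI)
        have "s < n"
        proof (rule ccontr)
          assume "\<not> s < n"
          then have "(1 / 2 :: real) ^ s \<le> (1 / 2) ^ n" by (intro power_decreasing) auto
          with n \<open>?h < (1 / 2) ^ s\<close> show False by linarith
        qed
        then obtain n' where n': "n = Suc n'" by (cases n) auto
        have "n' < n" using n' by simp
        then have "\<not> (1 / 2 :: real) ^ n' \<le> ?h" unfolding n_def by (rule not_less_Least)
        then have h2: "?h < 2 * (1 / 2) ^ n" by (simp add: n')
        have sub: "{Y. binary_real Y \<in> ?J - C} \<subseteq> {Y. near (pref Y n) (pref X n) \<and> Y \<in> H s}"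
        proof (clarify, intro conjI)
          fix Y assume Y: "binary_real Y \<in> ?J" "binary_real Y \<notin> C"
          show "Y \<in> H s" using Y(2) nD pJ[OF Y(1)] by (simp add: H_def)
          have "real (pref Y n) / 2 ^ n < (real (pref X n) + 3) / 2 ^ n"
            "real (pref X n) / 2 ^ n < (real (pref Y n) + 3) / 2 ^ n"
            using Y(1) h2 gd binary_real_bounds[of Y n] binary_real_bounds[of X n]
            by (auto simp: add_divide_distrib power_one_over)
          then have "real (pref Y n) < real (pref X n) + 3" "real (pref X n) < real (pref Y n) + 3"
            by (simp_all add: divide_less_cancel)
          then show "near (pref Y n) (pref X n)" unfolding near_def by linarith
        qed
        have "measure lborel (?J - C) = \<mu> {Y. binary_real Y \<in> ?J - C}"
          using J01 bC by (intro measure_binary_real) auto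
        also have "\<dots> \<le> \<mu> {Y. near (pref Y n) (pref X n) \<and> Y \<in> H s}"
        proof (rule cantor.finite_measure_mono[OF sub])
          have "{Y. near (pref Y n) (pref X n) \<and> Y \<in> H s} = {Y. near (pref Y n) (pref X n)} \<inter> H s" by auto
          then show "{Y. near (pref Y n) (pref X n) \<and> Y \<in> H s} \<in> sets cantor_measure" using mH by auto
        qed
        \<comment> \<open>Escaping the open set bounds the trace of \<open>H s\<close> on every
          cylinder near the prefix of \<open>X\<close>, and there are at most five of them.\<close>
        also have "\<dots> \<le> 5 * (1 / 2) ^ (n + j)"
        proof (rule measure_near_le[OF mH])
          fix k assume "near k (pref X n)"
          then have "near (pref X n) k" by (auto simp: near_def)
          with nV have "\<not> S n k" by blast
          with \<open>s < n\<close> show "\<mu> (cyl n k \<inter> H s) \<le> (1 / 2) ^ (n + j)" by (simp add: S_def)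
        qed
        also have "5 * (1 / 2 :: real) ^ (n + j) = 5 / 2 ^ j * (1 / 2) ^ n" by (simp add: power_add power_one_over)
        also have "\<dots> \<le> 5 / 2 ^ j * ?h" using n by (intro mult_left_mono) auto
        finally have le: "measure lborel (?J - C) \<le> 5 / 2 ^ j * ?h" .
        have "measure lborel (?J - (?J - C)) = measure lborel ?J - measure lborel (?J - C)"
          using bC gd by (intro measurable_measure_Diff) (auto simp: fmeasurable_def emeasure_lborel_Icc_eq)
        moreover have "?J - (?J - C) = ?J \<inter> C" by auto
        ultimately have "?h - 5 / 2 ^ j * ?h \<le> measure lborel (?J \<inter> C)" using le gd by simp
        then have "(1 - 5 / 2 ^ j) * ?h \<le> measure lborel (?J \<inter> C)" by (simp add: algebra_simps)
        then show "1 - 5 / 2 ^ j \<le> measure lborel ({?z - fst (\<gamma>, \<delta>)..?z + snd (\<gamma>, \<delta>)} \<inter> C) /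
            (fst (\<gamma>, \<delta>) + snd (\<gamma>, \<delta>))"
          using gd by (simp add: pos_le_divide_eq)
      qed
      with X show False by blast
    qed
  qed
  ultimately show "\<exists>V. sig1 A V \<and> ?N \<subseteq> V \<and> \<mu> V < \<epsilon>" by blast
qed

section \<open>Countably many null sets for density randomness\<close>

instance prog :: countable by countable_datatype

lemma countable_ce: "countable {W. ce_in A W}"
proof -
  have "{W. ce_in A W} = range (\<lambda>p. {n. \<exists>y. computes A p [n] y})" by (auto simp: ce_in_def)
  then show ?thesis by simp
qed

lemma countable_ml_tests: "countable {U. ml_test A U}"
proof (rule countable_subset)
  show "{U. ml_test A U} \<subseteq> (\<lambda>W n. \<Union>\<sigma>\<in>{\<sigma>. prod_encode (n, string_code \<sigma>) \<in> W}. cylinder \<sigma>) ` {W. ce_in A W}"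
    by (auto simp: ml_test_def fun_eq_iff image_iff)
qed (intro countable_image countable_ce)

lemma countable_effectively_closed: "countable {C. effectively_closed A C}"
proof (rule countable_subset)
  show "{C. effectively_closed A C} \<subseteq> (\<lambda>W. {0..1} - (\<Union>c\<in>W. interval_of_code c)) ` {W. ce_in A W}"
    by (auto simp: effectively_closed_def image_iff)
qed (intro countable_image countable_ce)

lemma density_random_small_covers:
  obtains N :: "nat \<Rightarrow> (nat \<Rightarrow> bool) set"
  where "\<And>i. small_cover A (N i)" "\<And>X. (\<And>i. X \<notin> N i) \<Longrightarrow> density_random A X"
proof -
  define d where "d C j = {X. nondyadic X \<and> binary_real X \<in> C \<and> \<not> density_ge C (binary_real X) (1 - 5 / 2 ^ j)}"
    for C and j :: nat
  \<comment> \<open>The fibres over dyadic rationals are included because the sets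
    \<open>d C j\<close> speak of nondyadic sequences only.\<close>
  define \<N> where "\<N> = (\<lambda>U. \<Inter>n. U n) ` {U. ml_test A U} \<union>
    (\<lambda>(m, n). {Y. binary_real Y = real m / 2 ^ n}) ` (UNIV :: (nat \<times> nat) set) \<union>
    (\<lambda>(C, j). d C j) ` ({C. effectively_closed A C} \<times> UNIV)"
  have ne: "\<N> \<noteq> {}" by (auto simp: \<N>_def)
  have co: "countable \<N>" unfolding \<N>_def
    by (intro countable_Un countable_image countable_SIGMA countable_ml_tests countable_effectively_closed) auto
  have sm: "small_cover A M" if "M \<in> \<N>" for M
    using that small_cover_ml_test small_cover_vimage_singleton small_cover_density unfolding \<N>_def d_def by auto
  show thesis
  proof (rule that[of "from_nat_into \<N>"])
    show "small_cover A (from_nat_into \<N> i)" for i by (rule sm[OF from_nat_into[OF ne]])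
    fix X assume X: "\<And>i. X \<notin> from_nat_into \<N> i"
    have nX: "X \<notin> M" if "M \<in> \<N>" for M
      using X from_nat_into_surj[OF co that] by blast
    have "ml_random A X" unfolding ml_random_def
    proof (intro allI impI)
      fix U assume "ml_test A U"
      then have "(\<Inter>n. U n) \<in> \<N>" unfolding \<N>_def by blast
      then show "X \<notin> (\<Inter>n. U n)" by (rule nX)
    qed
    moreover have nd: "nondyadic X" unfolding nondyadic_def
    proof (intro allI)
      fix m n
      have "{Y. binary_real Y = real m / 2 ^ n} \<in> \<N>" unfolding \<N>_def by auto
      from nX[OF this] show "binary_real X \<noteq> real m / 2 ^ n" by simp
    qed
    moreover have "lower_density C (binary_real X) = 1" if C: "effectively_closed A C" "binary_real X \<in> C" for C
      unfolding lower_density_eq_1_iff[OF borel_effectively_closed[OF C(1)]]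
    proof (intro allI impI)
      fix r :: real assume "r < 1"
      then obtain j where j: "(1 / 2 :: real) ^ j < (1 - r) / 5"
        using real_arch_pow_inv[of "(1 - r) / 5" "1 / 2"] by auto
      have "d C j \<in> \<N>" using C(1) unfolding \<N>_def by auto
      from nX[OF this] have "density_ge C (binary_real X) (1 - 5 / 2 ^ j)"
        using nd C(2) by (simp add: d_def)
      moreover have "r \<le> 1 - 5 / 2 ^ j" using j by (simp add: power_one_over)
      ultimately show "density_ge C (binary_real X) r"
        unfolding density_ge_iff by (auto elim!: eventually_mono)
    qed
    ultimately show "density_random A X" unfolding density_random_def by blast
  qed
qed

section \<open>Lowness\<close>

text \<open>All levels of the family are coded into one set \<open>W\<close> of triples, weighted by
  string length alone. For each \<open>i\<close> the minimal strings have disjoint cylinders inside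
  \<open>U i\<close>, so the total weight is at most \<open>K\<close>. The cover again has finite
  weight, hence Solovay's criterion relative to \<open>B\<close> leaves only finitely many of its
  strings on a \<open>B\<close>-random sequence.\<close>

lemma lowness_cover:
  fixes U :: "nat \<Rightarrow> (nat \<Rightarrow> bool) set"
  assumes low: "\<And>X. density_random B X \<Longrightarrow> ml_random A X"
    and U: "copen A U" and fin: "\<And>k. (\<Sum>i<k. \<mu> (U i)) \<le> K"
  obtains D R where "re B (\<lambda>p. R (fst p) (fst (snd p)) (snd (snd p)))"
    "\<And>i n m. minimal (D i) n m \<Longrightarrow> m < 2 ^ n \<Longrightarrow> R i n m"
    "\<And>i. U i = {X. \<exists>n. D i n (pref X n)}"
    "\<And>Z. ml_random B Z \<Longrightarrow> finite {(i, n). R i n (pref Z n)}"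
proof -
  obtain D where D: "dec A (\<lambda>p. D (fst p) (fst (snd p)) (snd (snd p)))"
    "\<And>i. U i = {X. \<exists>n. D i n (pref X n)}"
    by (rule copen_witness[OF U]) (rule that)
  obtain N :: "nat \<Rightarrow> _" where N: "\<And>i. small_cover B (N i)" "\<And>X. (\<And>i. X \<notin> N i) \<Longrightarrow> density_random B X"
    using density_random_small_covers[of B] by blast
  let ?s = "\<lambda>c. snd (prod_decode c)"
  \<comment> \<open>The bound on \<open>strval e\<close> ensures that the pair denotes an actual
    string, whose weight equals the measure of its cylinder.\<close>
  define M where "M i e \<longleftrightarrow> minimal (D i) (strlen e) (strval e) \<and> strval e < 2 ^ strlen e" for i e
  define W where "W = {c. M (fst (prod_decode c)) (?s c)}"
  have D': "dec A (\<lambda>x. D (f x) (g x) (h x))" if "rc A f" "rc A g" "rc A h" for f g h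
    using dec_comp[OF D(1), of "\<lambda>x. (f x, g x, h x)"] that by (simp add: rc_Pair)
  have "re A (\<lambda>c. M (fst (prod_decode c)) (?s c))"
    unfolding M_def minimal_def by (intro re_dec rc_intros D')
  then have W: "re A (\<lambda>c. c \<in> W)" unfolding W_def mem_Collect_eq .
  have wU: "(\<Sum>e<k. of_bool (M i e) * (1 / 2 :: real) ^ strlen e) \<le> \<mu> (U i)" for i k
  proof -
    have "(\<Sum>e<k. of_bool (M i e) * (1 / 2 :: real) ^ strlen e) = (\<Sum>e<k. if M i e then (1 / 2) ^ strlen e else 0)"
      by (intro sum.cong) auto
    also have "\<dots> = (\<Sum>e\<in>{e\<in>{..<k}. M i e}. (1 / 2) ^ strlen e)"
      by (rule sum.inter_filter[symmetric]) simp
    also have "\<dots> = (\<Sum>e\<in>{e\<in>{..<k}. M i e}. \<mu> (cyl (strlen e) (strval e) \<inter> U i))"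
    proof (rule sum.cong)
      fix e assume e: "e \<in> {e\<in>{..<k}. M i e}"
      then have "D i (strlen e) (strval e)" by (simp add: M_def minimal_def)
      then have "cyl (strlen e) (strval e) \<inter> U i = cyl (strlen e) (strval e)"
        unfolding D(2) cyl_def by (intro Int_absorb2 subsetI) (simp, metis)
      with e show "(1 / 2) ^ strlen e = \<mu> (cyl (strlen e) (strval e) \<inter> U i)"
        by (simp add: M_def measure_cyl)
    qed simp
    also have "\<dots> \<le> \<mu> (U i)"
      by (rule sum_minimal_le[of _ _ "D i"]) (use sets_copen[OF U] in \<open>auto simp: M_def\<close>)
    finally show ?thesis .
  qed
  have "(\<Sum>c<k. of_bool (c \<in> W) * (1 / 2 :: real) ^ strlen (?s c)) \<le> K" for k
  proof -
    let ?f = "\<lambda>(i, e). of_bool (M i e) * (1 / 2 :: real) ^ strlen e"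
    have "(\<Sum>c<k. of_bool (c \<in> W) * (1 / 2 :: real) ^ strlen (?s c)) = (\<Sum>c<k. ?f (prod_decode c))"
      by (simp add: W_def case_prod_unfold)
    also have "\<dots> = (\<Sum>p\<in>prod_decode ` {..<k}. ?f p)"
      by (subst sum.reindex) (auto simp: inj_on_def prod_decode_eq)
    \<comment> \<open>A code below \<open>k\<close> has both components below \<open>k\<close>, so
      the sum over codes is dominated by a sum over a square.\<close>
    also have "\<dots> \<le> (\<Sum>p\<in>{..<k} \<times> {..<k}. ?f p)"
    proof (rule sum_mono2)
      have "fst (prod_decode c) < k \<and> snd (prod_decode c) < k" if "c < k" for c
        using that le_prod_encode_1[of "fst (prod_decode c)" "snd (prod_decode c)"]
          le_prod_encode_2[of "snd (prod_decode c)" "fst (prod_decode c)"] by simp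
      then show "prod_decode ` {..<k} \<subseteq> {..<k} \<times> {..<k}"
        by (intro image_subsetI) (simp only: mem_Times_iff lessThan_iff)
    qed (simp_all add: case_prod_unfold)
    also have "\<dots> = (\<Sum>i<k. \<Sum>e<k. of_bool (M i e) * (1 / 2 :: real) ^ strlen e)"
      by (simp only: sum.cartesian_product)
    also have "\<dots> \<le> (\<Sum>i<k. \<mu> (U i))" by (intro sum_mono wU)
    also have "\<dots> \<le> K" by (rule fin)
    finally show ?thesis .
  qed
  note wW = this
  have len: "rc X (\<lambda>c. strlen (?s c))" for X by (intro rc_intros)
  obtain W' K' where W': "re B (\<lambda>e. e \<in> W')" "W \<subseteq> W'"
    "\<And>k. (\<Sum>c<k. of_bool (c \<in> W') * (1 / 2 :: real) ^ strlen (?s c)) \<le> K'"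
    by (rule finite_weight_cover[OF N(1) low[OF N(2)] len len W wW]) (assumption, rule that)
  show thesis
  proof (rule that[of "\<lambda>i n m. prod_encode (i, prod_encode (n, m)) \<in> W'" D])
    show "re B (\<lambda>p. prod_encode (fst p, prod_encode (fst (snd p), snd (snd p))) \<in> W')"
      by (intro re_comp[OF W'(1)] rc_intros)
    show "prod_encode (i, prod_encode (n, m)) \<in> W'" if "minimal (D i) n m" "m < 2 ^ n" for i n m
    proof -
      have "prod_encode (i, prod_encode (n, m)) \<in> W" using that by (simp add: W_def M_def)
      with W'(2) show ?thesis by blast
    qed
    show "U i = {X. \<exists>n. D i n (pref X n)}" for i by (rule D(2))
    fix Z assume Z: "ml_random B Z"
    define S where "S c = {X. c \<in> W' \<and> pref X (strlen (?s c)) = strval (?s c)}" for c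
    have "copen B S"
    proof (rule copenI)
      show "re B (\<lambda>p. fst p \<in> W' \<and> fst (snd p) = strlen (?s (fst p)) \<and> snd (snd p) = strval (?s (fst p)))"
        by (intro re_conj re_comp[OF W'(1)] re_dec rc_intros)
      show "S c = {X. \<exists>n. c \<in> W' \<and> n = strlen (?s c) \<and> pref X n = strval (?s c)}" for c
        by (auto simp: S_def)
    qed
    moreover have "(\<Sum>c<k. \<mu> (S c)) \<le> K'" for k
    proof -
      have "\<mu> (S c) \<le> of_bool (c \<in> W') * (1 / 2) ^ strlen (?s c)" for c
        using measure_cyl_le[of "strlen (?s c)" "strval (?s c)"] by (simp add: S_def cyl_def)
      then have "(\<Sum>c<k. \<mu> (S c)) \<le> (\<Sum>c<k. of_bool (c \<in> W') * (1 / 2) ^ strlen (?s c))"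
        by (intro sum_mono)
      also have "\<dots> \<le> K'" by (rule W'(3))
      finally show ?thesis .
    qed
    ultimately have f: "finite {c. Z \<in> S c}" using solovay[of B S K' Z] Z by blast
    have "(\<lambda>(i, n). prod_encode (i, prod_encode (n, pref Z n))) `
      {(i, n). prod_encode (i, prod_encode (n, pref Z n)) \<in> W'} \<subseteq> {c. Z \<in> S c}"
      by (auto simp: S_def)
    from finite_subset[OF this f] show "finite {(i, n). prod_encode (i, prod_encode (n, pref Z n)) \<in> W'}"
      by (rule finite_imageD) (auto simp: inj_on_def)
  qed
qed

text \<open>A sequence in every level has, for each \<open>i\<close>, a minimal prefix in the cover;
  these are infinitely many pairs, against the finiteness in \<open>lowness_cover\<close>.\<close>

lemma low_for_mlI:
  assumes low: "\<And>X. density_random B X \<Longrightarrow> ml_random A X" and Z: "ml_random B Z"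
  shows "ml_random A Z"
  unfolding ml_random_def
proof (intro allI impI notI)
  fix U assume "ml_test A U" and ZU: "Z \<in> (\<Inter>n. U n)"
  then have U: "copen A U" "\<And>n. \<mu> (U n) \<le> (1 / 2) ^ n" by (auto simp: ml_test_iff)
  have w: "(\<Sum>i<k. \<mu> (U i)) \<le> 2" for k
  proof -
    have "(\<Sum>i<k. \<mu> (U i)) \<le> (\<Sum>i<k. (1 / 2) ^ i)" by (intro sum_mono U(2))
    also have "\<dots> \<le> 2" by (subst sum_gp_strict) simp
    finally show ?thesis .
  qed
  obtain D R where R:
    "\<And>i n m. minimal (D i) n m \<Longrightarrow> m < 2 ^ n \<Longrightarrow> R i n m"
    "\<And>i. U i = {X. \<exists>n. D i n (pref X n)}"
    "\<And>Z. ml_random B Z \<Longrightarrow> finite {(i :: nat, n). R i n (pref Z n)}"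
    by (rule lowness_cover[OF low U(1) w]) (assumption, rule that)
  have "\<exists>n. R i n (pref Z n)" for i
  proof -
    have "Z \<in> U i" using ZU by blast
    then obtain n where n: "D i n (pref Z n)" unfolding R(2) by blast
    then obtain k where k: "k \<le> n" "minimal (D i) k (pref Z n div 2 ^ (n - k))" by (rule minimal_prefix)
    then have "R i k (pref Z k)" by (intro R(1) pref_less) (simp add: pref_div)
    then show ?thesis ..
  qed
  then have "UNIV \<subseteq> fst ` {(i, n). R i n (pref Z n)}" by force
  from finite_subset[OF this finite_imageI[OF R(3)[OF Z]]] show False by simp
qed

lemma lower_density_mono_eq_1:
  assumes "C \<in> sets borel" "D \<in> sets borel" "countable Q" "D - Q \<subseteq> C" "lower_density D z = 1"
  shows "lower_density C z = 1"
proof -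
  have Q: "Q \<in> null_sets lborel" by (rule countable_imp_null_set_lborel[OF assms(3)])
  have le: "measure lborel (J \<inter> D) \<le> measure lborel (J \<inter> C)" if "J = {a..b}" for a b :: real and J
  proof -
    have f: "J \<in> fmeasurable lborel" using that by (simp add: fmeasurable_def emeasure_lborel_Icc_eq)
    have "measure lborel (J \<inter> D) = measure lborel (J \<inter> D - Q)"
      using Q f assms(2) by (intro measure_Diff_null_set[symmetric]) auto
    also have "\<dots> \<le> measure lborel (J \<inter> C)"
      using f assms Q by (intro measure_mono_fmeasurable fmeasurable_Int_fmeasurable) auto
    finally show ?thesis .
  qed
  show ?thesis unfolding lower_density_eq_1_iff[OF assms(1)]
  proof (intro allI impI)
    fix r :: real assume "r < 1"
    with assms(5) have "density_ge D z r" using lower_density_eq_1_iff[OF assms(2)] by blast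
    moreover have "\<forall>\<^sub>F p in at_right (0::real) \<times>\<^sub>F at_right (0::real). 0 < fst p + snd p"
      by (rule eventually_right_prod[of 1]) auto
    ultimately show "density_ge C z r" unfolding density_ge_iff
    proof eventually_elim
      case (elim p)
      note elim(1)
      also have "measure lborel ({z - fst p..z + snd p} \<inter> D) / (fst p + snd p) \<le>
        measure lborel ({z - fst p..z + snd p} \<inter> C) / (fst p + snd p)"
        using elim(2) by (intro divide_right_mono le[OF refl]) simp
      finally show ?case .
    qed
  qed
qed

lemma low_for_densityI:
  assumes low: "\<And>X. density_random B X \<Longrightarrow> ml_random A X" and Z: "density_random B Z"
  shows "density_random A Z"
  unfolding density_random_def
proof (intro conjI allI impI)
  show "ml_random A Z" by (rule low[OF Z])
next
  fix C assume C: "effectively_closed A C \<and> binary_real Z \<in> C"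
  let ?z = "binary_real Z"
  \<comment> \<open>A single open set, padded with empty levels to fit the family format of
    \<open>lowness_cover\<close>.\<close>
  let ?U = "\<lambda>i::nat. if i = 0 then {X. binary_real X \<notin> C} else {}"
  have U: "copen A ?U"
  proof -
    obtain E where E: "dec A (\<lambda>p. E (fst p) (snd p))" "{X. binary_real X \<notin> C} = {X. \<exists>n. E n (pref X n)}"
      by (rule sig1_witness[OF sig1_complement[OF conjunct1[OF C]]]) (rule that)
    show ?thesis
    proof (rule copenI)
      show "re A (\<lambda>p. fst p = (0::nat) \<and> E (fst (snd p)) (snd (snd p)))"
        by (intro re_dec rc_intros dec_comp2[OF E(1)])
    qed (use E(2) in auto)
  qed
  have w: "(\<Sum>i<k. \<mu> (?U i)) \<le> 1" for k
  proof -
    have "(\<Sum>i<k. \<mu> (?U i)) = (\<Sum>i<k. if i = 0 then \<mu> {X. binary_real X \<notin> C} else 0)"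
      by (intro sum.cong) auto
    also have "\<dots> \<le> 1" by (cases k) (simp_all add: sum.delta)
    finally show ?thesis .
  qed
  obtain D R where R: "re B (\<lambda>p :: nat \<times> nat \<times> nat. R (fst p) (fst (snd p)) (snd (snd p)))"
    "\<And>i n m. minimal (D i) n m \<Longrightarrow> m < 2 ^ n \<Longrightarrow> R i n m"
    "\<And>i. ?U i = {X. \<exists>n. D i n (pref X n)}"
    "\<And>Z. ml_random B Z \<Longrightarrow> finite {(i, n). R i n (pref Z n)}"
    by (rule lowness_cover[OF low U w]) (assumption, rule that)
  have G: "binary_real X \<notin> C \<longleftrightarrow> (\<exists>n. D 0 n (pref X n))" for X using R(3)[of 0] by auto
  have "{n. R 0 n (pref Z n)} \<subseteq> snd ` {(i, n). R i n (pref Z n)}" by force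
  moreover have "ml_random B Z" using Z by (simp add: density_random_def)
  ultimately have fin: "finite {n. R 0 n (pref Z n)}" using R(4) finite_surj by blast
  \<comment> \<open>Exceeds the lengths of all prefixes of \<open>Z\<close> in the cover;
    \<open>0\<close> only keeps \<open>Max\<close> defined on an empty set.\<close>
  define b where "b = Suc (Max (insert 0 {n. R 0 n (pref Z n)}))"
  have b: "n < b" if "R 0 n (pref Z n)" for n
    unfolding b_def using fin that by (simp add: less_Suc_eq_le)
  \<comment> \<open>Prefixes of \<open>Z\<close> shorter than \<open>b\<close> are recognised from
    the constant \<open>pref Z b\<close>, so the deletion is decidable and \<open>R'\<close> stays
    \<open>B\<close>-enumerable.\<close>
  define R' where "R' n m \<longleftrightarrow> R 0 n m \<and> \<not> (n < b \<and> m = pref Z b div 2 ^ (b - n))" for n m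
  have nZ: "\<not> R' n (pref Z n)" for n
    using b[of n] pref_div[of n b Z] by (auto simp: R'_def)
  have re': "re B (\<lambda>p. R' (fst p) (snd p))"
    unfolding R'_def
    by (intro re_conj re_dec rc_intros re_comp[OF R(1), of "\<lambda>p. (0, p)", simplified])
  define F where "F = {0..1} - {x. \<exists>n m. R' n m \<and> x \<in> {real m / 2 ^ n<..<(real m + 1) / 2 ^ n}}"
  have F: "effectively_closed B F" unfolding F_def by (rule effectively_closed_dyadic[OF re'])
  have in_pref: "m = pref X n" if "binary_real X \<in> {real m / 2 ^ n<..<(real m + 1) / 2 ^ n}" for X n m
  proof -
    have "real m / 2 ^ n < (real (pref X n) + 1) / 2 ^ n" "real (pref X n) / 2 ^ n < (real m + 1) / 2 ^ n"
      using that binary_real_bounds[of X n] by auto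
    then have "real m < real (pref X n) + 1" "real (pref X n) < real m + 1"
      by (simp_all add: divide_less_cancel)
    then show ?thesis by linarith
  qed
  have "?z \<in> F" using nZ in_pref binary_real_range[of Z] unfolding F_def by blast
  with Z F have "lower_density F ?z = 1" by (auto simp: density_random_def)
  moreover have "F - range (\<lambda>(m::nat, n::nat). real m / 2 ^ n) \<subseteq> C"
  proof
    fix x assume x: "x \<in> F - range (\<lambda>(m::nat, n::nat). real m / 2 ^ n)"
    then have nd: "x \<noteq> real m / 2 ^ n" for m n :: nat by auto
    \<comment> \<open>\<open>nd\<close> with \<open>1 / 2 ^ 0\<close> excludes the point
      \<open>1\<close>, to which \<open>binary_real_surj\<close> does not apply.\<close>
    from nd[of 1 0] x have "x \<in> {0..<1}" by (auto simp: F_def)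
    then obtain X where X: "binary_real X = x" using binary_real_surj by blast
    show "x \<in> C"
    proof (rule ccontr)
      assume "x \<notin> C"
      then obtain n where n: "D 0 n (pref X n)" using G X by blast
      then obtain k where k: "k \<le> n" "minimal (D 0) k (pref X n div 2 ^ (n - k))" by (rule minimal_prefix)
      then have D: "minimal (D 0) k (pref X k)" by (simp add: pref_div)
      \<comment> \<open>The minimal string below \<open>X\<close> was not deleted: as a prefix of
        \<open>Z\<close> it would place \<open>Z\<close> in the complement of
        \<open>C\<close>.\<close>
      have "\<not> (k < b \<and> pref X k = pref Z b div 2 ^ (b - k))"
      proof
        assume "k < b \<and> pref X k = pref Z b div 2 ^ (b - k)"
        then have "D 0 k (pref Z k)" using D by (simp add: pref_div minimal_def)
        then show False using G C by blast
      qed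
      then have "R' k (pref X k)" using R(2)[OF D pref_less] by (simp add: R'_def)
      moreover have "x \<in> {real (pref X k) / 2 ^ k<..<(real (pref X k) + 1) / 2 ^ k}"
        using binary_real_bounds[of X k] nd[of "pref X k" k] nd[of "Suc (pref X k)" k] X
        by (simp add: add.commute less_le)
      ultimately show False using x unfolding F_def by blast
    qed
  qed
  moreover have "C \<in> sets borel" "F \<in> sets borel" using C F borel_effectively_closed by auto
  ultimately show "lower_density C ?z = 1"
    using lower_density_mono_eq_1[of C F "range (\<lambda>(m::nat, n::nat). real m / 2 ^ n)" ?z] by simp
qed

theorem theorem2p6:
  fixes A :: "nat \<Rightarrow> bool"
  shows "low_for_ml_randomness A \<longleftrightarrow> low_for_density_randomness A"
proof
  assume "low_for_ml_randomness A"
  then have "\<And>X. density_random empty_oracle X \<Longrightarrow> ml_random A X"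
    by (auto simp: low_for_ml_randomness_def density_random_def)
  from low_for_densityI[OF this] show "low_for_density_randomness A"
    unfolding low_for_density_randomness_def by blast
next
  assume "low_for_density_randomness A"
  then have "\<And>X. density_random empty_oracle X \<Longrightarrow> ml_random A X"
    by (auto simp: low_for_density_randomness_def density_random_def)
  from low_for_mlI[OF this] show "low_for_ml_randomness A"
    unfolding low_for_ml_randomness_def by blast
qed

end
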